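(* Let $P$ be a finite connected ordered set with at least $4$ elements and let $r>0$ be an integer. Then the deck $\mathcal{N}_P^r:=\langle P\setminus\{x\}: x\in P\setminus\max(P),\ \mathrm{rank}(x)=r\rangle$ of cards obtained by removing nonmaximal points of rank $r$ is reconstructible; that is, for every ordered set $Q$ with $\mathcal{D}_Q=\mathcal{D}_P$ we have $\mathcal{N}_Q^r=\mathcal{N}_P^r$. Consequently, the deck $\langle P\setminus\{x\}: x\in\max(P)\cup\min(P)\rangle$ of cards obtained by removing extremal points is reconstructible; that is, for every ordered set $Q$ with $\mathcal{D}_Q=\mathcal{D}_P$ we have $\langle P\setminus\{x\}: x\in\max(P)\cup\min(P)\rangle=\langle Q\setminus\{x\}: x\in\max(Q)\cup\min(Q)\rangle$.
   Context: An ordered set is a set with a reflexive, antisymmetric, transitive relation $\le$; subsets carry the induced order. All ordered sets are finite. $\min(P)$ and $\max(P)$ are the sets of minimal and maximal elements. The rank $\mathrm{rank}(x)$ of an element $x$ is the length of the longest chain from a minimal element to $x$, where a chain of length $k$ has $k+1$ elements. An ordered set is connected iff any two elements are joined by a fence, i.e. a finite sequence of elements in which consecutive elements are comparable. For $x\in P$, the card $P\setminus\{x\}$ is considered unlabelled, i.e. up to isomorphism. Angle brackets $\langle\cdot\rangle$ denote multisets of (isomorphism types of) unlabelled ordered sets, counted with multiplicity over the indicated points $x$. The deck of $P$ is $\mathcal{D}_P=\langle P\setminus\{x\}:x\in P\rangle$. *)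

theory Defs
  imports "HOL-Library.Multiset"
begin

text \<open>An ordered set is given by a carrier \<open>P\<close> and a relation \<open>le\<close> with
  \<^term>\<open>partial_order_on P le\<close>; this includes \<^term>\<open>le \<subseteq> P \<times> P\<close>.\<close>

definition minimal_elements :: "'a set \<Rightarrow> 'a rel \<Rightarrow> 'a set" where
  "minimal_elements P le = {x \<in> P. \<forall>y\<in>P. (y, x) \<in> le \<longrightarrow> y = x}"

definition maximal_elements :: "'a set \<Rightarrow> 'a rel \<Rightarrow> 'a set" where
  "maximal_elements P le = {x \<in> P. \<forall>y\<in>P. (x, y) \<in> le \<longrightarrow> y = x}"

text \<open>A chain from \<open>m\<close> to \<open>x\<close> has least element \<open>m\<close> and greatest element \<open>x\<close>;
  its length is one less than its number of elements.\<close>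

definition chain_from_to :: "'a set \<Rightarrow> 'a rel \<Rightarrow> 'a \<Rightarrow> 'a \<Rightarrow> 'a set \<Rightarrow> bool" where
  "chain_from_to P le m x C \<longleftrightarrow>
     C \<subseteq> P \<and> C \<in> Chains le \<and> m \<in> C \<and> x \<in> C \<and> (\<forall>c\<in>C. (m, c) \<in> le \<and> (c, x) \<in> le)"

definition order_rank :: "'a set \<Rightarrow> 'a rel \<Rightarrow> 'a \<Rightarrow> nat" where
  "order_rank P le x =
     Max {k. \<exists>m\<in>minimal_elements P le. \<exists>C. chain_from_to P le m x C \<and> card C = k + 1}"

definition comparable :: "'a rel \<Rightarrow> 'a \<Rightarrow> 'a \<Rightarrow> bool" where
  "comparable le x y \<longleftrightarrow> (x, y) \<in> le \<or> (y, x) \<in> le"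

definition fence :: "'a set \<Rightarrow> 'a rel \<Rightarrow> 'a list \<Rightarrow> bool" where
  "fence P le xs \<longleftrightarrow> xs \<noteq> [] \<and> set xs \<subseteq> P \<and> successively (comparable le) xs"

definition connected_order :: "'a set \<Rightarrow> 'a rel \<Rightarrow> bool" where
  "connected_order P le \<longleftrightarrow>
     (\<forall>x\<in>P. \<forall>y\<in>P. \<exists>xs. fence P le xs \<and> hd xs = x \<and> last xs = y)"

definition order_isomorphic :: "'a set \<Rightarrow> 'a rel \<Rightarrow> 'b set \<Rightarrow> 'b rel \<Rightarrow> bool" where
  "order_isomorphic P le Q le' \<longleftrightarrow>
     (\<exists>f. bij_betw f P Q \<and> (\<forall>x\<in>P. \<forall>y\<in>P. (x, y) \<in> le \<longleftrightarrow> (f x, f y) \<in> le'))"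

text \<open>The isomorphism type of a finite ordered set is represented by the class of all ordered sets
  on sets of natural numbers that are isomorphic to it. In this way ordered sets over different
  types have comparable isomorphism types; see \<open>iso_type_eq_iff\<close> below.\<close>

type_synonym unlabelled_order = "(nat set \<times> nat rel) set"

definition iso_type :: "'a set \<Rightarrow> 'a rel \<Rightarrow> unlabelled_order" where
  "iso_type P le = {(N, s). partial_order_on N s \<and> order_isomorphic P le N s}"

definition unlabelled_card :: "'a set \<Rightarrow> 'a rel \<Rightarrow> 'a \<Rightarrow> unlabelled_order" where
  "unlabelled_card P le x = iso_type (P - {x}) (Restr le (P - {x}))"

definition cards_removing :: "'a set \<Rightarrow> 'a rel \<Rightarrow> 'a set \<Rightarrow> unlabelled_order multiset" where
  "cards_removing P le S = image_mset (unlabelled_card P le) (mset_set S)"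

definition deck :: "'a set \<Rightarrow> 'a rel \<Rightarrow> unlabelled_order multiset" where
  "deck P le = cards_removing P le P"

definition nonmaximal_rank_deck :: "'a set \<Rightarrow> 'a rel \<Rightarrow> nat \<Rightarrow> unlabelled_order multiset" where
  "nonmaximal_rank_deck P le r =
     cards_removing P le {x \<in> P - maximal_elements P le. order_rank P le x = r}"

definition extremal_deck :: "'a set \<Rightarrow> 'a rel \<Rightarrow> unlabelled_order multiset" where
  "extremal_deck P le = cards_removing P le (maximal_elements P le \<union> minimal_elements P le)"

lemma order_isomorphic_sym:
  assumes "order_isomorphic P le Q le'"
  shows "order_isomorphic Q le' P le"
proof -
  obtain f where f: "bij_betw f P Q" "\<forall>x\<in>P. \<forall>y\<in>P. (x, y) \<in> le \<longleftrightarrow> (f x, f y) \<in> le'"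
    using assms unfolding order_isomorphic_def by blast
  let ?g = "inv_into P f"
  have g: "bij_betw ?g Q P" using f(1) by (rule bij_betw_inv_into)
  have "(x, y) \<in> le' \<longleftrightarrow> (?g x, ?g y) \<in> le" if "x \<in> Q" "y \<in> Q" for x y
    using that f g bij_betw_inv_into_right[OF f(1)] bij_betwE[OF g] by simp
  then show ?thesis using g unfolding order_isomorphic_def by blast
qed

lemma order_isomorphic_trans:
  assumes "order_isomorphic P le Q le'" "order_isomorphic Q le' R le''"
  shows "order_isomorphic P le R le''"
proof -
  obtain f where f: "bij_betw f P Q" "\<forall>x\<in>P. \<forall>y\<in>P. (x, y) \<in> le \<longleftrightarrow> (f x, f y) \<in> le'"
    using assms unfolding order_isomorphic_def by blast
  obtain g where g: "bij_betw g Q R" "\<forall>x\<in>Q. \<forall>y\<in>Q. (x, y) \<in> le' \<longleftrightarrow> (g x, g y) \<in> le''"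
    using assms unfolding order_isomorphic_def by blast
  have "bij_betw (g \<circ> f) P R" using f(1) g(1) by (rule bij_betw_trans)
  moreover have "\<forall>x\<in>P. \<forall>y\<in>P. (x, y) \<in> le \<longleftrightarrow> ((g \<circ> f) x, (g \<circ> f) y) \<in> le''"
    using f g bij_betwE[OF f(1)] by simp
  ultimately show ?thesis unfolding order_isomorphic_def by blast
qed

lemma iso_type_nonempty:
  fixes P :: "'a set"
  assumes "finite P" "partial_order_on P le"
  shows "iso_type P le \<noteq> {}"
proof -
  obtain h where h: "bij_betw h P {0..<card P}"
    using ex_bij_betw_finite_nat[OF assms(1)] by blast
  define N where "N = {0..<card P}"
  define s where "s = map_prod h h ` le"
  have le: "le \<subseteq> P \<times> P" "refl_on P le" "trans le" "antisym le"
    using assms(2) by (auto simp: partial_order_on_def preorder_on_def)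
  have inj: "inj_on h P" and im: "h ` P = N"
    using h by (auto simp: bij_betw_def N_def)
  have s: "(h x, h y) \<in> s \<longleftrightarrow> (x, y) \<in> le" if "x \<in> P" "y \<in> P" for x y
    using that le(1) inj by (auto simp: s_def dest: inj_onD)
  have sub: "s \<subseteq> N \<times> N" using le(1) im by (auto simp: s_def)
  have "refl_on N s" using le(2) s im by (auto simp: refl_on_def)
  moreover have "trans s"
  proof (rule transI)
    fix a b c assume "(a, b) \<in> s" "(b, c) \<in> s"
    moreover from this obtain x y z where "x \<in> P" "y \<in> P" "z \<in> P" "a = h x" "b = h y" "c = h z"
      using sub im by blast
    ultimately show "(a, c) \<in> s" using s le(3) by (metis transD)
  qed
  moreover have "antisym s"
  proof (rule antisymI)
    fix a b assume "(a, b) \<in> s" "(b, a) \<in> s"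
    moreover from this obtain x y where "x \<in> P" "y \<in> P" "a = h x" "b = h y"
      using sub im by blast
    ultimately show "a = b" using s le(4) by (metis antisymD)
  qed
  ultimately have "partial_order_on N s"
    using sub by (simp add: partial_order_on_def preorder_on_def)
  moreover have "order_isomorphic P le N s"
    unfolding order_isomorphic_def using h s N_def by blast
  ultimately show ?thesis unfolding iso_type_def by blast
qed

lemma iso_type_eq_iff:
  assumes "finite P" "partial_order_on P le"
  shows "iso_type P le = iso_type Q le' \<longleftrightarrow> order_isomorphic P le Q le'"
proof
  assume eq: "iso_type P le = iso_type Q le'"
  obtain N s where "(N, s) \<in> iso_type P le"
    using iso_type_nonempty[OF assms] by auto
  with eq have "order_isomorphic P le N s" "order_isomorphic Q le' N s"
    by (auto simp: iso_type_def)
  then show "order_isomorphic P le Q le'"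
    using order_isomorphic_sym order_isomorphic_trans by blast
next
  assume "order_isomorphic P le Q le'"
  then have "order_isomorphic P le N s \<longleftrightarrow> order_isomorphic Q le' N s" for N :: "nat set" and s
    using order_isomorphic_sym order_isomorphic_trans by metis
  then show "iso_type P le = iso_type Q le'"
    unfolding iso_type_def by simp
qed

end

theory Submission imports Defs begin

text \<open>Ranks are replaced by the sizes of principal ideals. Suppose \<open>P - x\<close> and \<open>Q - q\<close> are isomorphic
  and the ideal of \<open>x\<close>, of size \<open>a\<close>, is smaller than that of \<open>q\<close>. Counting points and comparable pairs
  by the size of an ideal shows that there is a unique \<open>z > x\<close> whose ideal is that of \<open>x\<close> plus \<open>z\<close>,
  and that exactly \<open>a - 1\<close> points below \<open>q\<close> have ideals smaller than \<open>a\<close>. If only one point below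
  \<open>q\<close> has an ideal of size \<open>a\<close>, then \<open>x\<close> and \<open>z\<close> are twins; the dual statement holds for filters.
  Otherwise consider alternating sums, over all suborders, of the numbers of walks and of embedded
  connected patterns. A configuration to which some point is irrelevant contributes nothing, so by
  Kelly's lemma these numbers agree in \<open>P\<close> and \<open>Q\<close>. This forces the component of \<open>x\<close> among the points
  with ideal and filter not too small to be autonomous, and isomorphic to the component of \<open>q\<close> before
  and after the deletion of \<open>x\<close> and \<open>q\<close>. Hence, for a fixed card, the numbers of points with the various
  ideal sizes are in the same proportion in both orders. The totals agree, so the numbers agree as
  soon as some point with that card is neither minimal nor maximal. Counting pairs by rank shows
  that the ideal size and the card determine the rank.\<close>

section \<open>Finite orders and hypomorphic orders\<close>

text \<open>An ideal of size k shrinks under exactly k - 1 of the deletions that spare its top, so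
  the sums over a deck obey a linear recursion; a rank does not tell how many deletions lower it.
  Four points are needed for the starting value, the presence of a greatest element. That no walks
  remain rests on parity: all points visited have ideals of size at least \<open>a\<close> and
  filters of size at least \<open>b\<close>, so a walk starting with too large a low part can first
  meet \<open>x\<close> only at a valley and \<open>q\<close> only at a peak. For each length at
  most one kind exists, yet their numbers agree, so there are none. The obstacle is a configuration
  without an irrelevant point. For a nonempty upper set \<open>T\<close> it makes the order an
  ordinal sum, and then the two orders are isomorphic. For empty \<open>T\<close>, when
  \<open>q\<close> is maximal, it covers all maximal elements, so only walks with few peaks are
  available, and the isomorphism of components has to come from the dual family, whose set has
  \<open>a - 1\<close> elements. One of the two sets must be nonempty, which is why a card needs an
  interior point: a minimal \<open>x\<close> and a maximal \<open>q\<close> with the same card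
  escape the argument.\<close>

text \<open>The relation may be larger than the carrier, so suborders need no restriction of it.\<close>
definition fpo :: "'a set \<Rightarrow> 'a rel \<Rightarrow> bool" where
  "fpo P r \<longleftrightarrow> finite P \<and> (\<forall>x\<in>P. (x, x) \<in> r)
     \<and> (\<forall>x\<in>P. \<forall>y\<in>P. (x, y) \<in> r \<longrightarrow> (y, x) \<in> r \<longrightarrow> x = y)
     \<and> (\<forall>x\<in>P. \<forall>y\<in>P. \<forall>z\<in>P. (x, y) \<in> r \<longrightarrow> (y, z) \<in> r \<longrightarrow> (x, z) \<in> r)"

definition dn :: "'a rel \<Rightarrow> 'a set \<Rightarrow> 'a \<Rightarrow> 'a set" where
  "dn r S v = {u \<in> S. (u, v) \<in> r}"

definition up :: "'a rel \<Rightarrow> 'a set \<Rightarrow> 'a \<Rightarrow> 'a set" where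
  "up r S v = {u \<in> S. (v, u) \<in> r}"

lemma fpo_finite: "fpo P r \<Longrightarrow> finite P"
  and fpo_refl: "fpo P r \<Longrightarrow> x \<in> P \<Longrightarrow> (x, x) \<in> r"
  and fpo_antisym: "fpo P r \<Longrightarrow> x \<in> P \<Longrightarrow> y \<in> P \<Longrightarrow> (x, y) \<in> r \<Longrightarrow> (y, x) \<in> r \<Longrightarrow> x = y"
  and fpo_trans: "fpo P r \<Longrightarrow> x \<in> P \<Longrightarrow> y \<in> P \<Longrightarrow> z \<in> P \<Longrightarrow> (x, y) \<in> r \<Longrightarrow> (y, z) \<in> r \<Longrightarrow> (x, z) \<in> r"
  unfolding fpo_def by blast+

lemma partial_order_fpo: "finite P \<Longrightarrow> partial_order_on P le \<Longrightarrow> fpo P le"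
  by (auto simp: fpo_def partial_order_on_def preorder_on_def refl_on_def dest: antisymD transD)

lemma fpo_subset:
  assumes "fpo P r" "S \<subseteq> P" shows "fpo S r"
proof -
  have "x \<in> P" if "x \<in> S" for x using assms(2) that by blast
  moreover have "finite S" using assms by (auto simp: fpo_def intro: finite_subset)
  ultimately show ?thesis
    using fpo_refl[OF assms(1)] fpo_antisym[OF assms(1)] fpo_trans[OF assms(1)]
    unfolding fpo_def by (intro conjI ballI impI) metis+
qed

lemma fpo_converseI: assumes "fpo P r" shows "fpo P (r\<inverse>)"
  using fpo_finite[OF assms] fpo_refl[OF assms] fpo_antisym[OF assms] fpo_trans[OF assms]
  unfolding fpo_def converse_iff by (intro conjI ballI impI) metis+

lemma fpo_converse [simp]: "fpo P (r\<inverse>) = fpo P r"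
  using fpo_converseI[of P r] fpo_converseI[of P "r\<inverse>"] by auto

lemma dn_converse [simp]: "dn (r\<inverse>) S v = up r S v"
  and up_converse [simp]: "up (r\<inverse>) S v = dn r S v"
  by (simp_all add: dn_def up_def)

lemma order_isomorphic_converse [simp]:
  "order_isomorphic P (r\<inverse>) Q (s\<inverse>) = order_isomorphic P r Q s"
proof -
  have "(\<forall>x\<in>P. \<forall>y\<in>P. (y, x) \<in> r \<longleftrightarrow> (f y, f x) \<in> s) \<longleftrightarrow> (\<forall>x\<in>P. \<forall>y\<in>P. (x, y) \<in> r \<longleftrightarrow> (f x, f y) \<in> s)"
    for f by metis
  then show ?thesis unfolding order_isomorphic_def converse_iff by simp
qed

lemma order_isomorphic_refl: "order_isomorphic P r P r"
  unfolding order_isomorphic_def by (rule exI[of _ id]) simp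

text \<open>Equality of decks without isomorphism types: a bijection matches points with isomorphic
  cards. The relations need no restriction to the cards, since \<open>order_isomorphic\<close> looks
  only at points of the carriers.\<close>

definition hypomorphic :: "'a set \<Rightarrow> 'a rel \<Rightarrow> 'b set \<Rightarrow> 'b rel \<Rightarrow> bool" where
  "hypomorphic P r Q s \<longleftrightarrow>
     (\<exists>\<pi>. bij_betw \<pi> P Q \<and> (\<forall>v\<in>P. order_isomorphic (P - {v}) r (Q - {\<pi> v}) s))"

lemma hypomorphic_converse [simp]: "hypomorphic P (r\<inverse>) Q (s\<inverse>) = hypomorphic P r Q s"
  by (simp add: hypomorphic_def)

lemma hypomorphic_sym:
  assumes "hypomorphic P r Q s" shows "hypomorphic Q s P r"
proof -
  obtain \<pi> where p: "bij_betw \<pi> P Q" "\<forall>v\<in>P. order_isomorphic (P - {v}) r (Q - {\<pi> v}) s"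
    using assms unfolding hypomorphic_def by blast
  have g: "bij_betw (inv_into P \<pi>) Q P" using p(1) by (rule bij_betw_inv_into)
  have "order_isomorphic (Q - {w}) s (P - {inv_into P \<pi> w}) r" if "w \<in> Q" for w
    using p(2) that bij_betwE[OF g] bij_betw_inv_into_right[OF p(1) that]
    by (metis order_isomorphic_sym)
  then show ?thesis using g unfolding hypomorphic_def by blast
qed

lemma hypomorphic_refl: "hypomorphic P r P r"
  unfolding hypomorphic_def by (rule exI[of _ id]) (simp add: order_isomorphic_refl)

lemma hypomorphic_card: "hypomorphic P r Q s \<Longrightarrow> card P = card Q"
  unfolding hypomorphic_def using bij_betw_same_card by blast

lemma iso_dn:
  assumes "bij_betw f P Q" "\<forall>x\<in>P. \<forall>y\<in>P. (x, y) \<in> r \<longleftrightarrow> (f x, f y) \<in> s" "v \<in> P"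
  shows "dn s Q (f v) = f ` dn r P v" "card (dn s Q (f v)) = card (dn r P v)"
    "up s Q (f v) = f ` up r P v" "card (up s Q (f v)) = card (up r P v)"
proof -
  have Q: "Q = f ` P" and inj: "inj_on f P" using assms(1) by (auto simp: bij_betw_def)
  show d: "dn s Q (f v) = f ` dn r P v" and u: "up s Q (f v) = f ` up r P v"
    using assms(2,3) by (auto simp: Q dn_def up_def)
  have "inj_on f (dn r P v)" "inj_on f (up r P v)"
    using inj by (rule inj_on_subset, auto simp: dn_def up_def)+
  then show "card (dn s Q (f v)) = card (dn r P v)" "card (up s Q (f v)) = card (up r P v)"
    by (simp_all add: d u card_image)
qed

lemma hypomorphic_sum:
  fixes F :: "'a set \<Rightarrow> 'c::comm_monoid_add" and G :: "'b set \<Rightarrow> 'c"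
  assumes "hypomorphic P r Q s"
    and "\<And>v w. v \<in> P \<Longrightarrow> w \<in> Q \<Longrightarrow> order_isomorphic (P - {v}) r (Q - {w}) s \<Longrightarrow> F (P - {v}) = G (Q - {w})"
  shows "(\<Sum>v\<in>P. F (P - {v})) = (\<Sum>w\<in>Q. G (Q - {w}))"
proof -
  obtain \<pi> where p: "bij_betw \<pi> P Q" "\<forall>v\<in>P. order_isomorphic (P - {v}) r (Q - {\<pi> v}) s"
    using assms(1) unfolding hypomorphic_def by blast
  have "(\<Sum>v\<in>P. F (P - {v})) = (\<Sum>v\<in>P. G (Q - {\<pi> v}))"
    using assms(2) p(2) bij_betwE[OF p(1)] by (intro sum.cong) auto
  also have "\<dots> = (\<Sum>w\<in>Q. G (Q - {w}))" by (rule sum.reindex_bij_betw[OF p(1)])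
  finally show ?thesis .
qed

section \<open>Counts of points and of comparable pairs by ideal size\<close>

definition dn_count :: "'a rel \<Rightarrow> nat \<Rightarrow> 'a set \<Rightarrow> nat" where
  "dn_count r k S = card {v \<in> S. card (dn r S v) = k}"

definition pair_count :: "'a rel \<Rightarrow> nat \<Rightarrow> 'a set \<Rightarrow> nat" where
  "pair_count r k S = card {(v, w). v \<in> S \<and> w \<in> S \<and> v \<noteq> w \<and> (v, w) \<in> r \<and> card (dn r S v) = k}"

lemma dn_count_iso:
  assumes "order_isomorphic P r Q s" shows "dn_count r k P = dn_count s k Q"
proof -
  obtain f where f: "bij_betw f P Q" "\<forall>x\<in>P. \<forall>y\<in>P. (x, y) \<in> r \<longleftrightarrow> (f x, f y) \<in> s"
    using assms unfolding order_isomorphic_def by blast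
  have Q: "Q = f ` P" and inj: "inj_on f P" using f(1) by (auto simp: bij_betw_def)
  have "{v \<in> Q. card (dn s Q v) = k} = f ` {v \<in> P. card (dn r P v) = k}"
    using iso_dn(2)[OF f] by (auto simp: Q)
  moreover have "inj_on f {v \<in> P. card (dn r P v) = k}" using inj by (rule inj_on_subset) auto
  ultimately show ?thesis by (simp add: dn_count_def card_image)
qed

lemma pair_count_iso:
  assumes "order_isomorphic P r Q s" shows "pair_count r k P = pair_count s k Q"
proof -
  obtain f where f: "bij_betw f P Q" "\<forall>x\<in>P. \<forall>y\<in>P. (x, y) \<in> r \<longleftrightarrow> (f x, f y) \<in> s"
    using assms unfolding order_isomorphic_def by blast
  have Q: "Q = f ` P" and inj: "inj_on f P" using f(1) by (auto simp: bij_betw_def)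
  let ?A = "{(v, w). v \<in> P \<and> w \<in> P \<and> v \<noteq> w \<and> (v, w) \<in> r \<and> card (dn r P v) = k}"
  have ne: "f v \<noteq> f w \<longleftrightarrow> v \<noteq> w" if "v \<in> P" "w \<in> P" for v w
    using inj that by (auto dest: inj_onD)
  have "{(v, w). v \<in> Q \<and> w \<in> Q \<and> v \<noteq> w \<and> (v, w) \<in> s \<and> card (dn s Q v) = k} = map_prod f f ` ?A"
    (is "?B = _")
  proof
    show "?B \<subseteq> map_prod f f ` ?A"
    proof clarify
      fix v' w' assume h: "v' \<in> Q" "w' \<in> Q" "v' \<noteq> w'" "(v', w') \<in> s" "k = card (dn s Q v')"
      then obtain v w where "v \<in> P" "w \<in> P" "v' = f v" "w' = f w" by (auto simp: Q)
      then show "(v', w') \<in> map_prod f f ` {(v, w). v \<in> P \<and> w \<in> P \<and> v \<noteq> w \<and> (v, w) \<in> r \<and> card (dn r P v) = card (dn s Q v')}"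
        using h f(2) iso_dn(2)[OF f] by (intro image_eqI[of _ _ "(v, w)"]) auto
    qed
    show "map_prod f f ` ?A \<subseteq> ?B"
      using f(2) iso_dn(2)[OF f] ne bij_betwE[OF f(1)] by auto
  qed
  moreover have "inj_on (map_prod f f) ?A"
    using map_prod_inj_on[OF inj inj] by (rule inj_on_subset) auto
  ultimately show ?thesis unfolding pair_count_def by (simp only: card_image)
qed

lemma dn_minus: "dn r (S - {t}) v = dn r S v - {t}"
  and up_minus: "up r (S - {t}) v = up r S v - {t}"
  by (auto simp: dn_def up_def)

lemma dn_subset: "dn r S v \<subseteq> S" and up_subset: "up r S v \<subseteq> S"
  by (auto simp: dn_def up_def)

text \<open>Here \<open>D\<close> is the ideal of \<open>v\<close>, and \<open>E\<close> consists of
  the points that must survive the deletion. The size of \<open>D\<close> is kept by deleting a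
  point outside \<open>D \<union> E\<close> and lowered by deleting a point of \<open>D\<close>
  other than \<open>v\<close>, which is never in \<open>E\<close>. The \<open>+ 1\<close> corrects
  for \<open>v\<close> lying in both sets.\<close>

lemma card_minus_choices:
  assumes "finite P" "D \<subseteq> P" "E \<subseteq> P" "v \<in> D" "v \<in> E" "D \<inter> E = {v}"
  shows "card {t \<in> P - E. card (D - {t}) = k}
    = (if card D = k then card P - card E + 1 - k else 0) + (if card D = Suc k then k else 0)"
proof -
  have fD: "finite D" using assms by (meson finite_subset)
  have fE: "finite E" using assms by (meson finite_subset)
  have t1: "card (D - {t}) = card D - 1" if "t \<in> D" for t using that fD by simp
  have t2: "card (D - {t}) = card D" if "t \<notin> D" for t using that by simp
  have pos: "card D > 0" using assms(4) fD by (auto simp: card_gt_0_iff)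
  have cDE: "card (D \<union> E) = card D + card E - 1"
    using card_Un_Int[OF fD fE] assms(6) by simp
  consider "card D = k" | "card D = Suc k" | "card D \<noteq> k" "card D \<noteq> Suc k" by blast
  then show ?thesis
  proof cases
    case 1
    have "{t \<in> P - E. card (D - {t}) = k} = P - (D \<union> E)"
      using 1 pos t1 t2 by auto
    then have "card {t \<in> P - E. card (D - {t}) = k} = card P - card (D \<union> E)"
      using assms fD fE by (simp add: card_Diff_subset)
    then show ?thesis using 1 cDE pos by simp
  next
    case 2
    have "{t \<in> P - E. card (D - {t}) = k} = D - {v}"
    proof (intro set_eqI iffI)
      fix t assume "t \<in> {t \<in> P - E. card (D - {t}) = k}"
      then show "t \<in> D - {v}" using 2 t2[of t] assms by (cases "t \<in> D") auto
    next
      fix t assume t: "t \<in> D - {v}"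
      then have "t \<notin> E" using assms(6) by blast
      then show "t \<in> {t \<in> P - E. card (D - {t}) = k}" using 2 t t1[of t] assms by auto
    qed
    then show ?thesis using 2 assms(4) fD by simp
  next
    case 3
    have "{t \<in> P - E. card (D - {t}) = k} = {}"
    proof -
      have "card (D - {t}) \<noteq> k" for t
        using 3 t1[of t] t2[of t] pos by (cases "t \<in> D") auto
      then show ?thesis by blast
    qed
    then show ?thesis by (simp only: 3 card.empty if_False)
  qed
qed

section \<open>Counting principal ideals\<close>

lemma card_filter_sum:
  assumes "finite I" shows "card {i \<in> I. Q i} = (\<Sum>i\<in>I. if Q i then 1 else 0)"
  using assms by (simp add: sum.If_cases Int_def)

text \<open>Common source of the recursions for points and for pairs; the number \<open>e\<close> of
  points that must survive is 1 and 2, respectively.\<close>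

lemma double_count_deletions:
  assumes P: "finite P" and I: "finite I"
    and D: "\<And>i. i \<in> I \<Longrightarrow> D i \<subseteq> P \<and> E i \<subseteq> P \<and> card (E i) = e \<and> (\<exists>v. D i \<inter> E i = {v})"
  shows "(\<Sum>t\<in>P. card {i \<in> I. t \<notin> E i \<and> card (D i - {t}) = k})
    = (card P + 1 - e - k) * card {i \<in> I. card (D i) = k} + k * card {i \<in> I. card (D i) = Suc k}"
proof -
  have "(\<Sum>t\<in>P. card {i \<in> I. t \<notin> E i \<and> card (D i - {t}) = k})
    = (\<Sum>t\<in>P. \<Sum>i\<in>I. if t \<notin> E i \<and> card (D i - {t}) = k then 1 else 0)"
    by (simp only: card_filter_sum[OF I])
  also have "\<dots> = (\<Sum>i\<in>I. \<Sum>t\<in>P. if t \<notin> E i \<and> card (D i - {t}) = k then 1 else 0)"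
    by (rule sum.swap)
  also have "\<dots> = (\<Sum>i\<in>I. card {t \<in> P - E i. card (D i - {t}) = k})"
  proof (intro sum.cong refl)
    fix i
    have "{t \<in> P. t \<notin> E i \<and> card (D i - {t}) = k} = {t \<in> P - E i. card (D i - {t}) = k}" by blast
    then show "(\<Sum>t\<in>P. if t \<notin> E i \<and> card (D i - {t}) = k then 1 else 0) = card {t \<in> P - E i. card (D i - {t}) = k}"
      using card_filter_sum[OF P, of "\<lambda>t. t \<notin> E i \<and> card (D i - {t}) = k"] by (simp only:)
  qed
  also have "\<dots> = (\<Sum>i\<in>I. (if card (D i) = k then card P + 1 - e - k else 0) + (if card (D i) = Suc k then k else 0))"
  proof (intro sum.cong refl)
    fix i assume i: "i \<in> I"
    obtain v where v: "D i \<inter> E i = {v}" and Di: "D i \<subseteq> P" "E i \<subseteq> P" "card (E i) = e"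
      using D[OF i] by blast
    have vD: "v \<in> D i" "v \<in> E i" using v by blast+
    have "card (E i) \<le> card P" using Di(2) by (rule card_mono[OF P])
    then have "card P - card (E i) + 1 - k = card P + 1 - e - k" using Di(3) by simp
    then show "card {t \<in> P - E i. card (D i - {t}) = k}
      = (if card (D i) = k then card P + 1 - e - k else 0) + (if card (D i) = Suc k then k else 0)"
      using card_minus_choices[OF P Di(1,2) vD v, of k] by (simp only:)
  qed
  also have "\<dots> = (\<Sum>i\<in>I. if card (D i) = k then card P + 1 - e - k else 0) + (\<Sum>i\<in>I. if card (D i) = Suc k then k else 0)"
    by (rule sum.distrib)
  also have "\<dots> = (card P + 1 - e - k) * card {i \<in> I. card (D i) = k} + k * card {i \<in> I. card (D i) = Suc k}"
    using I by (simp add: sum.If_cases Int_def)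
  finally show ?thesis .
qed

lemma dn_count_sum:
  assumes "fpo P r"
  shows "(\<Sum>t\<in>P. dn_count r k (P - {t})) = (card P - k) * dn_count r k P + k * dn_count r (Suc k) P"
proof -
  have fin: "finite P" using assms by (rule fpo_finite)
  have "dn_count r k (P - {t}) = card {v \<in> P. t \<notin> {v} \<and> card (dn r P v - {t}) = k}" for t
    unfolding dn_count_def dn_minus by (rule arg_cong[of _ _ card]) auto
  then have "(\<Sum>t\<in>P. dn_count r k (P - {t})) = (\<Sum>t\<in>P. card {v \<in> P. t \<notin> {v} \<and> card (dn r P v - {t}) = k})"
    by simp
  also have "\<dots> = (card P + 1 - 1 - k) * card {v \<in> P. card (dn r P v) = k} + k * card {v \<in> P. card (dn r P v) = Suc k}"
  proof (rule double_count_deletions[OF fin fin])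
    fix v assume "v \<in> P"
    then show "dn r P v \<subseteq> P \<and> {v} \<subseteq> P \<and> card {v} = 1 \<and> (\<exists>va. dn r P v \<inter> {v} = {va})"
      using fpo_refl[OF assms] by (auto simp: dn_def)
  qed
  finally show ?thesis by (simp add: dn_count_def)
qed

lemma pair_count_sum:
  assumes "fpo P r"
  shows "(\<Sum>t\<in>P. pair_count r k (P - {t})) = (card P - 1 - k) * pair_count r k P + k * pair_count r (Suc k) P"
proof -
  have fin: "finite P" using assms by (rule fpo_finite)
  define I where "I = {p \<in> P \<times> P. fst p \<noteq> snd p \<and> p \<in> r}"
  have fI: "finite I" using fin by (simp add: I_def)
  have "pair_count r k (P - {t}) = card {p \<in> I. t \<notin> {fst p, snd p} \<and> card (dn r P (fst p) - {t}) = k}" for t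
    unfolding pair_count_def dn_minus I_def by (rule arg_cong[of _ _ card]) auto
  then have "(\<Sum>t\<in>P. pair_count r k (P - {t})) = (\<Sum>t\<in>P. card {p \<in> I. t \<notin> {fst p, snd p} \<and> card (dn r P (fst p) - {t}) = k})"
    by simp
  also have "\<dots> = (card P + 1 - 2 - k) * card {p \<in> I. card (dn r P (fst p)) = k} + k * card {p \<in> I. card (dn r P (fst p)) = Suc k}"
  proof (rule double_count_deletions[OF fin fI])
    fix p assume "p \<in> I"
    then obtain v w where p: "p = (v, w)" "v \<in> P" "w \<in> P" "v \<noteq> w" "(v, w) \<in> r" by (auto simp: I_def)
    have "w \<notin> dn r P v" using p fpo_antisym[OF assms, of v w] by (auto simp: dn_def)
    then have "dn r P v \<inter> {v, w} = {v}" using p fpo_refl[OF assms] by (auto simp: dn_def)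
    then show "dn r P (fst p) \<subseteq> P \<and> {fst p, snd p} \<subseteq> P \<and> card {fst p, snd p} = 2 \<and> (\<exists>va. dn r P (fst p) \<inter> {fst p, snd p} = {va})"
      using p by (auto simp: dn_def)
  qed
  finally have F: "(\<Sum>t\<in>P. pair_count r k (P - {t})) = (card P + 1 - 2 - k) * card {p \<in> I. card (dn r P (fst p)) = k} + k * card {p \<in> I. card (dn r P (fst p)) = Suc k}" .
  have e: "card {p \<in> I. card (dn r P (fst p)) = j} = pair_count r j P" for j
    unfolding pair_count_def I_def by (rule arg_cong[of _ _ card]) auto
  have e2: "card P + 1 - 2 - k = card P - 1 - k" by simp
  show ?thesis using F unfolding e e2 .
qed

lemma dn_self: "fpo P r \<Longrightarrow> v \<in> P \<Longrightarrow> v \<in> dn r P v"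
  and up_self: "fpo P r \<Longrightarrow> v \<in> P \<Longrightarrow> v \<in> up r P v"
  by (auto simp: dn_def up_def fpo_refl)

lemma finite_dn: "fpo P r \<Longrightarrow> finite (dn r P v)" and finite_up: "fpo P r \<Longrightarrow> finite (up r P v)"
  by (auto simp: dn_def up_def fpo_finite)

lemma dn_mono: "fpo P r \<Longrightarrow> u \<in> P \<Longrightarrow> v \<in> P \<Longrightarrow> (u, v) \<in> r \<Longrightarrow> dn r P u \<subseteq> dn r P v"
  by (auto simp: dn_def intro: fpo_trans)

lemma dn_psubset: "fpo P r \<Longrightarrow> u \<in> P \<Longrightarrow> v \<in> P \<Longrightarrow> (u, v) \<in> r \<Longrightarrow> u \<noteq> v \<Longrightarrow> dn r P u \<subset> dn r P v"
  using dn_mono[of P r u v] dn_self[of P r v] fpo_antisym[of P r u v] by (auto simp: dn_def)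

lemma card_dn_less: "fpo P r \<Longrightarrow> u \<in> P \<Longrightarrow> v \<in> P \<Longrightarrow> (u, v) \<in> r \<Longrightarrow> u \<noteq> v \<Longrightarrow> card (dn r P u) < card (dn r P v)"
  by (intro psubset_card_mono finite_dn dn_psubset)

lemma up_mono: "fpo P r \<Longrightarrow> u \<in> P \<Longrightarrow> v \<in> P \<Longrightarrow> (u, v) \<in> r \<Longrightarrow> up r P v \<subseteq> up r P u"
  by (auto simp: up_def intro: fpo_trans)

lemma card_up_less: "fpo P r \<Longrightarrow> u \<in> P \<Longrightarrow> v \<in> P \<Longrightarrow> (u, v) \<in> r \<Longrightarrow> u \<noteq> v \<Longrightarrow> card (up r P v) < card (up r P u)"
  using card_dn_less[of P "r\<inverse>" v u] by simp

lemma card_dn_pos: "fpo P r \<Longrightarrow> v \<in> P \<Longrightarrow> 0 < card (dn r P v)"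
  using dn_self[of P r v] finite_dn[of P r v] by (auto simp: card_gt_0_iff)

lemma dn_count_big: "fpo P r \<Longrightarrow> card P < k \<Longrightarrow> dn_count r k P = 0"
proof -
  assume a: "fpo P r" "card P < k"
  have "card (dn r P v) \<le> card P" for v using card_mono[OF fpo_finite[OF a(1)] dn_subset] .
  then have "{v \<in> P. card (dn r P v) = k} = {}" using a(2) by (auto simp: not_less[symmetric])
  then show ?thesis unfolding dn_count_def by (simp only: card.empty)
qed

lemma dn_count_top_le_1: assumes "fpo P r" shows "dn_count r (card P) P \<le> 1"
proof -
  let ?A = "{v \<in> P. card (dn r P v) = card P}"
  have "v = w" if "v \<in> P" "w \<in> P" "card (dn r P v) = card P" "card (dn r P w) = card P" for v w
  proof -
    have "dn r P v = P" "dn r P w = P"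
      using that card_subset_eq[OF fpo_finite[OF assms] dn_subset] by metis+
    then have "(v, w) \<in> r" "(w, v) \<in> r" using that by (auto simp: dn_def)
    then show ?thesis using that fpo_antisym[OF assms] by blast
  qed
  then have "\<forall>v\<in>?A. \<forall>w\<in>?A. v = w" by simp
  moreover have "finite ?A" using fpo_finite[OF assms] by simp
  ultimately show ?thesis unfolding dn_count_def One_nat_def using card_le_Suc0_iff_eq[of ?A] by simp
qed

text \<open>An element with exactly one element not below it is incomparable to every other such element,
  unless there is a greatest element.\<close>
lemma dn_count_coatom:
  assumes "fpo P r" "dn_count r (card P) P = 0" shows "dn_count r (card P - 1) P \<le> 2"
proof -
  have fin: "finite P" using assms(1) by (rule fpo_finite)
  have ng: "dn r P v \<noteq> P" if "v \<in> P" for v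
    using assms(2) that fin by (auto simp: dn_count_def)
  define A where "A = {v \<in> P. card (dn r P v) = card P - 1}"
  have inc: "(v, w) \<notin> r" if "v \<in> A" "w \<in> A" "v \<noteq> w" for v w
  proof
    assume "(v, w) \<in> r"
    then have "card (dn r P v) < card (dn r P w)" using that card_dn_less[OF assms(1), of v w] by (auto simp: A_def)
    then show False using that by (auto simp: A_def)
  qed
  have "card A \<le> 2"
  proof (rule ccontr)
    assume "\<not> card A \<le> 2"
    then obtain B where B: "B \<subseteq> A" "card B = 3"
      using obtain_subset_with_card_n[of 3 A] by (metis Suc_leI eval_nat_numeral(3) not_le)
    then obtain u v w where uvw: "B = {u, v, w}" "u \<noteq> v" "v \<noteq> w" "u \<noteq> w" by (auto simp: card_3_iff)
    then have m: "u \<in> A" "v \<in> A" "w \<in> A" using B by auto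
    then have "dn r P u \<subseteq> P - {v, w}" using inc uvw by (auto simp: dn_def)
    then have "card (dn r P u) \<le> card (P - {v, w})" using fin by (meson card_mono finite_Diff)
    also have "\<dots> = card P - 2" using m uvw fin by (subst card_Diff_subset) (auto simp: A_def)
    finally have "card (dn r P u) \<le> card P - 2" .
    moreover have "card P \<ge> 2" using m uvw fin card_mono[OF fin, of "{u,v}"] by (auto simp: A_def)
    ultimately show False using m by (auto simp: A_def)
  qed
  then show ?thesis by (simp add: dn_count_def A_def)
qed

section \<open>Reconstruction of the counts\<close>

lemma hypomorphic_dn_count_sum:
  assumes "fpo P r" "fpo Q s" "hypomorphic P r Q s"
  shows "(card P - k) * dn_count r k P + k * dn_count r (Suc k) P
    = (card Q - k) * dn_count s k Q + k * dn_count s (Suc k) Q"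
    and "(card P - 1 - k) * pair_count r k P + k * pair_count r (Suc k) P
    = (card Q - 1 - k) * pair_count s k Q + k * pair_count s (Suc k) Q"
proof -
  have "(\<Sum>t\<in>P. dn_count r k (P - {t})) = (\<Sum>t\<in>Q. dn_count s k (Q - {t}))"
    by (rule hypomorphic_sum[OF assms(3)]) (rule dn_count_iso)
  then show "(card P - k) * dn_count r k P + k * dn_count r (Suc k) P
    = (card Q - k) * dn_count s k Q + k * dn_count s (Suc k) Q"
    unfolding dn_count_sum[OF assms(1), of k] dn_count_sum[OF assms(2), of k] .
  have "(\<Sum>t\<in>P. pair_count r k (P - {t})) = (\<Sum>t\<in>Q. pair_count s k (Q - {t}))"
    by (rule hypomorphic_sum[OF assms(3)]) (rule pair_count_iso)
  then show "(card P - 1 - k) * pair_count r k P + k * pair_count r (Suc k) P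
    = (card Q - 1 - k) * pair_count s k Q + k * pair_count s (Suc k) Q"
    unfolding pair_count_sum[OF assms(1), of k] pair_count_sum[OF assms(2), of k] .
qed

text \<open>At \<open>k = card P - 1\<close> the recursion sets the contribution
  \<open>card P - 1\<close> of a greatest element against at most 2 on a side without one. This is
  where four points are needed.\<close>

lemma hypomorphic_top_le:
  assumes "fpo P r" "fpo Q s" "hypomorphic P r Q s" "4 \<le> card P" "dn_count r (card P) P = 1"
  shows "dn_count s (card Q) Q = 1"
proof (rule ccontr)
  assume "dn_count s (card Q) Q \<noteq> 1"
  then have 0: "dn_count s (card Q) Q = 0" using dn_count_top_le_1[OF assms(2)] by linarith
  have n: "card P = card Q" using assms(3) by (rule hypomorphic_card)
  have S: "Suc (card P - 1) = card P" using assms(4) by linarith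
  have "card P - 1 \<le> (card P - (card P - 1)) * dn_count r (card P - 1) P + (card P - 1) * dn_count r (card P) P"
    using assms(5) by simp
  also have "\<dots> = (card Q - (card P - 1)) * dn_count s (card P - 1) Q + (card P - 1) * dn_count s (card P) Q"
    using hypomorphic_dn_count_sum(1)[OF assms(1-3), of "card P - 1"] S by simp
  also have "\<dots> \<le> 2" using 0 dn_count_coatom[OF assms(2) 0] n assms(4) by simp
  finally show False using assms(4) by linarith
qed

text \<open>Descending induction on the size: the coefficient \<open>card P - k\<close> of the
  unknown value is positive below the top, and the top value is known.\<close>

lemma hypomorphic_dn_count:
  assumes "fpo P r" "fpo Q s" "hypomorphic P r Q s" "4 \<le> card P"
  shows "dn_count r k P = dn_count s k Q"
proof -
  have n: "card P = card Q" using assms(3) by (rule hypomorphic_card)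
  have top: "dn_count r (card P) P = dn_count s (card Q) Q"
    using hypomorphic_top_le[OF assms] hypomorphic_top_le[OF assms(2,1) hypomorphic_sym[OF assms(3)]]
      dn_count_top_le_1[OF assms(1)] dn_count_top_le_1[OF assms(2)] assms(4) n
    by (cases "dn_count r (card P) P = 1"; cases "dn_count s (card Q) Q = 1") auto
  have "dn_count r (card P - i) P = dn_count s (card P - i) Q" for i
  proof (induction i)
    case 0 show ?case using top n by simp
  next
    case (Suc i)
    show ?case
    proof (cases "i < card P")
      case True
      let ?k = "card P - Suc i"
      have S: "Suc ?k = card P - i" using True by linarith
      have "(card P - ?k) * dn_count r ?k P = (card P - ?k) * dn_count s ?k Q"
        using hypomorphic_dn_count_sum(1)[OF assms(1-3), of ?k] Suc S n by simp
      moreover have "0 < card P - ?k" using True by linarith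
      ultimately show ?thesis by (metis nat_mult_eq_cancel1)
    next
      case False then show ?thesis using Suc by simp
    qed
  qed
  from this[of "card P - k"] show ?thesis
    using dn_count_big[OF assms(1), of k] dn_count_big[OF assms(2), of k] n by (cases "k \<le> card P") auto
qed

lemma pair_count_big: "fpo P r \<Longrightarrow> card P \<le> k \<Longrightarrow> pair_count r k P = 0"
proof -
  assume a: "fpo P r" "card P \<le> k"
  have "card (dn r P v) < k" if "v \<in> P" "w \<in> P" "v \<noteq> w" "(v, w) \<in> r" for v w
    using card_dn_less[OF a(1) that(1,2,4,3)] card_mono[OF fpo_finite[OF a(1)] dn_subset, of r w] a(2) by linarith
  then have "{(v, w). v \<in> P \<and> w \<in> P \<and> v \<noteq> w \<and> (v, w) \<in> r \<and> card (dn r P v) = k} = {}" by force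
  then show ?thesis unfolding pair_count_def by (simp only: card.empty)
qed

text \<open>An ideal that properly contains one of size \<open>card P - 1\<close> is everything, so
  the pairs in question end at the greatest element. This gives the starting value of the descending
  induction for pairs.\<close>

lemma pair_count_coatom:
  assumes "fpo P r" "2 \<le> card P"
  shows "pair_count r (card P - 1) P = (if dn_count r (card P) P = 0 then 0 else dn_count r (card P - 1) P)"
proof -
  have fin: "finite P" using assms(1) by (rule fpo_finite)
  let ?A = "{(v, w). v \<in> P \<and> w \<in> P \<and> v \<noteq> w \<and> (v, w) \<in> r \<and> card (dn r P v) = card P - 1}"
  have top: "dn r P w = P" if "(v, w) \<in> ?A" for v w
  proof -
    have "card P - 1 < card (dn r P w)" using that card_dn_less[OF assms(1), of v w] by auto
    then show ?thesis using card_subset_eq[OF fin dn_subset, of r w] card_mono[OF fin dn_subset, of r w] by linarith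
  qed
  show ?thesis
  proof (cases "dn_count r (card P) P = 0")
    case True
    then have "{v \<in> P. card (dn r P v) = card P} = {}" using fin by (simp add: dn_count_def)
    then have "dn r P w \<noteq> P" if "w \<in> P" for w using that by force
    then have "?A = {}" using top by blast
    then show ?thesis using True unfolding pair_count_def by (simp only: card.empty if_True refl)
  next
    case False
    then obtain g where g: "g \<in> P" "card (dn r P g) = card P"
      unfolding dn_count_def by (metis (mono_tags, lifting) card.empty empty_Collect_eq)
    then have gP: "dn r P g = P" using card_subset_eq[OF fin dn_subset] by metis
    have "?A = (\<lambda>v. (v, g)) ` {v \<in> P. card (dn r P v) = card P - 1}" (is "_ = _ ` ?B")
    proof
      show "?A \<subseteq> (\<lambda>v. (v, g)) ` ?B"
      proof clarify
        fix v w assume h: "v \<in> P" "w \<in> P" "v \<noteq> w" "(v, w) \<in> r" "card (dn r P v) = card P - 1"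
        then have "dn r P w = P" using top by blast
        then have "(g, w) \<in> r" "(w, g) \<in> r" using g gP h by (auto simp: dn_def)
        then have "w = g" using fpo_antisym[OF assms(1)] g h by blast
        then show "(v, w) \<in> (\<lambda>v. (v, g)) ` ?B" using h by blast
      qed
      show "(\<lambda>v. (v, g)) ` ?B \<subseteq> ?A" using g gP assms(2) by (auto simp: dn_def)
    qed
    moreover have "inj_on (\<lambda>v. (v, g)) ?B" by (auto intro: inj_onI)
    ultimately show ?thesis using False unfolding pair_count_def dn_count_def by (simp only: card_image if_False)
  qed
qed

lemma hypomorphic_pair_count:
  assumes "fpo P r" "fpo Q s" "hypomorphic P r Q s" "4 \<le> card P"
  shows "pair_count r k P = pair_count s k Q"
proof -
  have n: "card P = card Q" using assms(3) by (rule hypomorphic_card)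
  have top: "pair_count r (card P - 1) P = pair_count s (card Q - 1) Q"
    using pair_count_coatom[OF assms(1)] pair_count_coatom[OF assms(2)] hypomorphic_dn_count[OF assms] assms(4) n
    by simp
  have "pair_count r (card P - 1 - i) P = pair_count s (card P - 1 - i) Q" for i
  proof (induction i)
    case 0 show ?case using top n by simp
  next
    case (Suc i)
    show ?case
    proof (cases "i < card P - 1")
      case True
      let ?k = "card P - 1 - Suc i"
      have S: "Suc ?k = card P - 1 - i" using True by linarith
      have "(card P - 1 - ?k) * pair_count r ?k P = (card P - 1 - ?k) * pair_count s ?k Q"
        using hypomorphic_dn_count_sum(2)[OF assms(1-3), of ?k] Suc S n by simp
      moreover have "0 < card P - 1 - ?k" using True by linarith
      ultimately show ?thesis by (metis nat_mult_eq_cancel1)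
    next
      case False then show ?thesis using Suc by simp
    qed
  qed
  from this[of "card P - 1 - k"] show ?thesis
    using pair_count_big[OF assms(1), of k] pair_count_big[OF assms(2), of k] n assms(4)
    by (cases "k \<le> card P - 1") auto
qed

section \<open>Pairs of isomorphic cards\<close>

lemma dn_minus_card:
  assumes "fpo P r" "x \<in> P" "v \<in> P"
  shows "card (dn r (P - {x}) v) = (if (x, v) \<in> r then card (dn r P v) - 1 else card (dn r P v))"
proof -
  have "x \<in> dn r P v \<longleftrightarrow> (x, v) \<in> r" using assms by (simp add: dn_def)
  then show ?thesis using finite_dn[OF assms(1), of v] by (simp add: dn_minus)
qed

lemma dn_minus_eq_iff:
  assumes "fpo P r" "x \<in> P" "v \<in> P" "v \<noteq> x" "k < card (dn r P x)"
  shows "card (dn r (P - {x}) v) = k \<longleftrightarrow> card (dn r P v) = k"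
  using dn_minus_card[OF assms(1-3)] card_dn_less[OF assms(1,2,3)] assms(4,5) by auto

lemma dn_minus_eq_iff':
  assumes "fpo P r" "x \<in> P" "v \<in> P" "v \<noteq> x"
  shows "card (dn r (P - {x}) v) = card (dn r P x)
    \<longleftrightarrow> card (dn r P v) = card (dn r P x) \<or> (x, v) \<in> r \<and> card (dn r P v) = Suc (card (dn r P x))"
  using dn_minus_card[OF assms(1-3)] card_dn_less[OF assms(1,2,3)] assms(4) by auto

lemma dn_count_minus:
  assumes "fpo P r" "x \<in> P" "k < card (dn r P x)"
  shows "dn_count r k (P - {x}) = dn_count r k P"
  unfolding dn_count_def using assms(3) dn_minus_eq_iff[OF assms(1,2) _ _ assms(3)]
  by (intro arg_cong[of _ _ card]) auto

text \<open>At the size of the ideal of \<open>x\<close>, the deletion loses \<open>x\<close> itself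
  and gains the points above \<open>x\<close> whose ideals were larger by one.\<close>

lemma dn_count_minus':
  assumes "fpo P r" "x \<in> P"
  shows "dn_count r (card (dn r P x)) (P - {x}) + 1 = dn_count r (card (dn r P x)) P
    + card {z \<in> P. (x, z) \<in> r \<and> card (dn r P z) = Suc (card (dn r P x))}"
proof -
  have fin: "finite P" using assms(1) by (rule fpo_finite)
  let ?a = "card (dn r P x)"
  let ?A = "{v \<in> P. card (dn r P v) = ?a}" and ?Z = "{z \<in> P. (x, z) \<in> r \<and> card (dn r P z) = Suc ?a}"
  have "{v \<in> P - {x}. card (dn r (P - {x}) v) = ?a} = (?A - {x}) \<union> ?Z"
  proof (rule set_eqI)
    fix v
    show "v \<in> {v \<in> P - {x}. card (dn r (P - {x}) v) = ?a} \<longleftrightarrow> v \<in> (?A - {x}) \<union> ?Z"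
      using dn_minus_eq_iff'[OF assms, of v] by (cases "v = x") auto
  qed
  then have "card {v \<in> P - {x}. card (dn r (P - {x}) v) = ?a} = card ((?A - {x}) \<union> ?Z)" by (rule arg_cong)
  moreover have "card ((?A - {x}) \<union> ?Z) = card (?A - {x}) + card ?Z"
    using fin by (intro card_Un_disjoint) auto
  moreover have "card (?A - {x}) + 1 = card ?A"
    using card_Suc_Diff1[of ?A x] fin assms(2) by simp
  ultimately show ?thesis unfolding dn_count_def by linarith
qed

section \<open>Comparable pairs in a card\<close>

definition spairs :: "'a rel \<Rightarrow> 'a set \<Rightarrow> ('a \<times> 'a) set" where
  "spairs r S = {(v, w). v \<in> S \<and> w \<in> S \<and> v \<noteq> w \<and> (v, w) \<in> r}"

lemma finite_spairs: "finite S \<Longrightarrow> finite (spairs r S)"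
  by (rule finite_subset[of _ "S \<times> S"]) (auto simp: spairs_def)

lemma pair_count_alt: "pair_count r k S = card {p \<in> spairs r S. card (dn r S (fst p)) = k}"
  unfolding pair_count_def spairs_def by (rule arg_cong[of _ _ card]) auto

lemma card_fst_x: "fpo P r \<Longrightarrow> x \<in> P \<Longrightarrow> card (spairs r P \<inter> ({x} \<times> UNIV)) = card (up r P x) - 1"
proof -
  assume a: "fpo P r" "x \<in> P"
  have "spairs r P \<inter> ({x} \<times> UNIV) = Pair x ` (up r P x - {x})" using a(2) by (auto simp: spairs_def up_def)
  then show ?thesis using up_self[OF a] finite_up[OF a(1), of x] by (simp add: card_image inj_on_def)
qed

text \<open>A point whose ideal is smaller than that of \<open>x\<close> is not above
  \<open>x\<close>, so its ideal is untouched, and a point above \<open>x\<close> does not fall to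
  such a size. Only pairs ending at \<open>x\<close> are lost.\<close>

lemma pair_count_minus:
  assumes "fpo P r" "x \<in> P" "k < card (dn r P x)"
  shows "pair_count r k (P - {x}) + card {v \<in> P. (v, x) \<in> r \<and> card (dn r P v) = k} = pair_count r k P"
proof -
  have fin: "finite P" using assms(1) by (rule fpo_finite)
  let ?A = "{p \<in> spairs r P. card (dn r P (fst p)) = k}"
  let ?B = "{v \<in> P. (v, x) \<in> r \<and> card (dn r P v) = k}"
  have m: "(p \<in> spairs r (P - {x}) \<and> card (dn r (P - {x}) (fst p)) = k) \<longleftrightarrow> p \<in> ?A - (UNIV \<times> {x})" for p
  proof (cases "fst p = x")
    case True then show ?thesis using assms(3) by (auto simp: spairs_def)
  next
    case False
    then show ?thesis using dn_minus_eq_iff[OF assms(1,2) _ False assms(3)] by (auto simp: spairs_def)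
  qed
  have "{p \<in> spairs r (P - {x}). card (dn r (P - {x}) (fst p)) = k} = ?A - (UNIV \<times> {x})" using m by blast
  moreover have "card (?A - (UNIV \<times> {x})) + card (?A \<inter> (UNIV \<times> {x})) = card ?A"
    using finite_spairs[OF fin, of r] card_Int_Diff[of ?A "UNIV \<times> {x}"] by simp
  moreover have "?A \<inter> (UNIV \<times> {x}) = (\<lambda>v. (v, x)) ` ?B" using assms by (auto simp: spairs_def)
  moreover have "card ((\<lambda>v. (v, x)) ` ?B) = card ?B" by (intro card_image inj_onI) simp
  ultimately show ?thesis unfolding pair_count_alt by simp
qed

text \<open>Pairs starting at \<open>x\<close> are lost and pairs starting at \<open>z\<close>,
  whose ideal drops to the size in question, are gained. No pair ending at \<open>x\<close> is
  involved, because its lower point has too small an ideal.\<close>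

lemma pair_count_minus':
  assumes "fpo P r" "x \<in> P"
    and z: "{z \<in> P. (x, z) \<in> r \<and> card (dn r P z) = Suc (card (dn r P x))} = {z}"
  shows "pair_count r (card (dn r P x)) (P - {x}) + (card (up r P x) - 1)
    = pair_count r (card (dn r P x)) P + (card (up r P z) - 1)"
proof -
  have fin: "finite P" using assms(1) by (rule fpo_finite)
  let ?a = "card (dn r P x)"
  let ?A = "{p \<in> spairs r P. card (dn r P (fst p)) = ?a}"
  let ?X = "spairs r P \<inter> ({x} \<times> UNIV)" and ?Z = "spairs r P \<inter> ({z} \<times> UNIV)"
  have zP: "z \<in> P" "(x, z) \<in> r" "card (dn r P z) = Suc ?a" using z by blast+
  have zx: "z \<noteq> x" using zP by auto
  have m: "(p \<in> spairs r (P - {x}) \<and> card (dn r (P - {x}) (fst p)) = ?a) \<longleftrightarrow> p \<in> (?A - ?X) \<union> ?Z" for p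
  proof (cases p)
    case (Pair v w)
    show ?thesis
    proof (cases "v \<in> P \<and> w \<in> P \<and> v \<noteq> w \<and> (v, w) \<in> r \<and> v \<noteq> x")
      case True
      then have vw: "v \<in> P" "w \<in> P" "v \<noteq> w" "(v, w) \<in> r" "v \<noteq> x" by auto
      have iff: "card (dn r (P - {x}) v) = ?a \<longleftrightarrow> card (dn r P v) = ?a \<or> v = z"
        using dn_minus_eq_iff'[OF assms(1,2) vw(1,5)] z vw(1) by blast
      have wx: "w \<noteq> x" if "card (dn r P v) = ?a \<or> v = z"
      proof
        assume "w = x"
        then have "card (dn r P v) < ?a" using card_dn_less[OF assms(1) vw(1,2,4,3)] by simp
        then show False using that zP by auto
      qed
      show ?thesis using Pair vw iff wx by (auto simp: spairs_def)
    next
      case False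
      then show ?thesis using Pair zP zx by (auto simp: spairs_def)
    qed
  qed
  have "{p \<in> spairs r (P - {x}). card (dn r (P - {x}) (fst p)) = ?a} = (?A - ?X) \<union> ?Z" using m by blast
  moreover have "card ((?A - ?X) \<union> ?Z) = card (?A - ?X) + card ?Z"
    using finite_spairs[OF fin, of r] zP by (intro card_Un_disjoint) auto
  moreover have "card (?A - ?X) + card ?X = card ?A"
  proof -
    have "?A \<inter> ?X = ?X" using assms(2) by auto
    then show ?thesis using finite_spairs[OF fin, of r] card_Int_Diff[of ?A ?X] by simp
  qed
  ultimately show ?thesis unfolding pair_count_alt using card_fst_x[OF assms(1,2)] card_fst_x[OF assms(1) zP(1)] by simp
qed

lemma card_fibers:
  fixes f :: "'a \<Rightarrow> nat"
  assumes "finite A" shows "card {v \<in> A. f v < m} = (\<Sum>k<m. card {v \<in> A. f v = k})"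
proof -
  have "{v \<in> A. f v < m} = (\<Union>k\<in>{..<m}. {v \<in> A. f v = k})" by auto
  also have "card \<dots> = (\<Sum>k<m. card {v \<in> A. f v = k})"
    by (rule card_UN_disjoint) (use assms in auto)
  finally show ?thesis .
qed

lemma card_spairs: "fpo P r \<Longrightarrow> card (spairs r P) = (\<Sum>k<Suc (card P). pair_count r k P)"
proof -
  assume a: "fpo P r"
  have "card (dn r P v) < Suc (card P)" for v using card_mono[OF fpo_finite[OF a] dn_subset] by (simp add: less_Suc_eq_le)
  then have "{p \<in> spairs r P. card (dn r P (fst p)) < Suc (card P)} = spairs r P" by blast
  then show ?thesis using card_fibers[OF finite_spairs[OF fpo_finite[OF a]], of r "\<lambda>p. card (dn r P (fst p))" "Suc (card P)"]
    by (simp add: pair_count_alt)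
qed

lemma card_spairs_minus:
  assumes "fpo P r" "x \<in> P"
  shows "card (spairs r (P - {x})) + (card (dn r P x) - 1) + (card (up r P x) - 1) = card (spairs r P)"
proof -
  have fin: "finite (spairs r P)" using finite_spairs fpo_finite[OF assms(1)] by blast
  let ?X = "spairs r P \<inter> ({x} \<times> UNIV)" and ?Y = "spairs r P \<inter> (UNIV \<times> {x})"
  have "spairs r P = spairs r (P - {x}) \<union> (?X \<union> ?Y)" by (auto simp: spairs_def)
  then have "card (spairs r P) = card (spairs r (P - {x}) \<union> (?X \<union> ?Y))" by (rule arg_cong)
  moreover have "card (spairs r (P - {x}) \<union> (?X \<union> ?Y)) = card (spairs r (P - {x})) + card (?X \<union> ?Y)"
    using fin finite_spairs[of "P - {x}" r] fpo_finite[OF assms(1)] by (intro card_Un_disjoint) (auto simp: spairs_def)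
  moreover have "card (?X \<union> ?Y) = card ?X + card ?Y"
    using fin by (intro card_Un_disjoint) (auto simp: spairs_def)
  moreover have "card ?Y = card (dn r P x) - 1"
  proof -
    have "?Y = (\<lambda>v. (v, x)) ` (dn r P x - {x})" using assms(2) by (auto simp: spairs_def dn_def)
    then show ?thesis using dn_self[OF assms] finite_dn[OF assms(1), of x] by (simp add: card_image inj_on_def)
  qed
  ultimately show ?thesis using card_fst_x[OF assms] by linarith
qed

text \<open>The number of comparable pairs is the sum of the reconstructible numbers
  \<open>pair_count\<close>, and the pairs destroyed by a deletion are those that contain the
  deleted point.\<close>

lemma deletion_degree_sum:
  assumes P: "fpo P r" and Q: "fpo Q s" and hyp: "hypomorphic P r Q s" and n4: "4 \<le> card P"
    and x: "x \<in> P" and q: "q \<in> Q" and iso: "order_isomorphic (P - {x}) r (Q - {q}) s"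
  shows "card (dn r P x) + card (up r P x) = card (dn s Q q) + card (up s Q q)"
proof -
  have "card (spairs r P) = card (spairs s Q)"
    by (simp add: card_spairs[OF P] card_spairs[OF Q] hypomorphic_card[OF hyp] hypomorphic_pair_count[OF P Q hyp n4])
  moreover have "card (spairs r (P - {x})) = card (spairs s (Q - {q}))"
  proof -
    have "fpo (P - {x}) r" "fpo (Q - {q}) s" using fpo_subset[OF P] fpo_subset[OF Q] by blast+
    moreover have "card (P - {x}) = card (Q - {q})"
      using hypomorphic_card[OF hyp] x q fpo_finite[OF P] fpo_finite[OF Q] by simp
    ultimately show ?thesis by (simp add: card_spairs pair_count_iso[OF iso])
  qed
  moreover have "0 < card (up r P x)" "0 < card (up s Q q)"
    using card_dn_pos[of P "r\<inverse>" x] card_dn_pos[of Q "s\<inverse>" q] P Q x q by simp_all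
  ultimately show ?thesis
    using card_spairs_minus[OF P x] card_spairs_minus[OF Q q] card_dn_pos[OF P x] card_dn_pos[OF Q q] by linarith
qed

text \<open>The situation to be controlled: one card, two ideal sizes. The assumption
  \<open>less\<close> only fixes an orientation, since exchanging the orders and reversing both
  gives another instance (\<open>dual\<close>). Every result below thus has a mirror image in terms
  of filters.\<close>

locale removal_pair =
  fixes P :: "'a set" and r :: "'a rel" and x :: 'a and Q :: "'b set" and s :: "'b rel" and q :: 'b
  assumes P: "fpo P r" and Q: "fpo Q s" and hyp: "hypomorphic P r Q s" and n4: "4 \<le> card P"
    and x: "x \<in> P" and q: "q \<in> Q" and iso: "order_isomorphic (P - {x}) r (Q - {q}) s"
    and less: "card (dn r P x) < card (dn s Q q)"
begin

lemma card_eq: "card P = card Q" using hyp by (rule hypomorphic_card)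

lemma finP: "finite P" and finQ: "finite Q" using P Q by (auto simp: fpo_finite)

lemma degree_sum: "card (dn r P x) + card (up r P x) = card (dn s Q q) + card (up s Q q)"
  by (rule deletion_degree_sum[OF P Q hyp n4 x q iso])

lemma up_less: "card (up s Q q) < card (up r P x)"
  using degree_sum less by linarith

lemma dual: "removal_pair Q (s\<inverse>) q P (r\<inverse>) x"
proof
  show "hypomorphic Q (s\<inverse>) P (r\<inverse>)" using hyp by (simp add: hypomorphic_sym)
  show "order_isomorphic (Q - {q}) (s\<inverse>) (P - {x}) (r\<inverse>)" using iso by (simp add: order_isomorphic_sym)
qed (use P Q n4 x q up_less card_eq in auto)

text \<open>Deleting \<open>q\<close> does not alter the number of points with ideals of the smaller
  size, whereas deleting \<open>x\<close> loses \<open>x\<close>. As the cards agree, exactly one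
  point must fall to that size.\<close>

lemma unique_z: "card {z \<in> P. (x, z) \<in> r \<and> card (dn r P z) = Suc (card (dn r P x))} = 1"
  using dn_count_minus'[OF P x] dn_count_minus[OF Q q less] hypomorphic_dn_count[OF P Q hyp n4]
    dn_count_iso[OF iso] by simp

definition z :: 'a where "z = (THE z. {z \<in> P. (x, z) \<in> r \<and> card (dn r P z) = Suc (card (dn r P x))} = {z})"

lemma z_set: "{z \<in> P. (x, z) \<in> r \<and> card (dn r P z) = Suc (card (dn r P x))} = {z}"
proof -
  obtain w where "{z \<in> P. (x, z) \<in> r \<and> card (dn r P z) = Suc (card (dn r P x))} = {w}"
    using unique_z by (auto simp: card_1_singleton_iff)
  then show ?thesis unfolding z_def by simp
qed

lemma z: "z \<in> P" "(x, z) \<in> r" "card (dn r P z) = Suc (card (dn r P x))" "z \<noteq> x"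
proof -
  show "z \<in> P" "(x, z) \<in> r" and c: "card (dn r P z) = Suc (card (dn r P x))" using z_set by blast+
  show "z \<noteq> x" using c by auto
qed

lemma dn_z: "dn r P z = insert z (dn r P x)"
proof -
  have "insert z (dn r P x) \<subseteq> dn r P z" using dn_mono[OF P x z(1,2)] dn_self[OF P z(1)] by blast
  moreover have "z \<notin> dn r P x" using fpo_antisym[OF P x z(1,2)] z(4) by (auto simp: dn_def)
  then have "card (insert z (dn r P x)) = card (dn r P z)" using z(3) finite_dn[OF P] by simp
  ultimately show ?thesis using card_subset_eq[OF finite_dn[OF P]] by metis
qed

lemma low_count: "k < card (dn r P x) \<Longrightarrow>
  card {v \<in> P. (v, x) \<in> r \<and> card (dn r P v) = k} = card {v \<in> Q. (v, q) \<in> s \<and> card (dn s Q v) = k}"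
  using pair_count_minus[OF P x, of k] pair_count_minus[OF Q q, of k] less
    hypomorphic_pair_count[OF P Q hyp n4, of k] pair_count_iso[OF iso, of k] by linarith

text \<open>At each size below that of \<open>x\<close> both deletions destroy equally many pairs,
  by \<open>low_count\<close>. On the side of \<open>x\<close> these pairs run through all points
  strictly below \<open>x\<close>.\<close>

lemma card_low: "card {v \<in> Q. (v, q) \<in> s \<and> card (dn s Q v) < card (dn r P x)} = card (dn r P x) - 1"
proof -
  let ?a = "card (dn r P x)"
  have "card {v \<in> dn s Q q. card (dn s Q v) < ?a} = (\<Sum>k<?a. card {v \<in> dn s Q q. card (dn s Q v) = k})"
    by (rule card_fibers[OF finite_dn[OF Q]])
  also have "\<dots> = (\<Sum>k<?a. card {v \<in> dn r P x. card (dn r P v) = k})"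
    using low_count by (intro sum.cong) (auto simp: dn_def)
  also have "\<dots> = card {v \<in> dn r P x. card (dn r P v) < ?a}"
    by (rule card_fibers[OF finite_dn[OF P], symmetric])
  also have "{v \<in> dn r P x. card (dn r P v) < ?a} = dn r P x - {x}"
    using card_dn_less[OF P _ x] by (auto simp: dn_def)
  also have "card \<dots> = ?a - 1" using dn_self[OF P x] finite_dn[OF P] by simp
  finally show ?thesis by (simp add: dn_def conj_assoc)
qed

text \<open>The balance of pairs at the size of the ideal of \<open>x\<close> itself. As the filter
  of \<open>z\<close> is smaller than that of \<open>x\<close>, some point below \<open>q\<close>
  has an ideal of this size; it is the only one iff the filter of \<open>z\<close> is smaller by
  exactly one.\<close>

lemma card_level: "card {u \<in> Q. (u, q) \<in> s \<and> card (dn s Q u) = card (dn r P x)} + card (up r P z) = card (up r P x)"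
proof -
  have "0 < card (up r P z)" using up_self[OF P z(1)] finite_up[OF P] by (auto simp: card_gt_0_iff)
  moreover have "0 < card (up r P x)" using up_self[OF P x] finite_up[OF P] by (auto simp: card_gt_0_iff)
  ultimately show ?thesis
  using pair_count_minus'[OF P x z_set] pair_count_minus[OF Q q less] pair_count_iso[OF iso]
    hypomorphic_pair_count[OF P Q hyp n4] by (smt (verit) add_diff_cancel_left' le_add_diff_inverse2 add.commute add.left_commute diff_add_inverse less_eq_Suc_le One_nat_def nat_less_le add_left_cancel)
qed

lemma card_up_z_less: "card (up r P z) < card (up r P x)"
  using card_up_less[OF P x z(1,2)] z(4) by simp

end

section \<open>Alternating sums over suborders\<close>

text \<open>A subset of size \<open>m\<close> survives in exactly \<open>card P - m\<close> cards,
  as in Kelly's counting argument.\<close>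

lemma sum_subsets_deletion:
  fixes G :: "'a set \<Rightarrow> int"
  assumes "finite P"
  shows "(\<Sum>v\<in>P. \<Sum>S | S \<subseteq> P - {v} \<and> card S = m. G S) = int (card P - m) * (\<Sum>S | S \<subseteq> P \<and> card S = m. G S)"
proof -
  let ?K = "{S. S \<subseteq> P \<and> card S = m}"
  have fK: "finite ?K" using assms by simp
  have "(\<Sum>v\<in>P. \<Sum>S | S \<subseteq> P - {v} \<and> card S = m. G S) = (\<Sum>v\<in>P. \<Sum>S\<in>?K. if v \<notin> S then G S else 0)"
  proof (rule sum.cong[OF refl])
    fix v
    have "{S. S \<subseteq> P - {v} \<and> card S = m} = {S \<in> ?K. v \<notin> S}" by blast
    then show "(\<Sum>S | S \<subseteq> P - {v} \<and> card S = m. G S) = (\<Sum>S\<in>?K. if v \<notin> S then G S else 0)"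
      using fK by (simp only: sum.inter_filter)
  qed
  also have "\<dots> = (\<Sum>S\<in>?K. \<Sum>v\<in>P. if v \<notin> S then G S else 0)" by (rule sum.swap)
  also have "\<dots> = (\<Sum>S\<in>?K. int (card P - m) * G S)"
  proof (intro sum.cong refl)
    fix S assume S: "S \<in> ?K"
    then have "finite S" using assms by (auto intro: finite_subset)
    have "(\<Sum>v\<in>P. if v \<notin> S then G S else 0) = (\<Sum>v\<in>{v \<in> P. v \<notin> S}. G S)"
      using assms by (simp only: sum.inter_filter)
    also have "{v \<in> P. v \<notin> S} = P - S" by blast
    finally show "(\<Sum>v\<in>P. if v \<notin> S then G S else 0) = int (card P - m) * G S"
      using S \<open>finite S\<close> by (simp add: card_Diff_subset)
  qed
  finally show ?thesis by (simp add: sum_distrib_left)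
qed

lemma sum_subsets_iso:
  fixes G :: "'a set \<Rightarrow> int" and G' :: "'b set \<Rightarrow> int"
  assumes "order_isomorphic A r B s"
    and inv: "\<And>S S'. S \<subseteq> A \<Longrightarrow> S' \<subseteq> B \<Longrightarrow> order_isomorphic S r S' s \<Longrightarrow> G S = G' S'"
  shows "(\<Sum>S | S \<subseteq> A \<and> card S = m. G S) = (\<Sum>S | S \<subseteq> B \<and> card S = m. G' S)"
proof -
  obtain f where f: "bij_betw f A B" "\<forall>x\<in>A. \<forall>y\<in>A. (x, y) \<in> r \<longleftrightarrow> (f x, f y) \<in> s"
    using assms(1) unfolding order_isomorphic_def by blast
  have inj: "inj_on f A" and B: "B = f ` A" using f(1) by (auto simp: bij_betw_def)
  have c: "card (f ` S) = card S" if "S \<subseteq> A" for S using inj that by (meson card_image inj_on_subset)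
  have "bij_betw ((`) f) {S. S \<subseteq> A \<and> card S = m} {S. S \<subseteq> B \<and> card S = m}"
    unfolding bij_betw_def
  proof
    have "inj_on ((`) f) (Pow A)" using inj by (rule inj_on_image_Pow)
    then show "inj_on ((`) f) {S. S \<subseteq> A \<and> card S = m}" by (rule inj_on_subset) auto
    show "(`) f ` {S. S \<subseteq> A \<and> card S = m} = {S. S \<subseteq> B \<and> card S = m}"
    proof
      show "(`) f ` {S. S \<subseteq> A \<and> card S = m} \<subseteq> {S. S \<subseteq> B \<and> card S = m}" using c B by auto
      show "{S. S \<subseteq> B \<and> card S = m} \<subseteq> (`) f ` {S. S \<subseteq> A \<and> card S = m}"
      proof
        fix S assume S: "S \<in> {S. S \<subseteq> B \<and> card S = m}"
        then obtain T where "T \<subseteq> A" "S = f ` T" unfolding B by (auto simp: subset_image_iff)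
        then show "S \<in> (`) f ` {S. S \<subseteq> A \<and> card S = m}" using S c by auto
      qed
    qed
  qed
  then have "(\<Sum>S | S \<subseteq> B \<and> card S = m. G' S) = (\<Sum>S | S \<subseteq> A \<and> card S = m. G' (f ` S))"
    by (rule sum.reindex_bij_betw[symmetric])
  also have "\<dots> = (\<Sum>S | S \<subseteq> A \<and> card S = m. G S)"
  proof (intro sum.cong refl)
    fix S assume "S \<in> {S. S \<subseteq> A \<and> card S = m}"
    then have S: "S \<subseteq> A" by blast
    have "order_isomorphic S r (f ` S) s"
      unfolding order_isomorphic_def bij_betw_def using S f(2) inj_on_subset[OF inj S] by blast
    moreover have "f ` S \<subseteq> B" using S B by blast
    ultimately show "G' (f ` S) = G S" using inv[OF S] by simp
  qed
  finally show ?thesis by simp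
qed

lemma kelly:
  fixes G :: "'a set \<Rightarrow> int" and G' :: "'b set \<Rightarrow> int"
  assumes "hypomorphic P r Q s" "finite P" "finite Q"
    and inv: "\<And>S S'. S \<subseteq> P \<Longrightarrow> S' \<subseteq> Q \<Longrightarrow> order_isomorphic S r S' s \<Longrightarrow> G S = G' S'"
    and m: "m < card P"
  shows "(\<Sum>S | S \<subseteq> P \<and> card S = m. G S) = (\<Sum>S | S \<subseteq> Q \<and> card S = m. G' S)"
proof -
  have n: "card P = card Q" using assms(1) by (rule hypomorphic_card)
  have "(\<Sum>v\<in>P. \<Sum>S | S \<subseteq> P - {v} \<and> card S = m. G S) = (\<Sum>w\<in>Q. \<Sum>S | S \<subseteq> Q - {w} \<and> card S = m. G' S)"
  proof (rule hypomorphic_sum[OF assms(1)])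
    fix v w assume "order_isomorphic (P - {v}) r (Q - {w}) s"
    then show "(\<Sum>S | S \<subseteq> P - {v} \<and> card S = m. G S) = (\<Sum>S | S \<subseteq> Q - {w} \<and> card S = m. G' S)"
      by (rule sum_subsets_iso) (use inv in blast)
  qed
  then show ?thesis unfolding sum_subsets_deletion[OF assms(2)] sum_subsets_deletion[OF assms(3)] using m n by simp
qed

lemma sum_Pow_by_card:
  fixes G :: "'a set \<Rightarrow> int"
  assumes "finite P"
  shows "(\<Sum>S\<in>Pow P. (-1) ^ card S * G S)
    = (\<Sum>m<card P. (-1) ^ m * (\<Sum>S | S \<subseteq> P \<and> card S = m. G S)) + (-1) ^ card P * G P"
proof -
  have "(\<Sum>S\<in>Pow P. (-1) ^ card S * G S) = (\<Sum>m\<in>{..card P}. \<Sum>S | S \<in> Pow P \<and> card S = m. (-1) ^ card S * G S)"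
    using assms card_mono[OF assms] by (intro sum.group[symmetric]) auto
  also have "\<dots> = (\<Sum>m\<in>{..card P}. (-1) ^ m * (\<Sum>S | S \<subseteq> P \<and> card S = m. G S))"
    by (simp add: sum_distrib_left)
  also have "\<dots> = (\<Sum>m<card P. (-1) ^ m * (\<Sum>S | S \<subseteq> P \<and> card S = m. G S))
     + (-1) ^ card P * (\<Sum>S | S \<subseteq> P \<and> card S = card P. G S)"
    by (simp add: lessThan_Suc_atMost[symmetric])
  also have "{S. S \<subseteq> P \<and> card S = card P} = {P}" using card_subset_eq[OF assms] by blast
  finally show ?thesis by simp
qed

text \<open>For a fixed configuration, inserting or removing its irrelevant point pairs off the
  subsets with opposite signs.\<close>

lemma alternating_sum_vanishes:
  assumes "finite P" "finite C"
    and irr: "\<And>c. c \<in> C \<Longrightarrow> \<exists>t\<in>P. \<forall>S\<subseteq>P - {t}. V (insert t S) c = V S c"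
  shows "(\<Sum>S\<in>Pow P. (-1) ^ card S * int (card {c \<in> C. V S c})) = 0"
proof -
  have "(\<Sum>S\<in>Pow P. (-1) ^ card S * int (card {c \<in> C. V S c}))
    = (\<Sum>S\<in>Pow P. \<Sum>c\<in>C. (-1) ^ card S * (if V S c then 1 else 0))"
    using assms(2) by (simp add: card_filter_sum sum_distrib_left) (simp add: of_nat_sum sum_distrib_left if_distrib cong: if_cong)
  also have "\<dots> = (\<Sum>c\<in>C. \<Sum>S\<in>Pow P. (-1) ^ card S * (if V S c then 1 else 0))" by (rule sum.swap)
  also have "\<dots> = (\<Sum>c\<in>C. 0)"
  proof (intro sum.cong refl)
    fix c assume "c \<in> C"
    then obtain t where t: "t \<in> P" "\<forall>S\<subseteq>P - {t}. V (insert t S) c = V S c" using irr by blast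
    let ?h = "\<lambda>S. (-1) ^ card S * (if V S c then 1 else 0) :: int"
    have Pow: "Pow P = Pow (P - {t}) \<union> insert t ` Pow (P - {t})"
      using t(1) Pow_insert[of t "P - {t}"] by (simp add: insert_absorb)
    have "sum ?h (Pow P) = sum ?h (Pow (P - {t})) + sum ?h (insert t ` Pow (P - {t}))"
      unfolding Pow by (rule sum.union_disjoint) (use assms(1) in auto)
    also have "sum ?h (insert t ` Pow (P - {t})) = sum (?h \<circ> insert t) (Pow (P - {t}))"
      by (rule sum.reindex) (auto intro!: inj_onI)
    also have "\<dots> = sum (\<lambda>S. - ?h S) (Pow (P - {t}))"
    proof (intro sum.cong refl)
      fix S assume S: "S \<in> Pow (P - {t})"
      then have "card (insert t S) = Suc (card S)" using assms(1) by (subst card_insert_disjoint) (auto intro: finite_subset)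
      then show "(?h \<circ> insert t) S = - ?h S" using t(2) S by simp
    qed
    finally show "sum ?h (Pow P) = 0" by (simp add: sum_negf)
  qed
  finally show ?thesis by simp
qed

text \<open>Kelly's lemma determines all sums over proper subsets; if every configuration has an
  irrelevant point then the alternating sum over all subsets vanishes, so that the value on
  the whole set is determined as well.\<close>
lemma configuration_count_eq:
  assumes hyp: "hypomorphic P r Q s" and fin: "finite P" "finite Q" "finite C" "finite C'"
    and inv: "\<And>S S'. S \<subseteq> P \<Longrightarrow> S' \<subseteq> Q \<Longrightarrow> order_isomorphic S r S' s
      \<Longrightarrow> card {c \<in> C. V S c} = card {c \<in> C'. V' S' c}"
    and irr: "\<And>c. c \<in> C \<Longrightarrow> \<exists>t\<in>P. \<forall>S\<subseteq>P - {t}. V (insert t S) c = V S c"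
    and irr': "\<And>c. c \<in> C' \<Longrightarrow> \<exists>t\<in>Q. \<forall>S\<subseteq>Q - {t}. V' (insert t S) c = V' S c"
  shows "card {c \<in> C. V P c} = card {c \<in> C'. V' Q c}"
proof -
  define G where "G = (\<lambda>S. int (card {c \<in> C. V S c}))"
  define G' where "G' = (\<lambda>S. int (card {c \<in> C'. V' S c}))"
  have n: "card P = card Q" using hyp by (rule hypomorphic_card)
  have "(\<Sum>m<card P. (-1) ^ m * (\<Sum>S | S \<subseteq> P \<and> card S = m. G S))
    = (\<Sum>m<card Q. (-1) ^ m * (\<Sum>S | S \<subseteq> Q \<and> card S = m. G' S))"
    unfolding n[symmetric]
  proof (intro sum.cong refl arg_cong2[of _ _ _ _ "(*)"])
    fix m assume "m \<in> {..<card P}"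
    then show "(\<Sum>S | S \<subseteq> P \<and> card S = m. G S) = (\<Sum>S | S \<subseteq> Q \<and> card S = m. G' S)"
      by (intro kelly[OF hyp fin(1,2)]) (auto simp: G_def G'_def inv)
  qed
  moreover have "(\<Sum>S\<in>Pow P. (-1) ^ card S * G S) = 0"
    unfolding G_def by (rule alternating_sum_vanishes[OF fin(1,3)]) (rule irr)
  moreover have "(\<Sum>S\<in>Pow Q. (-1) ^ card S * G' S) = 0"
    unfolding G'_def by (rule alternating_sum_vanishes[OF fin(2,4)]) (rule irr')
  ultimately have "(-1) ^ card P * G P = (-1) ^ card Q * G' Q"
    unfolding sum_Pow_by_card[OF fin(1)] sum_Pow_by_card[OF fin(2)] by linarith
  then have "G P = G' Q" using n by simp
  then show ?thesis by (simp add: G_def G'_def)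
qed

section \<open>Autonomous sets and twins\<close>

definition order_module :: "'a set \<Rightarrow> 'a rel \<Rightarrow> 'a set \<Rightarrow> bool" where
  "order_module P r A \<longleftrightarrow> A \<subseteq> P \<and> (\<forall>v\<in>P - A. \<forall>a\<in>A. \<forall>b\<in>A.
     ((v, a) \<in> r \<longleftrightarrow> (v, b) \<in> r) \<and> ((a, v) \<in> r \<longleftrightarrow> (b, v) \<in> r))"

text \<open>The given isomorphism is extended by the identity outside \<open>A\<close>; autonomy
  makes the relations across the boundary independent of the points of \<open>A\<close>
  involved.\<close>

lemma module_replace:
  assumes A: "order_module P r A" and k: "k \<in> A" "k' \<in> A"
    and iso: "order_isomorphic (A - {k}) r (A - {k'}) r"
  shows "order_isomorphic (P - {k}) r (P - {k'}) r"
proof -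
  obtain f where f: "bij_betw f (A - {k}) (A - {k'})"
    "\<forall>x\<in>A - {k}. \<forall>y\<in>A - {k}. (x, y) \<in> r \<longleftrightarrow> (f x, f y) \<in> r"
    using iso unfolding order_isomorphic_def by blast
  define g where "g v = (if v \<in> A then f v else v)" for v
  have g1: "bij_betw g (A - {k}) (A - {k'})" using f(1) by (rule bij_betw_cong[THEN iffD1, rotated]) (simp add: g_def)
  have "bij_betw id (P - A) (P - A)" by simp
  then have g2: "bij_betw g (P - A) (P - A)" by (rule bij_betw_cong[THEN iffD1, rotated]) (simp add: g_def)
  have "bij_betw g ((A - {k}) \<union> (P - A)) ((A - {k'}) \<union> (P - A))"
    by (rule bij_betw_combine[OF g1 g2]) blast
  moreover have "(A - {k}) \<union> (P - A) = P - {k}" "(A - {k'}) \<union> (P - A) = P - {k'}"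
    using A k by (auto simp: order_module_def)
  moreover have "(v, w) \<in> r \<longleftrightarrow> (g v, g w) \<in> r" if "v \<in> P - {k}" "w \<in> P - {k}" for v w
  proof -
    have fA: "f u \<in> A" if "u \<in> A" "u \<noteq> k" for u using bij_betwE[OF f(1)] that by blast
    have mod: "(u, a) \<in> r \<longleftrightarrow> (u, b) \<in> r" "(a, u) \<in> r \<longleftrightarrow> (b, u) \<in> r" if "u \<in> P" "u \<notin> A" "a \<in> A" "b \<in> A" for u a b
      using A that unfolding order_module_def by blast+
    show ?thesis
    proof (cases "v \<in> A"; cases "w \<in> A")
      assume "v \<in> A" "w \<in> A" then show ?thesis using f(2) that by (simp add: g_def)
    next
      assume h: "v \<in> A" "w \<notin> A"
      then show ?thesis using mod(2)[of w v "f v"] fA[of v] that by (simp add: g_def)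
    next
      assume h: "v \<notin> A" "w \<in> A"
      then show ?thesis using mod(1)[of v w "f w"] fA[of w] that by (simp add: g_def)
    qed (simp add: g_def)
  qed
  ultimately have "bij_betw g (P - {k}) (P - {k'}) \<and> (\<forall>v\<in>P - {k}. \<forall>w\<in>P - {k}. (v, w) \<in> r \<longleftrightarrow> (g v, g w) \<in> r)"
    by simp
  then show ?thesis unfolding order_isomorphic_def by blast
qed

text \<open>The hypotheses on ideal and filter make \<open>{x, z}\<close> autonomous, and removing
  either point leaves a singleton.\<close>

lemma twin_swap:
  assumes P: "fpo P r" and x: "x \<in> P" and z: "z \<in> P" and "x \<noteq> z"
    and d: "dn r P z = insert z (dn r P x)" and u: "up r P x = insert x (up r P z)"
  shows "order_isomorphic (P - {x}) r (P - {z}) r"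
proof (rule module_replace)
  have dd: "(v, z) \<in> r \<longleftrightarrow> (v, x) \<in> r" if "v \<in> P" "v \<noteq> z" for v
    using d that by (auto simp: dn_def set_eq_iff)
  have uu: "(x, v) \<in> r \<longleftrightarrow> (z, v) \<in> r" if "v \<in> P" "v \<noteq> x" for v
    using u that by (auto simp: up_def set_eq_iff)
  show "order_module P r {x, z}" unfolding order_module_def using x z dd uu by auto
  have "{x, z} - {x} = {z}" "{x, z} - {z} = {x}" using assms(4) by auto
  moreover have "order_isomorphic {z} r {x} r"
    unfolding order_isomorphic_def using fpo_refl[OF P x] fpo_refl[OF P z]
    by (intro exI[of _ "\<lambda>_. x"]) (auto simp: bij_betw_def)
  ultimately show "order_isomorphic ({x, z} - {x}) r ({x, z} - {z}) r" by simp
qed auto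

section \<open>Configurations\<close>

text \<open>The low part of the ideal of \<open>y\<close>. With the converse relation it becomes the
  set of points above \<open>y\<close> whose filters have fewer than \<open>a\<close>
  elements.\<close>

definition lowdn :: "nat \<Rightarrow> 'a set \<Rightarrow> 'a rel \<Rightarrow> 'a \<Rightarrow> 'a set" where
  "lowdn a P r y = {u \<in> dn r P y. card (dn r P u) < a}"

lemma finite_lowdn: "fpo P r \<Longrightarrow> finite (lowdn a P r y)"
  by (simp add: lowdn_def finite_dn)

text \<open>Among the points below \<open>y\<close> with ideals of size at least \<open>a\<close>,
  one with the smallest ideal has only low points strictly below it, and there are at least
  \<open>a - 1\<close> of these.\<close>

lemma card_lowdn_ge:
  assumes P: "fpo P r" and y: "y \<in> P" "a \<le> card (dn r P y)"
  shows "a - 1 \<le> card (lowdn a P r y)"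
proof -
  let ?A = "{u \<in> dn r P y. a \<le> card (dn r P u)}"
  have "y \<in> ?A" using dn_self[OF P] y by simp
  then obtain u where u: "u \<in> ?A" "\<And>w. w \<in> ?A \<Longrightarrow> card (dn r P u) \<le> card (dn r P w)"
    using ex_has_least_nat[of "\<lambda>u. u \<in> ?A" y "\<lambda>u. card (dn r P u)"] by blast
  have uP: "u \<in> P" "(u, y) \<in> r" using u(1) by (auto simp: dn_def)
  have "dn r P u - {u} \<subseteq> lowdn a P r y"
  proof
    fix w assume w: "w \<in> dn r P u - {u}"
    then have wP: "w \<in> P" "(w, u) \<in> r" "w \<noteq> u" by (auto simp: dn_def)
    then have "card (dn r P w) < card (dn r P u)" using card_dn_less[OF P _ uP(1)] by blast
    moreover have "w \<in> dn r P y" using fpo_trans[OF P wP(1) uP(1) y(1) wP(2) uP(2)] wP by (simp add: dn_def)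
    moreover from calculation have "\<not> a \<le> card (dn r P w)" using u(2)[of w] by auto
    ultimately show "w \<in> lowdn a P r y" by (simp add: lowdn_def)
  qed
  then have "card (dn r P u - {u}) \<le> card (lowdn a P r y)" by (rule card_mono[OF finite_lowdn[OF P]])
  moreover have "card (dn r P u - {u}) = card (dn r P u) - 1" using dn_self[OF P uP(1)] finite_dn[OF P] by simp
  moreover have "a \<le> card (dn r P u)" using u(1) by simp
  ultimately show ?thesis by linarith
qed

lemma lowdn_mono:
  assumes "fpo P r" "u \<in> P" "y \<in> P" "(u, y) \<in> r" shows "lowdn a P r u \<subseteq> lowdn a P r y"
  using dn_mono[OF assms] by (auto simp: lowdn_def)

text \<open>Low parts grow upwards and have at least \<open>a - 1\<close> elements, so equality at
  \<open>y\<close> leaves no room. A point attaining the bound is called pure in the sequel; purity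
  makes the low part constant along comparabilities, hence on components.\<close>

lemma lowdn_eq:
  assumes "fpo P r" "u \<in> P" "y \<in> P" "(u, y) \<in> r" "a \<le> card (dn r P u)" "card (lowdn a P r y) = a - 1"
  shows "lowdn a P r u = lowdn a P r y"
  using card_lowdn_ge[OF assms(1,2,5)] card_seteq[OF finite_lowdn[OF assms(1)] lowdn_mono[OF assms(1-4)]] assms(6)
  by simp

lemma lowdn_minus:
  assumes "fpo P r" "x \<in> P" "y \<in> P" "y \<noteq> x" "a \<le> card (dn r P x)"
  shows "lowdn a (P - {x}) r y = lowdn a P r y"
proof -
  have "card (dn r (P - {x}) u) < a \<longleftrightarrow> card (dn r P u) < a" if "u \<in> P" "u \<noteq> x" for u
    using dn_minus_card[OF assms(1,2) that(1)] card_dn_less[OF assms(1,2) that(1)] that(2) assms(5) by auto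
  moreover have "x \<notin> lowdn a P r y" using assms(5) by (simp add: lowdn_def)
  ultimately have "u \<in> lowdn a (P - {x}) r y \<longleftrightarrow> u \<in> lowdn a P r y" for u
    unfolding lowdn_def dn_minus[of r P x y] using dn_subset[of r P y] by blast
  then show ?thesis by blast
qed

lemma dn_minus_ge:
  assumes "fpo P r" "x \<in> P" "y \<in> P" "y \<noteq> x" "a \<le> card (dn r P x)"
  shows "a \<le> card (dn r (P - {x}) y) \<longleftrightarrow> a \<le> card (dn r P y)"
  using dn_minus_card[OF assms(1,2,3)] card_dn_less[OF assms(1,2,3)] assms(4,5) by auto

text \<open>Walks and embeddings of patterns are both configurations: \<open>pat\<close> prescribes the order on the
  list \<open>ys\<close>, \<open>lab\<close> the sizes of the low parts of the ideals. The set \<open>T\<close> excludes points with few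
  upper bounds from the count.\<close>
definition config :: "nat \<Rightarrow> nat \<Rightarrow> nat \<Rightarrow> ((nat \<Rightarrow> nat \<Rightarrow> bool) \<Rightarrow> bool) \<Rightarrow> ((nat \<Rightarrow> nat) \<Rightarrow> bool)
    \<Rightarrow> 'a rel \<Rightarrow> 'a set \<Rightarrow> 'a set \<times> 'a list \<Rightarrow> bool" where
  "config t a m pat lab r S c \<longleftrightarrow> fst c \<subseteq> S \<and> card (fst c) = t \<and> length (snd c) = m \<and> set (snd c) \<subseteq> S
    \<and> (\<forall>y\<in>set (snd c). \<forall>w\<in>fst c. (y, w) \<in> r \<and> y \<noteq> w)
    \<and> (\<forall>y\<in>set (snd c). a \<le> card (dn r S y))
    \<and> pat (\<lambda>i j. i < m \<and> j < m \<and> (snd c ! i, snd c ! j) \<in> r)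
    \<and> lab (\<lambda>i. if i < m then card (lowdn a S r (snd c ! i)) else 0)"

text \<open>Candidates independent of the suborder, so that the sums over suborders and over
  configurations can be interchanged.\<close>

definition config_space :: "nat \<Rightarrow> 'a set \<Rightarrow> ('a set \<times> 'a list) set" where
  "config_space m P = Pow P \<times> {ys. set ys \<subseteq> P \<and> length ys = m}"

lemma finite_config_space: "finite P \<Longrightarrow> finite (config_space m P)"
  unfolding config_space_def by (intro finite_cartesian_product finite_lists_length_eq) auto

lemma config_in_space: "config t a m pat lab r S c \<Longrightarrow> S \<subseteq> P \<Longrightarrow> c \<in> config_space m P"
  unfolding config_def config_space_def by (cases c) auto

lemma config_count_le:
  assumes "order_isomorphic S r S' s" "S \<subseteq> P" "S' \<subseteq> Q" "finite P" "finite Q"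
  shows "card {c \<in> config_space m P. config t a m pat lab r S c} \<le> card {c \<in> config_space m Q. config t a m pat lab s S' c}"
proof -
  obtain f where f: "bij_betw f S S'" "\<forall>x\<in>S. \<forall>y\<in>S. (x, y) \<in> r \<longleftrightarrow> (f x, f y) \<in> s"
    using assms(1) unfolding order_isomorphic_def by blast
  have inj: "inj_on f S" and S': "S' = f ` S" using f(1) by (auto simp: bij_betw_def)
  define h where "h c = (f ` fst c, map f (snd c))" for c
  have low: "card (lowdn a S' s (f y)) = card (lowdn a S r y)" if y: "y \<in> S" for y
  proof -
    have "lowdn a S' s (f y) = f ` lowdn a S r y"
      using iso_dn(2)[OF f] y unfolding lowdn_def iso_dn(1)[OF f y] by (auto simp: dn_def)
    moreover have "inj_on f (lowdn a S r y)" using inj by (rule inj_on_subset) (auto simp: lowdn_def dn_def)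
    ultimately show ?thesis by (simp add: card_image)
  qed
  show ?thesis
  proof (rule card_inj_on_le[of h])
    show "inj_on h {c \<in> config_space m P. config t a m pat lab r S c}"
    proof (rule inj_onI)
      fix c d assume c: "c \<in> {c \<in> config_space m P. config t a m pat lab r S c}"
        and d: "d \<in> {c \<in> config_space m P. config t a m pat lab r S c}" and e: "h c = h d"
      have s: "fst c \<subseteq> S" "set (snd c) \<subseteq> S" "fst d \<subseteq> S" "set (snd d) \<subseteq> S"
        using c d by (auto simp: config_def)
      have "fst c = fst d" using e s inj by (auto simp: h_def inj_on_image_eq_iff)
      moreover have "snd c = snd d"
        using e s inj by (auto simp: h_def intro!: map_inj_on[of f "snd c" "snd d"] inj_on_subset[OF inj])
      ultimately show "c = d" by (rule prod_eqI)
    qed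
    show "finite {c \<in> config_space m Q. config t a m pat lab s S' c}"
      using finite_config_space[OF assms(5)] by simp
    show "h ` {c \<in> config_space m P. config t a m pat lab r S c} \<subseteq> {c \<in> config_space m Q. config t a m pat lab s S' c}"
    proof
      fix d assume "d \<in> h ` {c \<in> config_space m P. config t a m pat lab r S c}"
      then obtain c where c: "config t a m pat lab r S c" "d = h c" by blast
      obtain T ys where Ty: "c = (T, ys)" by (cases c)
      have T: "T \<subseteq> S" "card T = t" "length ys = m" "set ys \<subseteq> S" "\<forall>y\<in>set ys. \<forall>w\<in>T. (y, w) \<in> r \<and> y \<noteq> w"
        "\<forall>y\<in>set ys. a \<le> card (dn r S y)"
        and pat: "pat (\<lambda>i j. i < m \<and> j < m \<and> (ys ! i, ys ! j) \<in> r)"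
        and lab: "lab (\<lambda>i. if i < m then card (lowdn a S r (ys ! i)) else 0)"
        using c(1) unfolding config_def Ty fst_conv snd_conv by blast+
      have nth: "ys ! i \<in> S" if "i < m" for i using T(3,4) that nth_mem by blast
      have e1: "(\<lambda>i j. i < m \<and> j < m \<and> (map f ys ! i, map f ys ! j) \<in> s) = (\<lambda>i j. i < m \<and> j < m \<and> (ys ! i, ys ! j) \<in> r)"
        using nth f(2) T(3) by (intro ext) auto
      have e2: "(\<lambda>i. if i < m then card (lowdn a S' s (map f ys ! i)) else 0) = (\<lambda>i. if i < m then card (lowdn a S r (ys ! i)) else 0)"
        using nth low T(3) by (intro ext) auto
      have "f ` T \<subseteq> S'" "set (map f ys) \<subseteq> S'" using T S' by auto
      moreover have "card (f ` T) = t" using T(1,2) inj by (metis card_image inj_on_subset)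
      moreover have "\<forall>y\<in>set (map f ys). \<forall>w\<in>f ` T. (y, w) \<in> s \<and> y \<noteq> w"
      proof (intro ballI)
        fix y w assume "y \<in> set (map f ys)" "w \<in> f ` T"
        then obtain y0 w0 where yw: "y = f y0" "w = f w0" "y0 \<in> set ys" "w0 \<in> T" by auto
        then have "(y0, w0) \<in> r" "y0 \<noteq> w0" "y0 \<in> S" "w0 \<in> S" using T by auto
        then show "(y, w) \<in> s \<and> y \<noteq> w" using yw f(2) inj by (auto dest: inj_onD)
      qed
      moreover have "\<forall>y\<in>set (map f ys). a \<le> card (dn s S' y)" using T iso_dn(2)[OF f] by auto
      ultimately have "config t a m pat lab s S' d"
        using T(3) pat lab unfolding config_def c(2) h_def Ty fst_conv snd_conv e1 e2 by (simp only: length_map simp_thms)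
      then show "d \<in> {c \<in> config_space m Q. config t a m pat lab s S' c}"
        using config_in_space[OF _ assms(3)] by blast
    qed
  qed
qed

lemma config_count_iso:
  assumes "order_isomorphic S r S' s" "S \<subseteq> P" "S' \<subseteq> Q" "finite P" "finite Q"
  shows "card {c \<in> config_space m P. config t a m pat lab r S c} = card {c \<in> config_space m Q. config t a m pat lab s S' c}"
  using config_count_le[OF assms] config_count_le[OF order_isomorphic_sym[OF assms(1)] assms(3,2,5,4)]
  by (rule antisym)

text \<open>All sizes are computed inside the ideals of listed points, and by transitivity these
  contain the ideals of their own members. A point outside the upper set that is below no listed
  point is never consulted.\<close>

lemma config_irrelevant:
  assumes P: "fpo P r" and t: "t \<in> P" "t \<notin> fst c" "\<And>y. y \<in> set (snd c) \<Longrightarrow> (t, y) \<notin> r"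
    and S: "S \<subseteq> P - {t}"
  shows "config k a m pat lab r (insert t S) c = config k a m pat lab r S c"
proof (cases "set (snd c) \<subseteq> S")
  case False
  have "t \<notin> set (snd c)" using t(3) fpo_refl[OF P t(1)] by blast
  then have "\<not> set (snd c) \<subseteq> insert t S" using False by blast
  then show ?thesis using False by (simp add: config_def)
next
  case True
  have d: "dn r (insert t S) y = dn r S y" if "(t, y) \<notin> r" for y using that by (auto simp: dn_def)
  have lw: "lowdn a (insert t S) r y = lowdn a S r y" if y: "y \<in> set (snd c)" for y
  proof -
    have "(t, u) \<notin> r" if "u \<in> dn r S y" for u
      using that t(3)[OF y] fpo_trans[OF P t(1), of u y] True S y by (auto simp: dn_def)
    then show ?thesis using d[OF t(3)[OF y]] d by (auto simp: lowdn_def)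
  qed
  have "fst c \<subseteq> insert t S \<longleftrightarrow> fst c \<subseteq> S" "set (snd c) \<subseteq> insert t S" using t(2) True by auto
  moreover have "(\<forall>y\<in>set (snd c). a \<le> card (dn r (insert t S) y)) \<longleftrightarrow> (\<forall>y\<in>set (snd c). a \<le> card (dn r S y))"
    using d t(3) by simp
  moreover have "length (snd c) = m \<Longrightarrow> (\<lambda>i. if i < m then card (lowdn a (insert t S) r (snd c ! i)) else 0)
     = (\<lambda>i. if i < m then card (lowdn a S r (snd c ! i)) else 0)"
    using lw by (intro ext) auto
  ultimately show ?thesis unfolding config_def using True by (auto simp only:)
qed

text \<open>The inner alternative with \<open>\<not> config\<close> covers candidates that are a
  configuration of no suborder at all; for these any point is irrelevant.\<close>

lemma config_count_eq:
  assumes P: "fpo P r" and Q: "fpo Q s" and hyp: "hypomorphic P r Q s"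
    and "order_isomorphic P r Q s \<or>
      (\<forall>c\<in>config_space m P. (\<exists>v\<in>P. v \<notin> fst c \<and> (\<forall>y\<in>set (snd c). (v, y) \<notin> r)) \<or> P \<noteq> {} \<and> (\<forall>S\<subseteq>P. \<not> config t a m pat lab r S c)) \<and>
      (\<forall>c\<in>config_space m Q. (\<exists>v\<in>Q. v \<notin> fst c \<and> (\<forall>y\<in>set (snd c). (v, y) \<notin> s)) \<or> Q \<noteq> {} \<and> (\<forall>S\<subseteq>Q. \<not> config t a m pat lab s S c))"
  shows "card {c \<in> config_space m P. config t a m pat lab r P c} = card {c \<in> config_space m Q. config t a m pat lab s Q c}"
  using assms(4)
proof
  assume "order_isomorphic P r Q s"
  then show ?thesis by (rule config_count_iso) (auto simp: fpo_finite[OF P] fpo_finite[OF Q])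
next
  have gen: "\<exists>v\<in>A. \<forall>S\<subseteq>A - {v}. config t a m pat lab u (insert v S) c = config t a m pat lab u S c"
    if "fpo A u" and h: "(\<exists>v\<in>A. v \<notin> fst c \<and> (\<forall>y\<in>set (snd c). (v, y) \<notin> u)) \<or> A \<noteq> {} \<and> (\<forall>S\<subseteq>A. \<not> config t a m pat lab u S c)"
    for A :: "'c set" and u c
    using h
  proof
    assume "\<exists>v\<in>A. v \<notin> fst c \<and> (\<forall>y\<in>set (snd c). (v, y) \<notin> u)"
    then obtain v where v: "v \<in> A" "v \<notin> fst c" "\<And>y. y \<in> set (snd c) \<Longrightarrow> (v, y) \<notin> u" by blast
    then show ?thesis using config_irrelevant[OF that(1) v] by blast
  next
    assume "A \<noteq> {} \<and> (\<forall>S\<subseteq>A. \<not> config t a m pat lab u S c)"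
    then obtain v where "v \<in> A" "\<forall>S\<subseteq>A. \<not> config t a m pat lab u S c" by blast
    moreover from this have "insert v S \<subseteq> A" if "S \<subseteq> A - {v}" for S using that by blast
    ultimately show ?thesis by (intro bexI[of _ v]) (meson Diff_subset order_trans)+
  qed
  assume h: "(\<forall>c\<in>config_space m P. (\<exists>v\<in>P. v \<notin> fst c \<and> (\<forall>y\<in>set (snd c). (v, y) \<notin> r)) \<or> P \<noteq> {} \<and> (\<forall>S\<subseteq>P. \<not> config t a m pat lab r S c)) \<and>
      (\<forall>c\<in>config_space m Q. (\<exists>v\<in>Q. v \<notin> fst c \<and> (\<forall>y\<in>set (snd c). (v, y) \<notin> s)) \<or> Q \<noteq> {} \<and> (\<forall>S\<subseteq>Q. \<not> config t a m pat lab s S c))"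
  show ?thesis
  proof (rule configuration_count_eq[OF hyp])
    show "\<exists>v\<in>P. \<forall>S\<subseteq>P - {v}. config t a m pat lab r (insert v S) c = config t a m pat lab r S c"
      if "c \<in> config_space m P" for c by (rule gen[OF P bspec[OF conjunct1[OF h] that]])
    show "\<exists>v\<in>Q. \<forall>S\<subseteq>Q - {v}. config t a m pat lab s (insert v S) c = config t a m pat lab s S c"
      if "c \<in> config_space m Q" for c by (rule gen[OF Q bspec[OF conjunct2[OF h] that]])
    show fin: "finite P" "finite Q" using fpo_finite P Q by blast+
    show "finite (config_space m P)" "finite (config_space m Q)" using fin finite_config_space by blast+
    show "card {c \<in> config_space m P. config t a m pat lab r S c} = card {c \<in> config_space m Q. config t a m pat lab s S' c}"
      if "S \<subseteq> P" "S' \<subseteq> Q" "order_isomorphic S r S' s" for S S'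
      using config_count_iso[OF that(3,1,2) fin] .
  qed
qed

text \<open>A point strictly above \<open>x\<close> has an ideal of more than \<open>a\<close>
  elements, so losing \<open>x\<close> does not carry it below the threshold. As \<open>x\<close>
  itself is not low, low parts do not change either.\<close>

lemma config_minus:
  assumes P: "fpo P r" "x \<in> P" and a: "a \<le> card (dn r P x)" and c: "x \<notin> fst c" "x \<notin> set (snd c)"
  shows "config t a m pat lab r (P - {x}) c \<longleftrightarrow> config t a m pat lab r P c"
proof (cases "set (snd c) \<subseteq> P")
  case False
  then show ?thesis by (auto simp: config_def)
next
  case True
  have ne: "y \<in> P" "y \<noteq> x" if "y \<in> set (snd c)" for y using that True c by auto
  have "(\<forall>y\<in>set (snd c). a \<le> card (dn r (P - {x}) y)) \<longleftrightarrow> (\<forall>y\<in>set (snd c). a \<le> card (dn r P y))"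
    using dn_minus_ge[OF P ne a] by blast
  moreover have "length (snd c) = m \<Longrightarrow> (\<lambda>i. if i < m then card (lowdn a (P - {x}) r (snd c ! i)) else 0)
     = (\<lambda>i. if i < m then card (lowdn a P r (snd c ! i)) else 0)"
    using lowdn_minus[OF P ne a] by (intro ext) auto
  moreover have "fst c \<subseteq> P - {x} \<longleftrightarrow> fst c \<subseteq> P" "set (snd c) \<subseteq> P - {x} \<longleftrightarrow> set (snd c) \<subseteq> P" using c by auto
  ultimately show ?thesis unfolding config_def by (auto simp only:)
qed

lemma config_count_minus:
  assumes P: "fpo P r" "x \<in> P" and a: "a \<le> card (dn r P x)"
  shows "card {c \<in> config_space m P. config t a m pat lab r P c}
    = card {c \<in> config_space m P. config t a m pat lab r (P - {x}) c}
    + card {c \<in> config_space m P. config t a m pat lab r P c \<and> (x \<in> fst c \<or> x \<in> set (snd c))}"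
proof -
  have "{c \<in> config_space m P. config t a m pat lab r P c}
    = {c \<in> config_space m P. config t a m pat lab r (P - {x}) c}
    \<union> {c \<in> config_space m P. config t a m pat lab r P c \<and> (x \<in> fst c \<or> x \<in> set (snd c))}" (is "?A = ?B \<union> ?C")
  proof (rule set_eqI)
    fix c
    have "config t a m pat lab r (P - {x}) c \<Longrightarrow> x \<notin> fst c \<and> x \<notin> set (snd c)" by (auto simp: config_def)
    then show "c \<in> ?A \<longleftrightarrow> c \<in> ?B \<union> ?C" using config_minus[OF P a, of c t m pat lab] by blast
  qed
  moreover have "?B \<inter> ?C = {}" by (auto simp: config_def)
  ultimately show ?thesis
    using finite_config_space[OF fpo_finite[OF P(1)]] by (simp add: card_Un_disjoint)
qed

section \<open>Ordinal sums with an upper summand of given size\<close>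

definition top_part :: "'a set \<Rightarrow> 'a rel \<Rightarrow> 'a set \<Rightarrow> bool" where
  "top_part P r T \<longleftrightarrow> T \<subseteq> P \<and> (\<forall>v\<in>P - T. \<forall>w\<in>T. (v, w) \<in> r)"

lemma top_part_up:
  assumes "fpo P r" "top_part P r T" "w \<in> T" shows "up r P w \<subseteq> T"
proof
  fix v assume v: "v \<in> up r P w"
  show "v \<in> T"
  proof (rule ccontr)
    assume "v \<notin> T"
    then have "(v, w) \<in> r" "v \<in> P" "w \<in> P" "(w, v) \<in> r" using v assms(2,3) by (auto simp: up_def top_part_def)
    then have "v = w" using fpo_antisym[OF assms(1)] by blast
    then show False using \<open>v \<notin> T\<close> assms(3) by blast
  qed
qed

lemma top_part_up_ge:
  assumes "fpo P r" "top_part P r T" "v \<in> P" "v \<notin> T" "A \<subseteq> P" "v \<in> A"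
  shows "Suc (card (T \<inter> A)) \<le> card (up r A v)"
proof -
  have fin: "finite A" using assms(1,5) by (auto simp: fpo_finite intro: finite_subset)
  have "insert v (T \<inter> A) \<subseteq> up r A v"
    using assms fpo_refl[OF assms(1,3)] by (auto simp: up_def top_part_def)
  then have "card (insert v (T \<inter> A)) \<le> card (up r A v)"
    using fin by (intro card_mono) (auto simp: up_def)
  moreover have "card (insert v (T \<inter> A)) = Suc (card (T \<inter> A))" using assms(4) fin by simp
  ultimately show ?thesis by simp
qed

text \<open>A point outside \<open>T\<close> has more than \<open>t\<close> points in its filter
  already in the card. So the \<open>t\<close> points above \<open>q\<close> with filters of size at
  most \<open>t\<close> come from \<open>T\<close> and, by their number, are its whole image; hence
  \<open>q\<close> lies below the image as well.\<close>

lemma top_part_transfer: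
  assumes P: "fpo P r" and Q: "fpo Q s" and x: "x \<in> P" and q: "q \<in> Q"
    and f: "bij_betw f (P - {x}) (Q - {q})" "\<forall>v\<in>P - {x}. \<forall>w\<in>P - {x}. (v, w) \<in> r \<longleftrightarrow> (f v, f w) \<in> s"
    and T: "top_part P r T" "card T = t" "x \<notin> T"
    and X: "card {w \<in> Q. (q, w) \<in> s \<and> w \<noteq> q \<and> card (up s Q w) \<le> t} = t"
  shows "top_part Q s (f ` T)" "card (f ` T) = t"
proof -
  let ?X = "{w \<in> Q. (q, w) \<in> s \<and> w \<noteq> q \<and> card (up s Q w) \<le> t}"
  have inj: "inj_on f (P - {x})" and im: "f ` (P - {x}) = Q - {q}" using f(1) by (auto simp: bij_betw_def)
  have TP: "T \<subseteq> P - {x}" using T by (auto simp: top_part_def)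
  then show c: "card (f ` T) = t" using inj T(2) by (metis card_image inj_on_subset)
  have X1: "?X \<subseteq> f ` T"
  proof
    fix w assume w: "w \<in> ?X"
    then have "w \<in> f ` (P - {x})" unfolding im by simp
    then obtain v where v: "v \<in> P - {x}" "w = f v" by blast
    show "w \<in> f ` T"
    proof (rule ccontr)
      assume "w \<notin> f ` T"
      then have "v \<notin> T" using v by blast
      then have "Suc (card (T \<inter> (P - {x}))) \<le> card (up r (P - {x}) v)"
        using v by (intro top_part_up_ge[OF P T(1)]) auto
      also have "card (up r (P - {x}) v) = card (up s (Q - {q}) w)" using iso_dn(4)[OF f v(1)] v(2) by simp
      also have "\<dots> \<le> card (up s Q w)" using finite_up[OF Q] by (intro card_mono) (auto simp: up_def)
      also have "\<dots> \<le> t" using w by blast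
      finally show False using TP T(2) by (simp add: Int_absorb2)
    qed
  qed
  have "finite T" using TP fpo_finite[OF P] by (auto intro: finite_subset)
  then have "finite (f ` T)" by simp
  moreover have "card ?X = card (f ` T)" using X c by simp
  ultimately have X: "?X = f ` T" using X1 by (intro card_subset_eq)
  show "top_part Q s (f ` T)"
    unfolding top_part_def
  proof (intro conjI ballI)
    show "f ` T \<subseteq> Q" using im TP by blast
    fix v w assume v: "v \<in> Q - f ` T" and w: "w \<in> f ` T"
    show "(v, w) \<in> s"
    proof (cases "v = q")
      case True then show ?thesis using X w by blast
    next
      case False
      then have "v \<in> f ` (P - {x})" unfolding im using v by simp
      then obtain v0 where v0: "v0 \<in> P - {x}" "v = f v0" by blast
      obtain w0 where w0: "w0 \<in> T" "w = f w0" using w by blast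
      have "v0 \<notin> T" using v v0 by blast
      then have "(v0, w0) \<in> r" using T(1) v0(1) w0(1) by (simp add: top_part_def)
      moreover have "w0 \<in> P - {x}" using TP w0(1) by blast
      ultimately show ?thesis using f(2) v0 w0(2) by simp
    qed
  qed
qed

context removal_pair
begin

abbreviation "a \<equiv> card (dn r P x)"
abbreviation "b \<equiv> card (up s Q q)"
abbreviation "t \<equiv> card (up s Q q) - 1"

lemma b_pos: "0 < b" using up_self[OF Q q] finite_up[OF Q] by (auto simp: card_gt_0_iff)
lemma a_pos: "0 < a" using card_dn_pos[OF P x] .

lemma card_high: "card {v \<in> P. (x, v) \<in> r \<and> card (up r P v) < b} = t"
  using removal_pair.card_low[OF dual] by simp

lemma card_up_q: "{w \<in> Q. (q, w) \<in> s \<and> w \<noteq> q \<and> card (up s Q w) \<le> t} = up s Q q - {q}"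
proof -
  have "card (up s Q w) \<le> t" if "w \<in> Q" "(q, w) \<in> s" "w \<noteq> q" for w
    using card_up_less[OF Q q that(1,2) that(3)[symmetric]] by linarith
  then show ?thesis by (auto simp: up_def)
qed

text \<open>If one of the two orders is an ordinal sum with upper summand of the critical size, then a
  card obtained by removing a point of that summand shows that the orders are isomorphic.\<close>
lemma top_part_iso:
  assumes two: "2 \<le> card {v \<in> P. (x, v) \<in> r \<and> card (up r P v) = b}" and t: "1 \<le> t"
    and T: "(top_part P r T \<and> card T = t) \<or> (top_part Q s T' \<and> card T' = t)"
  shows "order_isomorphic P r Q s"
proof -
  obtain f where f: "bij_betw f (P - {x}) (Q - {q})" "\<forall>v\<in>P - {x}. \<forall>w\<in>P - {x}. (v, w) \<in> r \<longleftrightarrow> (f v, f w) \<in> s"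
    using iso unfolding order_isomorphic_def by blast
  obtain g where g: "bij_betw g (Q - {q}) (P - {x})" "\<forall>v\<in>Q - {q}. \<forall>w\<in>Q - {q}. (v, w) \<in> s \<longleftrightarrow> (g v, g w) \<in> r"
    using order_isomorphic_sym[OF iso] unfolding order_isomorphic_def by blast
  have bt: "b = Suc t" using b_pos by simp
  have up_le: "card (up u A w) \<le> t" if "fpo A u" "top_part A u B" "card B = t" "w \<in> B" for A :: "'c set" and u B w
  proof -
    have "finite B" using that(1,2) by (auto simp: top_part_def fpo_finite intro: finite_subset)
    then have "card (up u A w) \<le> card B" using top_part_up[OF that(1,2,4)] by (rule card_mono)
    then show ?thesis using that(3) by simp
  qed
  have "\<exists>T. top_part P r T \<and> card T = t"
    using T
  proof
    assume T': "top_part Q s T' \<and> card T' = t"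
    have "q \<notin> T'" using up_le[of Q s T' q] T' Q bt by auto
    moreover have "{w \<in> P. (x, w) \<in> r \<and> w \<noteq> x \<and> card (up r P w) \<le> t} = {v \<in> P. (x, v) \<in> r \<and> card (up r P v) < b}"
      using up_less bt by auto
    ultimately have "top_part P r (g ` T')" "card (g ` T') = t"
      using top_part_transfer[OF Q P q x g, of T' t] T' card_high by simp_all
    then show ?thesis by blast
  qed blast
  then obtain T where T: "top_part P r T" "card T = t" by blast
  have xT: "x \<notin> T" using up_le[OF P T, of x] up_less bt by auto
  have "card {w \<in> Q. (q, w) \<in> s \<and> w \<noteq> q \<and> card (up s Q w) \<le> t} = t"
    unfolding card_up_q using up_self[OF Q q] finite_up[OF Q] by simp
  then have T': "top_part Q s (f ` T)" "card (f ` T) = t"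
    using top_part_transfer[OF P Q x q f T xT] by simp_all
  have TP: "T \<subseteq> P" and T'Q: "f ` T \<subseteq> Q" using T T' by (auto simp: top_part_def)
  have finT: "finite T" "finite (f ` T)" using TP finP finite_subset by auto
  obtain \<pi> where pi: "bij_betw \<pi> P Q" "\<forall>v\<in>P. order_isomorphic (P - {v}) r (Q - {\<pi> v}) s"
    using hyp unfolding hypomorphic_def by blast
  obtain v0 where v0: "v0 \<in> T" using T t by fastforce
  define w0 where "w0 = \<pi> v0"
  have w0: "w0 \<in> Q" using bij_betwE[OF pi(1)] v0 TP by (auto simp: w0_def)
  obtain h where h: "bij_betw h (P - {v0}) (Q - {w0})" "\<forall>v\<in>P - {v0}. \<forall>w\<in>P - {v0}. (v, w) \<in> r \<longleftrightarrow> (h v, h w) \<in> s"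
    using pi(2) v0 TP unfolding order_isomorphic_def w0_def by blast
  have hinj: "inj_on h (P - {v0})" and him: "h ` (P - {v0}) = Q - {w0}" using h(1) by (auto simp: bij_betw_def)
  have cT: "card (T \<inter> (P - {v0})) = t - 1"
  proof -
    have "T \<inter> (P - {v0}) = T - {v0}" using TP by blast
    then show ?thesis using v0 T(2) finT by simp
  qed
  let ?B = "{v \<in> P - {v0}. card (up r (P - {v0}) v) \<le> t}"
  let ?B' = "{v \<in> Q - {w0}. card (up s (Q - {w0}) v) \<le> t}"
  have "?B' = h ` ?B"
  proof
    show "?B' \<subseteq> h ` ?B"
    proof
      fix w assume w: "w \<in> ?B'"
      then have "w \<in> h ` (P - {v0})" using him by blast
      then obtain v where v: "v \<in> P - {v0}" "w = h v" by blast
      then have "v \<in> ?B" using w iso_dn(4)[OF h v(1)] by simp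
      then show "w \<in> h ` ?B" using v(2) by (rule rev_image_eqI)
    qed
    show "h ` ?B \<subseteq> ?B'"
    proof
      fix w assume "w \<in> h ` ?B"
      then obtain v where v: "v \<in> P - {v0}" "card (up r (P - {v0}) v) \<le> t" "w = h v" by blast
      then have "w \<in> Q - {w0}" using him by blast
      then show "w \<in> ?B'" using v(2,3) iso_dn(4)[OF h v(1)] by simp
    qed
  qed
  then have cB: "card ?B' = card ?B" using hinj by (metis (no_types, lifting) card_image inj_on_subset mem_Collect_eq subsetI)
  \<comment> \<open>Otherwise at most \<open>t\<close> points of the card of \<open>Q\<close> have
    filters of size at most \<open>t\<close>, all in the upper summand. The card of \<open>P\<close>
    has \<open>t - 1\<close> of them in \<open>T\<close> and at least two more: points above
    \<open>x\<close> whose filters of size \<open>b = Suc t\<close> lose \<open>v0\<close>.\<close>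
  have w0T: "w0 \<in> f ` T"
  proof (rule ccontr)
    assume n: "w0 \<notin> f ` T"
    then have e: "f ` T \<inter> (Q - {w0}) = f ` T" using T'Q by blast
    have "?B' \<subseteq> f ` T"
      using top_part_up_ge[OF Q T'(1), of _ "Q - {w0}"] unfolding e T'(2) by fastforce
    then have "card ?B' \<le> t" using T'(2) finT card_mono by metis
    let ?M = "{v \<in> P. (x, v) \<in> r \<and> card (up r P v) = b}"
    have M: "?M \<inter> T = {}" using up_le[OF P T] bt by fastforce
    have "(T - {v0}) \<union> ?M \<subseteq> ?B"
    proof
      fix v assume v: "v \<in> (T - {v0}) \<union> ?M"
      then have vP: "v \<in> P" using TP by blast
      show "v \<in> ?B"
      proof (cases "v \<in> T")
        case True
        then have "card (up r P v) \<le> t" by (rule up_le[OF P T])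
        moreover have "card (up r (P - {v0}) v) \<le> card (up r P v)"
          using finite_up[OF P] by (intro card_mono) (auto simp: up_def)
        ultimately show ?thesis using v True M vP by auto
      next
        case False
        then have c: "card (up r P v) = b" using v by blast
        have "v0 \<in> up r P v" using T(1) v0 vP False TP by (auto simp: up_def top_part_def)
        then have "card (up r (P - {v0}) v) = t" unfolding up_minus using c finite_up[OF P] by simp
        then show ?thesis using vP False v0 by auto
      qed
    qed
    then have "card ((T - {v0}) \<union> ?M) \<le> card ?B" using finP by (intro card_mono) auto
    moreover have "card ((T - {v0}) \<union> ?M) = (t - 1) + card ?M"
      using M finT finP v0 T(2) by (subst card_Un_disjoint) auto
    ultimately show False using \<open>card ?B' \<le> t\<close> cB two t by linarith
  qed
  have cT': "card (f ` T \<inter> (Q - {w0})) = t - 1"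
  proof -
    have "f ` T \<inter> (Q - {w0}) = f ` T - {w0}" using T'Q by blast
    then show ?thesis using w0T T'(2) finT by simp
  qed
  \<comment> \<open>With a point of each upper summand deleted, the rest of the summand is
    recognised in the card by filter sizes below \<open>t\<close>, so \<open>h\<close> respects the
    decomposition.\<close>
  have low_iff: "v \<in> T \<longleftrightarrow> card (up r (P - {v0}) v) < t" if v: "v \<in> P" "v \<noteq> v0" for v
  proof
    assume vT: "v \<in> T"
    have "up r (P - {v0}) v \<subseteq> T - {v0}" unfolding up_minus using top_part_up[OF P T(1) vT] by blast
    then have "card (up r (P - {v0}) v) \<le> card (T - {v0})" using finT by (intro card_mono) auto
    then show "card (up r (P - {v0}) v) < t" using v0 T(2) finT t by simp
  next
    assume "card (up r (P - {v0}) v) < t"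
    then show "v \<in> T" using top_part_up_ge[OF P T(1), of v "P - {v0}"] v cT t by fastforce
  qed
  have low_iff': "w \<in> f ` T \<longleftrightarrow> card (up s (Q - {w0}) w) < t" if w: "w \<in> Q" "w \<noteq> w0" for w
  proof
    assume wT: "w \<in> f ` T"
    have "up s (Q - {w0}) w \<subseteq> f ` T - {w0}" unfolding up_minus using top_part_up[OF Q T'(1) wT] by blast
    then have "card (up s (Q - {w0}) w) \<le> card (f ` T - {w0})" using finT by (intro card_mono) auto
    then show "card (up s (Q - {w0}) w) < t" using w0T T'(2) finT t by simp
  next
    assume "card (up s (Q - {w0}) w) < t"
    then show "w \<in> f ` T" using top_part_up_ge[OF Q T'(1), of w "Q - {w0}"] w cT' t by fastforce
  qed
  have hT: "h v \<in> f ` T \<longleftrightarrow> v \<in> T" if v: "v \<in> P" "v \<noteq> v0" for v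
    using low_iff[OF v] low_iff'[of "h v"] him v iso_dn(4)[OF h, of v] by auto
  have b1: "bij_betw h (P - T) (Q - f ` T)"
    unfolding bij_betw_def
  proof
    show "inj_on h (P - T)" using hinj by (rule inj_on_subset) (use v0 in blast)
    show "h ` (P - T) = Q - f ` T"
    proof
      show "h ` (P - T) \<subseteq> Q - f ` T"
      proof
        fix w assume "w \<in> h ` (P - T)"
        then obtain v where v: "v \<in> P" "v \<notin> T" "w = h v" by blast
        then have "v \<noteq> v0" using v0 by blast
        then have "h v \<in> h ` (P - {v0})" using v(1) by (intro imageI) simp
        then have "h v \<in> Q - {w0}" using him by simp
        then show "w \<in> Q - f ` T" using hT[OF v(1) \<open>v \<noteq> v0\<close>] v by simp
      qed
      show "Q - f ` T \<subseteq> h ` (P - T)"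
      proof
        fix w assume w: "w \<in> Q - f ` T"
        then have "w \<in> Q - {w0}" using w0T by blast
        then have "w \<in> h ` (P - {v0})" using him by simp
        then obtain v where v: "v \<in> P" "v \<noteq> v0" "w = h v" by blast
        then have "v \<notin> T" using hT[OF v(1,2)] w by simp
        then show "w \<in> h ` (P - T)" using v by simp
      qed
    qed
  qed
  have TPx: "T \<subseteq> P - {x}" using TP xT by blast
  have b2: "bij_betw f T (f ` T)" using f(1) TPx by (auto simp: bij_betw_def intro: inj_on_subset)
  \<comment> \<open>On the upper summand the isomorphism comes from the card at \<open>x\<close>,
    below it from the card at \<open>v0\<close>; the relations between the summands are
    forced.\<close>
  define k where "k v = (if v \<in> T then f v else h v)" for v
  have "bij_betw k (P - T) (Q - f ` T)" using b1 by (rule bij_betw_cong[THEN iffD1, rotated]) (simp add: k_def)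
  moreover have "bij_betw k T (f ` T)" using b2 by (rule bij_betw_cong[THEN iffD1, rotated]) (simp add: k_def)
  ultimately have "bij_betw k ((P - T) \<union> T) ((Q - f ` T) \<union> f ` T)" by (rule bij_betw_combine) blast
  then have "bij_betw k P Q" using TP T'Q by (simp add: Un_absorb2)
  moreover have "(v, w) \<in> r \<longleftrightarrow> (k v, k w) \<in> s" if v: "v \<in> P" and w: "w \<in> P" for v w
  proof (cases "v \<in> T"; cases "w \<in> T")
    assume "v \<in> T" "w \<in> T" then show ?thesis using f(2) TPx by (auto simp: k_def)
  next
    assume vw: "v \<notin> T" "w \<notin> T"
    then have "v \<in> P - {v0}" "w \<in> P - {v0}" using v w v0 by auto
    then show ?thesis using h(2) vw by (simp add: k_def)
  next
    assume vw: "v \<notin> T" "w \<in> T"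
    then have "(v, w) \<in> r" using T(1) v by (auto simp: top_part_def)
    moreover have "h v \<in> Q - f ` T" using b1 v vw by (auto simp: bij_betw_def)
    then have "(h v, f w) \<in> s" using T'(1) vw by (auto simp: top_part_def)
    ultimately show ?thesis using vw by (simp add: k_def)
  next
    assume vw: "v \<in> T" "w \<notin> T"
    then have "(v, w) \<notin> r" using top_part_up[OF P T(1), of v] w by (auto simp: up_def)
    moreover have "h w \<in> Q - f ` T" using b1 w vw by (auto simp: bij_betw_def)
    then have "(f v, h w) \<notin> s" using top_part_up[OF Q T'(1), of "f v"] vw by (auto simp: up_def)
    ultimately show ?thesis using vw by (simp add: k_def)
  qed
  ultimately show ?thesis unfolding order_isomorphic_def by blast
qed

end

section \<open>Components and walks\<close>

definition comparability :: "'a set \<Rightarrow> 'a rel \<Rightarrow> 'a rel" where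
  "comparability Z r = {(u, w). u \<in> Z \<and> w \<in> Z \<and> ((u, w) \<in> r \<or> (w, u) \<in> r)}"

text \<open>A connected component of the comparability graph on \<open>Z\<close>. The reflexive
  closure puts \<open>v\<close> into its component even if \<open>v\<close> is not in
  \<open>Z\<close>.\<close>

definition component :: "'a set \<Rightarrow> 'a rel \<Rightarrow> 'a \<Rightarrow> 'a set" where
  "component Z r v = (comparability Z r)\<^sup>* `` {v}"

lemma component_self: "v \<in> component Z r v"
  by (simp add: component_def)

lemma component_subset: assumes "v \<in> Z" shows "component Z r v \<subseteq> Z"
proof
  fix w assume "w \<in> component Z r v"
  then have "(v, w) \<in> (comparability Z r)\<^sup>*" by (simp add: component_def)
  then show "w \<in> Z" using assms by (induction) (auto simp: comparability_def)
qed

lemma component_step: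
  assumes "u \<in> component Z r v" "u \<in> Z" "w \<in> Z" "(u, w) \<in> r \<or> (w, u) \<in> r"
  shows "w \<in> component Z r v"
proof -
  have "(v, u) \<in> (comparability Z r)\<^sup>*" "(u, w) \<in> comparability Z r"
    using assms by (auto simp: component_def comparability_def)
  then show ?thesis by (simp add: component_def)
qed

lemma sym_comparability: "sym (comparability Z r)"
  by (auto simp: sym_def comparability_def)

lemma component_sym: "w \<in> component Z r v \<Longrightarrow> v \<in> component Z r w"
  using sym_rtrancl[OF sym_comparability, of Z r] by (auto simp: component_def sym_def)

lemma component_trans: "w \<in> component Z r v \<Longrightarrow> u \<in> component Z r w \<Longrightarrow> u \<in> component Z r v"
  by (auto simp: component_def)

lemma component_eq:
  assumes "w \<in> component Z r v" shows "component Z r w = component Z r v"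
proof (intro subset_antisym subsetI)
  show "u \<in> component Z r v" if "u \<in> component Z r w" for u using assms that by (rule component_trans)
  show "u \<in> component Z r w" if "u \<in> component Z r v" for u using component_sym[OF assms] that by (rule component_trans)
qed

lemma component_induct [consumes 1, case_names base step]:
  assumes "w \<in> component Z r v" "\<Phi> v"
    and "\<And>u w. u \<in> component Z r v \<Longrightarrow> u \<in> Z \<Longrightarrow> w \<in> Z \<Longrightarrow> (u, w) \<in> r \<or> (w, u) \<in> r \<Longrightarrow> \<Phi> u \<Longrightarrow> \<Phi> w"
  shows "\<Phi> w"
proof -
  have "(v, w) \<in> (comparability Z r)\<^sup>*" using assms(1) by (simp add: component_def)
  then show ?thesis
  proof (induction rule: rtrancl_induct)
    case base show ?case by (rule assms(2))
  next
    case (step u w)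
    then show ?case using assms(3)[of u w] by (auto simp: component_def comparability_def)
  qed
qed

lemma component_converse [simp]: "component Z (r\<inverse>) v = component Z r v"
proof -
  have "comparability Z (r\<inverse>) = comparability Z r" by (auto simp: comparability_def)
  then show ?thesis by (simp add: component_def)
qed

lemma component_mono_step:
  assumes "\<And>u. u \<in> component Z r v \<Longrightarrow> u \<in> Z'"
  shows "component Z r v \<subseteq> component Z' r v"
proof
  fix w assume "w \<in> component Z r v"
  then show "w \<in> component Z' r v"
  proof (induction rule: component_induct)
    case base show ?case by (rule component_self)
  next
    case (step u w)
    have w: "w \<in> component Z r v" by (rule component_step[OF step(1-4)])
    show ?case by (rule component_step[OF step(5) assms[OF step(1)] assms[OF w] step(4)])
  qed
qed

text \<open>A shortest path to \<open>X\<close> visits each vertex outside \<open>X\<close> at most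
  once. The induction enlarges \<open>X\<close> by its predecessors, which trades one step of the
  path for at least one vertex of the bound.\<close>

lemma short_path_to_set:
  assumes "finite B" "R \<subseteq> B \<times> B" "(u, v) \<in> R\<^sup>*" "v \<in> X" "X \<subseteq> B"
  shows "\<exists>k. \<exists>w\<in>X. (u, w) \<in> R ^^ k \<and> k \<le> card (B - X)"
  using assms(4,5)
proof (induction "card (B - X)" arbitrary: X rule: less_induct)
  case less
  show ?case
  proof (cases "u \<in> X")
    case True then show ?thesis by (intro exI[of _ 0]) auto
  next
    case False
    define X' where "X' = X \<union> {w \<in> B. \<exists>y\<in>X. (w, y) \<in> R}"
    have "\<exists>w y. (w, y) \<in> R \<and> w \<notin> X \<and> y \<in> X"
      using assms(3) less.prems(1)
    proof (induction rule: rtrancl_induct)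
      case base then show ?case using False by blast
    next
      case (step y z) then show ?case by (cases "y \<in> X") auto
    qed
    then have "X \<subset> X'" "X' \<subseteq> B" using assms(2) less.prems by (auto simp: X'_def)
    then have "B - X' \<subset> B - X" by blast
    then have c: "card (B - X') < card (B - X)" using assms(1) by (intro psubset_card_mono) auto
    then obtain k w where k: "w \<in> X'" "(u, w) \<in> R ^^ k" "k \<le> card (B - X')"
      using less.hyps[of X'] less.prems(1) \<open>X' \<subseteq> B\<close> by (auto simp: X'_def)
    show ?thesis
    proof (cases "w \<in> X")
      case True then show ?thesis using k c by (intro exI[of _ k]) auto
    next
      case False
      then obtain y where "y \<in> X" "(w, y) \<in> R" using k by (auto simp: X'_def)
      then show ?thesis using k c by (intro exI[of _ "Suc k"]) auto
    qed
  qed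
qed

section \<open>Alternating walks, with peaks at even and valleys at odd positions\<close>

definition walk_pat :: "nat \<Rightarrow> (nat \<Rightarrow> nat \<Rightarrow> bool) \<Rightarrow> bool" where
  "walk_pat j R \<longleftrightarrow> (\<forall>i<j. if even i then R (Suc i) i else R i (Suc i))"

text \<open>The least possible size of a low part is \<open>a - 1\<close>, so this condition says
  exactly that the first point of the walk is not pure.\<close>

definition impure_start :: "nat \<Rightarrow> (nat \<Rightarrow> nat) \<Rightarrow> bool" where
  "impure_start a l \<longleftrightarrow> a \<le> l 0"

abbreviation walk_config where
  "walk_config t a j r P c \<equiv> config t a (Suc j) (walk_pat j) (impure_start a) r P c"

lemma walk_config_iff:
  "walk_config t a j r P (T, ys) \<longleftrightarrow> T \<subseteq> P \<and> card T = t \<and> length ys = Suc j \<and> set ys \<subseteq> P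
    \<and> (\<forall>y\<in>set ys. \<forall>w\<in>T. (y, w) \<in> r \<and> y \<noteq> w) \<and> (\<forall>y\<in>set ys. a \<le> card (dn r P y))
    \<and> (\<forall>i<j. if even i then (ys ! Suc i, ys ! i) \<in> r else (ys ! i, ys ! Suc i) \<in> r)
    \<and> a \<le> card (lowdn a P r (ys ! 0))"
  by (auto simp: config_def walk_pat_def impure_start_def)

lemma walk_config_append:
  assumes w: "walk_config t a j r P (T, ys)" and y: "y \<in> P" "a \<le> card (dn r P y)" "\<forall>w\<in>T. (y, w) \<in> r \<and> y \<noteq> w"
    and s: "if even j then (y, ys ! j) \<in> r else (ys ! j, y) \<in> r"
  shows "walk_config t a (Suc j) r P (T, ys @ [y])"
proof -
  have len: "length ys = Suc j" using w by (simp add: walk_config_iff)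
  have st: "\<forall>i<Suc j. if even i then ((ys @ [y]) ! Suc i, (ys @ [y]) ! i) \<in> r else ((ys @ [y]) ! i, (ys @ [y]) ! Suc i) \<in> r"
  proof (intro allI impI)
    fix i assume that: "i < Suc j"
    show "if even i then ((ys @ [y]) ! Suc i, (ys @ [y]) ! i) \<in> r else ((ys @ [y]) ! i, (ys @ [y]) ! Suc i) \<in> r"
  proof (cases "i = j")
    case True then show ?thesis using s len by (simp add: nth_append)
  next
    case False then show ?thesis using w that len by (auto simp: walk_config_iff nth_append)
  qed
  qed
  show ?thesis
    unfolding walk_config_iff by (intro conjI st) (use w y len in \<open>auto simp: walk_config_iff nth_append\<close>)
qed

lemma walk_config_take:
  assumes w: "walk_config t a j r P (T, ys)" and i: "i \<le> j"
  shows "walk_config t a i r P (T, take (Suc i) ys)"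
proof -
  have "length ys = Suc j" using w by (simp add: walk_config_iff)
  moreover have "set (take (Suc i) ys) \<subseteq> set ys" by (rule set_take_subset)
  ultimately show ?thesis using w i by (auto simp: walk_config_iff)
qed

definition walk_reach :: "nat \<Rightarrow> nat \<Rightarrow> 'a rel \<Rightarrow> 'a set \<Rightarrow> 'a set \<Rightarrow> nat \<Rightarrow> 'a \<Rightarrow> bool" where
  "walk_reach t a r P T j y \<longleftrightarrow> (\<exists>ys. walk_config t a j r P (T, ys) \<and> ys ! j = y)"

lemma walk_reach_0:
  assumes "T \<subseteq> P" "card T = t" "y \<in> P" "a \<le> card (dn r P y)" "\<forall>w\<in>T. (y, w) \<in> r \<and> y \<noteq> w" "a \<le> card (lowdn a P r y)"
  shows "walk_reach t a r P T 0 y"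
  unfolding walk_reach_def by (rule exI[of _ "[y]"]) (use assms in \<open>auto simp: walk_config_iff\<close>)

lemma walk_reach_Suc:
  assumes "walk_reach t a r P T j y0" "y \<in> P" "a \<le> card (dn r P y)" "\<forall>w\<in>T. (y, w) \<in> r \<and> y \<noteq> w"
    "if even j then (y, y0) \<in> r else (y0, y) \<in> r"
  shows "walk_reach t a r P T (Suc j) y"
proof -
  obtain ys where ys: "walk_config t a j r P (T, ys)" "ys ! j = y0" using assms(1) by (auto simp: walk_reach_def)
  then have "walk_config t a (Suc j) r P (T, ys @ [y])" using walk_config_append[OF ys(1) assms(2-4)] assms(5) by simp
  moreover have "(ys @ [y]) ! Suc j = y" using ys(1) by (simp add: walk_config_iff nth_append)
  ultimately show ?thesis unfolding walk_reach_def by blast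
qed

lemma walk_reach_two:
  assumes P: "fpo P r" and "walk_reach t a r P T j y0" "even j" "g \<in> P" "y \<in> P" "a \<le> card (dn r P g)"
    "\<forall>w\<in>T. (y, w) \<in> r \<and> y \<noteq> w" "(g, y0) \<in> r" "(g, y) \<in> r" "T \<subseteq> P"
  shows "walk_reach t a r P T (Suc (Suc j)) y"
proof (rule walk_reach_Suc)
  have gw: "(g, w) \<in> r \<and> g \<noteq> w" if "w \<in> T" for w
  proof -
    have w: "w \<in> P" "(y, w) \<in> r" "y \<noteq> w" using that assms by auto
    then have "(g, w) \<in> r" using fpo_trans[OF P assms(4,5) w(1) assms(9)] by blast
    moreover have "g \<noteq> w" using w assms(9) fpo_antisym[OF P assms(5) w(1)] by blast
    ultimately show ?thesis by blast
  qed
  show "walk_reach t a r P T (Suc j) g"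
    by (rule walk_reach_Suc[OF assms(2)]) (use assms gw in auto)
  show "a \<le> card (dn r P y)"
    using assms(6) card_mono[OF finite_dn[OF P] dn_mono[OF P assms(4,5,9)]] by linarith
qed (use assms in auto)

text \<open>A comparability is traversed by stepping down to the smaller of its two ends and up
  again, one of these steps possibly being trivial. Each edge costs two steps, so the endpoint
  remains a peak.\<close>

lemma walk_reach_component:
  assumes P: "fpo P r" and T: "T \<subseteq> P" "card T = t"
    and Z: "\<And>v. v \<in> Z \<Longrightarrow> v \<in> P \<and> a \<le> card (dn r P v) \<and> (\<forall>w\<in>T. (v, w) \<in> r \<and> v \<noteq> w)"
    and y: "y \<in> Z" "a \<le> card (lowdn a P r y)" and p: "p \<in> component Z r y"
  shows "\<exists>k. walk_reach t a r P T (2 * k) p"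
  using p
proof (induction rule: component_induct)
  case base
  show ?case using walk_reach_0[OF T, of y a r] Z[OF y(1)] y(2) by (intro exI[of _ 0]) auto
next
  case (step u w)
  then obtain k where k: "walk_reach t a r P T (2 * k) u" by blast
  obtain g where g: "g \<in> Z" "(g, u) \<in> r" "(g, w) \<in> r"
    using step(2-4) Z fpo_refl[OF P] by blast
  have "walk_reach t a r P T (Suc (Suc (2 * k))) w"
    by (rule walk_reach_two[OF P k]) (use g Z step T in auto)
  then show ?case by (intro exI[of _ "Suc k"]) simp
qed

context removal_pair
begin

lemma lowdn_x: "card (lowdn a P r x) = a - 1"
proof -
  have "lowdn a P r x = dn r P x - {x}" using card_dn_less[OF P _ x] by (auto simp: lowdn_def dn_def)
  then show ?thesis using dn_self[OF P x] finite_dn[OF P] by simp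
qed

lemma lowdn_q: "card (lowdn a Q s q) = a - 1"
  using card_low by (simp add: lowdn_def dn_def conj_assoc)

definition same_count :: "nat \<Rightarrow> nat \<Rightarrow> nat \<Rightarrow> ((nat \<Rightarrow> nat \<Rightarrow> bool) \<Rightarrow> bool) \<Rightarrow> ((nat \<Rightarrow> nat) \<Rightarrow> bool) \<Rightarrow> bool" where
  "same_count k c m pat lab \<longleftrightarrow> card {d \<in> config_space m P. config k c m pat lab r P d}
     = card {d \<in> config_space m Q. config k c m pat lab s Q d}"

text \<open>Configurations that avoid the deleted point are those of the common card, so equal
  totals leave equal numbers through \<open>x\<close> and through \<open>q\<close>.\<close>

lemma through_count:
  assumes "same_count k a m pat lab"
  shows "card {c \<in> config_space m P. config k a m pat lab r P c \<and> (x \<in> fst c \<or> x \<in> set (snd c))}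
    = card {c \<in> config_space m Q. config k a m pat lab s Q c \<and> (q \<in> fst c \<or> q \<in> set (snd c))}"
proof -
  have "card {c \<in> config_space m P. config k a m pat lab r (P - {x}) c}
      = card {c \<in> config_space m Q. config k a m pat lab s (Q - {q}) c}"
    by (rule config_count_iso[OF iso _ _ finP finQ]) auto
  then show ?thesis
    using assms config_count_minus[OF P x order_refl, of m k pat lab] config_count_minus[OF Q q, of a m k pat lab] less
    unfolding same_count_def by linarith
qed

lemma iso_same_count: "order_isomorphic P r Q s \<Longrightarrow> same_count k c m pat lab"
  unfolding same_count_def by (rule config_count_iso) (auto simp: finP finQ)

lemma up_ge:
  assumes "T \<subseteq> Q" "card T = t" "y \<in> Q" "\<forall>w\<in>T. (y, w) \<in> s \<and> y \<noteq> w"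
  shows "b \<le> card (up s Q y)"
proof -
  have "finite T" using assms(1) finQ by (rule finite_subset)
  moreover have "y \<notin> T" using assms(4) by blast
  ultimately have "card (insert y T) = Suc t" using assms(2) by simp
  moreover have "insert y T \<subseteq> up s Q y" using assms fpo_refl[OF Q] by (auto simp: up_def)
  ultimately show ?thesis using card_mono[OF finite_up[OF Q], of "insert y T" y] by simp
qed

text \<open>No point strictly below \<open>x\<close> has an ideal of size at least \<open>a\<close>.
  So \<open>x\<close> is neither in the upper set nor first reached by an upward step, and being
  pure it is not the start.\<close>

lemma walk_through_x:
  assumes c: "walk_config t a j r P (T, ys)" and th: "x \<in> T \<or> x \<in> set ys"
    and IH: "\<And>i T ys. i < j \<Longrightarrow> walk_config t a i r P (T, ys) \<Longrightarrow> x \<notin> set ys"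
  shows "odd j"
proof -
  have len: "length ys = Suc j" and ysP: "set ys \<subseteq> P" using c by (auto simp: walk_config_iff)
  have y0: "ys ! 0 \<in> set ys" using len by simp
  have "x \<notin> T"
  proof
    assume "x \<in> T"
    then have "(ys ! 0, x) \<in> r" "ys ! 0 \<noteq> x" using c y0 by (auto simp: walk_config_iff)
    then have "card (dn r P (ys ! 0)) < a" using card_dn_less[OF P _ x] y0 ysP by blast
    moreover have "a \<le> card (dn r P (ys ! 0))" using c y0 unfolding walk_config_iff by blast
    ultimately show False by linarith
  qed
  then obtain i where i: "i \<le> j" "ys ! i = x" using th len by (auto simp: in_set_conv_nth less_Suc_eq_le)
  have no: "ys ! i' \<noteq> x" if "i' < j" for i'
  proof
    assume "ys ! i' = x"
    then have "x \<in> set (take (Suc i') ys)" using that len by (auto simp: in_set_conv_nth intro!: exI[of _ i'])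
    then show False using IH[OF that walk_config_take[OF c]] that by simp
  qed
  then have yj: "ys ! j = x" using i by (cases "i = j") auto
  show ?thesis
  proof (rule ccontr)
    assume e: "\<not> odd j"
    show False
    proof (cases j)
      case 0
      then have "a \<le> card (lowdn a P r x)" using c yj by (simp add: walk_config_iff)
      then show False using lowdn_x a_pos by linarith
    next
      case (Suc i)
      then have "odd i" "i < j" using e by auto
      then have "(ys ! i, x) \<in> r" using c Suc yj by (auto simp: walk_config_iff)
      moreover have "ys ! i \<in> set ys" using len \<open>i < j\<close> by simp
      ultimately have "card (dn r P (ys ! i)) < a" "a \<le> card (dn r P (ys ! i))"
        using card_dn_less[OF P _ x] ysP no[OF \<open>i < j\<close>] c by (auto simp: walk_config_iff)
      then show False by linarith
    qed
  qed
qed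

text \<open>Points of the walk have filters of size at least \<open>b\<close>, points strictly above
  \<open>q\<close> smaller ones, so \<open>q\<close> is not first reached by a downward step. If
  \<open>q\<close> were in the upper set, the low part of the start would lie in that of
  \<open>q\<close>, which has only \<open>a - 1\<close> elements.\<close>

lemma walk_through_q:
  assumes c: "walk_config t a j s Q (T, ys)" and th: "q \<in> T \<or> q \<in> set ys"
    and IH: "\<And>i T ys. i < j \<Longrightarrow> walk_config t a i s Q (T, ys) \<Longrightarrow> q \<notin> set ys"
  shows "even j"
proof -
  have len: "length ys = Suc j" and ysQ: "set ys \<subseteq> Q" using c by (auto simp: walk_config_iff)
  have y0: "ys ! 0 \<in> set ys" using len by simp
  have "q \<notin> T"
  proof
    assume "q \<in> T"
    then have "(ys ! 0, q) \<in> s" using c y0 by (auto simp: walk_config_iff)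
    then have "lowdn a Q s (ys ! 0) \<subseteq> lowdn a Q s q" using lowdn_mono[OF Q _ q] y0 ysQ by blast
    then have "card (lowdn a Q s (ys ! 0)) \<le> a - 1" using card_mono[OF finite_lowdn[OF Q]] lowdn_q by metis
    moreover have "a \<le> card (lowdn a Q s (ys ! 0))" using c by (simp add: walk_config_iff)
    ultimately show False using a_pos by linarith
  qed
  then obtain i where i: "i \<le> j" "ys ! i = q" using th len by (auto simp: in_set_conv_nth less_Suc_eq_le)
  have no: "ys ! i' \<noteq> q" if "i' < j" for i'
  proof
    assume "ys ! i' = q"
    then have "q \<in> set (take (Suc i') ys)" using that len by (auto simp: in_set_conv_nth intro!: exI[of _ i'])
    then show False using IH[OF that walk_config_take[OF c]] that by simp
  qed
  then have yj: "ys ! j = q" using i by (cases "i = j") auto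
  show ?thesis
  proof (rule ccontr)
    assume e: "\<not> even j"
    then obtain i where ij: "j = Suc i" by (cases j) auto
    then have i: "even i" "i < j" using e by auto
    then have "(q, ys ! i) \<in> s" using c ij yj by (auto simp: walk_config_iff)
    moreover have yi: "ys ! i \<in> set ys" using len i(2) by simp
    ultimately have "card (up s Q (ys ! i)) < b" using card_up_less[OF Q q] ysQ no[OF i(2)] by blast
    moreover have "b \<le> card (up s Q (ys ! i))"
      by (rule up_ge[of T]) (use c yi ysQ in \<open>auto simp: walk_config_iff\<close>)
    ultimately show False by linarith
  qed
qed

text \<open>The numbers of walks with \<open>j\<close> steps through \<open>x\<close> and through
  \<open>q\<close> agree, and by parity one of them is zero. The parity statements concern first
  visits; the induction supplies them by excluding earlier visits through prefixes.\<close>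

lemma no_walk_through:
  assumes "\<And>i. i \<le> j \<Longrightarrow> same_count t a (Suc i) (walk_pat i) (impure_start a)"
  shows "(walk_config t a j r P (T, ys) \<longrightarrow> x \<notin> set ys) \<and> (walk_config t a j s Q (T', ys') \<longrightarrow> q \<notin> set ys')"
  using assms
proof (induction j arbitrary: T ys T' ys' rule: less_induct)
  case (less j)
  let ?A = "{c \<in> config_space (Suc j) P. walk_config t a j r P c \<and> (x \<in> fst c \<or> x \<in> set (snd c))}"
  let ?B = "{c \<in> config_space (Suc j) Q. walk_config t a j s Q c \<and> (q \<in> fst c \<or> q \<in> set (snd c))}"
  have fin: "finite ?A" "finite ?B" using finite_config_space[OF finP] finite_config_space[OF finQ] by simp_all
  have pr: "same_count t a (Suc i') (walk_pat i') (impure_start a)" if "i < j" "i' \<le> i" for i i'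
    using less.prems[of i'] that by linarith
  have IH: "x \<notin> set ys" if "i < j" "walk_config t a i r P (T, ys)" for i T ys
    using less.IH[OF that(1) pr[OF that(1)]] that(2) by blast
  have IH': "q \<notin> set ys" if "i < j" "walk_config t a i s Q (T, ys)" for i T ys
    using less.IH[OF that(1) pr[OF that(1)]] that(2) by blast
  have A: "odd j" if ne: "?A \<noteq> {}"
  proof -
    obtain c where "c \<in> ?A" using ne by blast
    then have "walk_config t a j r P (fst c, snd c)" "x \<in> fst c \<or> x \<in> set (snd c)" by simp_all
    then show ?thesis using IH by (rule walk_through_x)
  qed
  have B: "even j" if ne: "?B \<noteq> {}"
  proof -
    obtain c where "c \<in> ?B" using ne by blast
    then have "walk_config t a j s Q (fst c, snd c)" "q \<in> fst c \<or> q \<in> set (snd c)" by simp_all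
    then show ?thesis using IH' by (rule walk_through_q)
  qed
  have ce: "card ?A = card ?B" using through_count[OF less.prems[OF order_refl]] .
  have "?A = {} \<or> ?B = {}" using A B by blast
  then have "card ?A = 0"
  proof
    assume "?A = {}" then show ?thesis by (simp only: card.empty)
  next
    assume "?B = {}" then show ?thesis by (simp only: ce card.empty)
  qed
  moreover from this have "card ?B = 0" using ce by (simp only:)
  ultimately have e: "?A = {}" "?B = {}" using fin by (simp_all only: card_0_eq)
  show ?case
  proof (intro conjI impI notI)
    assume "walk_config t a j r P (T, ys)" "x \<in> set ys"
    then have "(T, ys) \<in> ?A" using config_in_space[OF _ order_refl, of t a "Suc j" "walk_pat j" "impure_start a" r P "(T, ys)"] by simp
    then show False using e(1) by blast
  next
    assume "walk_config t a j s Q (T', ys')" "q \<in> set ys'"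
    then have "(T', ys') \<in> ?B" using config_in_space[OF _ order_refl, of t a "Suc j" "walk_pat j" "impure_start a" s Q "(T', ys')"] by simp
    then show False using e(2) by blast
  qed
qed

lemma no_reach:
  assumes "\<And>i. i \<le> j \<Longrightarrow> same_count t a (Suc i) (walk_pat i) (impure_start a)"
  shows "\<not> walk_reach t a r P T j x" "\<not> walk_reach t a s Q T' j q"
proof -
  have nth: "ys ! j \<in> set ys" if "length ys = Suc j" for ys :: "'c list" using that by simp
  show "\<not> walk_reach t a r P T j x"
  proof
    assume "walk_reach t a r P T j x"
    then obtain ys where "walk_config t a j r P (T, ys)" "ys ! j = x" by (auto simp: walk_reach_def)
    moreover from this have "x \<in> set ys" using nth[of ys] by (simp add: walk_config_iff)
    ultimately show False using no_walk_through[OF assms] by blast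
  qed
  show "\<not> walk_reach t a s Q T' j q"
  proof
    assume "walk_reach t a s Q T' j q"
    then obtain ys where "walk_config t a j s Q (T', ys)" "ys ! j = q" by (auto simp: walk_reach_def)
    moreover from this have "q \<in> set ys" using nth[of ys] by (simp add: walk_config_iff)
    ultimately show False using no_walk_through[OF assms] by blast
  qed
qed

end

section \<open>Short walks between maximal elements\<close>

definition maxima :: "'a set \<Rightarrow> 'a rel \<Rightarrow> 'a set" where
  "maxima P r = {v \<in> P. card (up r P v) = 1}"

lemma maxima_up:
  assumes "fpo P r" "v \<in> maxima P r" "w \<in> P" "(v, w) \<in> r" shows "w = v"
proof -
  have "v \<in> P" "card (up r P v) = 1" using assms(2) by (auto simp: maxima_def)
  then obtain u where "up r P v = {u}" by (auto simp: card_1_singleton_iff)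
  moreover have "v \<in> up r P v" using up_self[OF assms(1) \<open>v \<in> P\<close>] .
  moreover have "w \<in> up r P v" using assms by (simp add: up_def)
  ultimately show ?thesis by simp
qed

lemma ex_maxima:
  assumes P: "fpo P r" and p: "p \<in> P" shows "\<exists>M\<in>maxima P r. (p, M) \<in> r"
proof -
  have "p \<in> up r P p" using up_self[OF P p] .
  then obtain M where M: "M \<in> up r P p" "\<And>w. w \<in> up r P p \<Longrightarrow> card (up r P M) \<le> card (up r P w)"
    using ex_has_least_nat[of "\<lambda>u. u \<in> up r P p" p "\<lambda>u. card (up r P u)"] by blast
  have MP: "M \<in> P" "(p, M) \<in> r" using M(1) by (auto simp: up_def)
  have "up r P M = {M}"
  proof
    show "up r P M \<subseteq> {M}"
    proof
      fix w assume w: "w \<in> up r P M"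
      then have wP: "w \<in> P" "(M, w) \<in> r" by (auto simp: up_def)
      then have "w \<in> up r P p" using fpo_trans[OF P p MP(1) wP(1) MP(2)] by (simp add: up_def)
      then have "card (up r P M) \<le> card (up r P w)" by (rule M(2))
      then show "w \<in> {M}" using card_up_less[OF P MP(1) wP] by fastforce
    qed
    show "{M} \<subseteq> up r P M" using up_self[OF P MP(1)] by simp
  qed
  then show ?thesis using MP by (auto simp: maxima_def)
qed

lemma finite_maxima: "fpo P r \<Longrightarrow> finite (maxima P r)"
  by (simp add: maxima_def fpo_finite)

text \<open>Peaks may be taken maximal. The relation \<open>R\<close> joins maximal elements with a
  common lower bound in the component, and each step of a shortest \<open>R\<close>-path costs one
  descent and one ascent. The path starts at a maximal element above \<open>y\<close>, which is
  impure because low parts grow upwards.\<close>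

lemma short_walk:
  assumes P: "fpo P r" and Z: "Z \<subseteq> P" "\<And>v. v \<in> Z \<Longrightarrow> a \<le> card (dn r P v)"
    and up: "\<And>v w. v \<in> Z \<Longrightarrow> w \<in> P \<Longrightarrow> (v, w) \<in> r \<Longrightarrow> w \<in> Z"
    and y: "y \<in> Z" "a \<le> card (lowdn a P r y)"
    and B: "B = component Z r y \<inter> maxima P r" and X: "X \<subseteq> B" "X \<noteq> {}"
  shows "\<exists>k. \<exists>w\<in>X. k \<le> card (B - X) \<and> walk_reach 0 a r P {} (2 * k) w"
proof -
  let ?V = "component Z r y"
  have VZ: "?V \<subseteq> Z" using component_subset[OF y(1)] .
  have VP: "v \<in> P" "v \<in> Z" if "v \<in> ?V" for v using that VZ Z(1) by auto
  have Vup: "w \<in> ?V" if "v \<in> ?V" "w \<in> P" "(v, w) \<in> r" for v w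
    using component_step[OF that(1) VP(2)[OF that(1)] up[OF VP(2)[OF that(1)] that(2,3)]] that(3) by blast
  define R where "R = {(M, M'). M \<in> B \<and> M' \<in> B \<and> (\<exists>g\<in>?V. (g, M) \<in> r \<and> (g, M') \<in> r)}"
  have finB: "finite B" using finite_maxima[OF P] B by simp
  have above: "\<exists>M\<in>B. (p, M) \<in> r" if p: "p \<in> ?V" for p
  proof -
    obtain M where M: "M \<in> maxima P r" "(p, M) \<in> r" using ex_maxima[OF P VP(1)[OF p]] by blast
    then have "M \<in> ?V" using Vup[OF p] by (auto simp: maxima_def)
    then show ?thesis using M B by blast
  qed
  obtain M0 where M0: "M0 \<in> B" "(y, M0) \<in> r" using above[OF component_self] by blast
  have path: "\<forall>M\<in>B. (p, M) \<in> r \<longrightarrow> (M0, M) \<in> R\<^sup>*" if "p \<in> ?V" for p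
    using that
  proof (induction rule: component_induct)
    case base
    have "(M0, M) \<in> R" if "M \<in> B" "(y, M) \<in> r" for M
      unfolding R_def using M0 that component_self[of y Z r] by blast
    then show ?case by blast
  next
    case (step u w)
    have wV: "w \<in> ?V" by (rule component_step[OF step(1-4)])
    show ?case
    proof (intro ballI impI)
      fix M assume M: "M \<in> B" "(w, M) \<in> r"
      have MP: "M \<in> P" using M(1) B VP by blast
      show "(M0, M) \<in> R\<^sup>*"
      proof (cases "(u, w) \<in> r")
        case True
        then have "(u, M) \<in> r" using fpo_trans[OF P VP(1)[OF step(1)] VP(1)[OF wV] MP] M(2) by blast
        then show ?thesis using step(5) M(1) by blast
      next
        case False
        then have wu: "(w, u) \<in> r" using step(4) by blast
        obtain M' where M': "M' \<in> B" "(u, M') \<in> r" using above[OF step(1)] by blast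
        then have "M' \<in> P" using B VP by blast
        then have "(w, M') \<in> r" using fpo_trans[OF P VP(1)[OF wV] VP(1)[OF step(1)] _ wu M'(2)] by blast
        then have "(M', M) \<in> R" unfolding R_def using M M' wV by blast
        moreover have "(M0, M') \<in> R\<^sup>*" using step(5) M' by blast
        ultimately show ?thesis by (rule rtrancl_into_rtrancl[rotated])
      qed
    qed
  qed
  obtain w0 where w0: "w0 \<in> X" using X(2) by blast
  then have "w0 \<in> ?V" "w0 \<in> B" using X(1) B by auto
  then have "(M0, w0) \<in> R\<^sup>*" using path fpo_refl[OF P VP(1)] by blast
  moreover have "R \<subseteq> B \<times> B" by (auto simp: R_def)
  ultimately obtain k w where k: "w \<in> X" "(M0, w) \<in> R ^^ k" "k \<le> card (B - X)"
    using short_path_to_set[OF finB _ _ w0 X(1)] by blast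
  have M0V: "M0 \<in> ?V" using M0 B by blast
  have "a \<le> card (lowdn a P r M0)"
    using y(2) card_mono[OF finite_lowdn[OF P] lowdn_mono[OF P _ VP(1)[OF M0V] M0(2)]] VP(1)[OF component_self] by (meson order_trans)
  then have "walk_reach 0 a r P {} 0 M0"
    using walk_reach_0[of "{}" P 0 M0 a r] VP[OF M0V] Z(2) by simp
  then have "walk_reach 0 a r P {} (2 * k) w" using k(2)
  proof (induction k arbitrary: w)
    case 0 then show ?case by simp
  next
    case (Suc k)
    then obtain M where M: "(M0, M) \<in> R ^^ k" "(M, w) \<in> R" by auto
    then obtain g where g: "g \<in> ?V" "(g, M) \<in> r" "(g, w) \<in> r" "w \<in> B" by (auto simp: R_def)
    have "walk_reach 0 a r P {} (Suc (Suc (2 * k))) w"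
      by (rule walk_reach_two[OF P Suc.IH[OF Suc.prems(1) M(1)]])
        (use g VP B Z(2) in auto)
    then show ?case by simp
  qed
  then show ?thesis using k by blast
qed

text \<open>The points that may be listed in a configuration with upper set \<open>T\<close>. With
  the converse relation: the points strictly above all of \<open>T\<close> whose filters have at
  least \<open>a\<close> elements.\<close>

definition below :: "nat \<Rightarrow> 'a set \<Rightarrow> 'a rel \<Rightarrow> 'a set \<Rightarrow> 'a set" where
  "below a P r T = {v \<in> P. a \<le> card (dn r P v) \<and> (\<forall>w\<in>T. (v, w) \<in> r \<and> v \<noteq> w)}"

context removal_pair
begin

definition two_up :: bool where
  "two_up \<longleftrightarrow> 2 \<le> card {v \<in> P. (x, v) \<in> r \<and> card (up r P v) = b}"

text \<open>If no point is irrelevant, every point outside the upper set lies below a listed point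
  and hence below the whole upper set. The order is then an ordinal sum with an upper summand of
  size \<open>t\<close>, and \<open>top_part_iso\<close> applies.\<close>

lemma same_count_top:
  assumes two: two_up and t: "1 \<le> t" and m: "0 < m"
  shows "same_count t c m pat lab"
proof (cases "order_isomorphic P r Q s")
  case True then show ?thesis by (rule iso_same_count)
next
  case False
  have gen: "(\<exists>v\<in>A. v \<notin> fst d \<and> (\<forall>y\<in>set (snd d). (v, y) \<notin> u)) \<or> A \<noteq> {} \<and> (\<forall>S\<subseteq>A. \<not> config t c m pat lab u S d)"
    if A: "fpo A u" "A \<noteq> {}" and no: "\<And>T. \<not> (top_part A u T \<and> card T = t)" for A :: "'z set" and u d
  proof (rule ccontr)
    assume h: "\<not> ?thesis"
    then obtain S where S: "S \<subseteq> A" "config t c m pat lab u S d" using A(2) by blast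
    have T: "fst d \<subseteq> A" "card (fst d) = t" "set (snd d) \<subseteq> A" "\<forall>y\<in>set (snd d). \<forall>w\<in>fst d. (y, w) \<in> u \<and> y \<noteq> w"
      using S by (auto simp: config_def)
    have "top_part A u (fst d)"
      unfolding top_part_def
    proof (intro conjI ballI)
      fix v w assume v: "v \<in> A - fst d" and w: "w \<in> fst d"
      obtain y where y: "y \<in> set (snd d)" "(v, y) \<in> u" using h v by blast
      then show "(v, w) \<in> u" using fpo_trans[OF A(1), of v y w] T v w by blast
    qed (rule T(1))
    then show False using no T(2) by blast
  qed
  have "\<not> (top_part P r T \<and> card T = t)" for T
    using top_part_iso[of T "{}"] False two t unfolding two_up_def by blast
  moreover have "\<not> (top_part Q s T \<and> card T = t)" for T
    using top_part_iso[of "{}" T] False two t unfolding two_up_def by blast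
  ultimately show ?thesis
    unfolding same_count_def using gen[OF P] gen[OF Q] x q by (intro config_count_eq[OF P Q hyp] disjI2) blast
qed

lemma card_maxima: "card (maxima P r) = card (maxima Q s)"
  using hypomorphic_dn_count[of P "r\<inverse>" Q "s\<inverse>" 1] P Q hyp n4 by (simp add: dn_count_def maxima_def)

text \<open>With an empty upper set, a configuration lacks an irrelevant point only if every maximal
  element is listed, and then each of them is a peak. A walk with \<open>j\<close> steps has
  \<open>Suc (j div 2)\<close> peaks.\<close>

lemma same_count_few_peaks:
  assumes t: "t = 0" and j: "Suc (j div 2) < card (maxima P r)"
  shows "same_count t c (Suc j) (walk_pat j) lab"
proof -
  have gen: "(\<exists>v\<in>A. v \<notin> fst d \<and> (\<forall>y\<in>set (snd d). (v, y) \<notin> u)) \<or> A \<noteq> {} \<and> (\<forall>S\<subseteq>A. \<not> config t c (Suc j) (walk_pat j) lab u S d)"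
    if A: "fpo A u" "A \<noteq> {}" and mu: "Suc (j div 2) < card (maxima A u)" for A :: "'z set" and u d
  proof (rule ccontr)
    assume h: "\<not> ?thesis"
    then obtain S where S: "S \<subseteq> A" "config t c (Suc j) (walk_pat j) lab u S d" using A(2) by blast
    define ys where "ys = snd d"
    have ys: "length ys = Suc j" "set ys \<subseteq> A" "finite (fst d)" "card (fst d) = 0"
      using S t fpo_finite[OF A(1)] unfolding ys_def by (auto simp: config_def intro: finite_subset)
    have pat: "if even i then (ys ! Suc i, ys ! i) \<in> u else (ys ! i, ys ! Suc i) \<in> u" if "i < j" for i
      using S that by (auto simp: config_def walk_pat_def ys_def)
    have "maxima A u \<subseteq> (\<lambda>k. ys ! (2 * k)) ` {..j div 2}"
    proof
      fix M assume M: "M \<in> maxima A u"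
      then have "M \<in> A" "M \<notin> fst d" using ys by (auto simp: maxima_def)
      then obtain y where "y \<in> set ys" "(M, y) \<in> u" using h by (auto simp: ys_def)
      then have "M \<in> set ys" using maxima_up[OF A(1) M] ys(2) by blast
      then obtain i where i: "i \<le> j" "ys ! i = M" using ys(1) by (auto simp: in_set_conv_nth less_Suc_eq_le)
      show "M \<in> (\<lambda>k. ys ! (2 * k)) ` {..j div 2}"
      proof (cases "even i")
        case True
        then obtain k where "i = 2 * k" by blast
        then show ?thesis using i by (intro image_eqI[of _ _ k]) auto
      next
        case False
        then obtain k where k: "i = Suc (2 * k)" by (auto elim: oddE)
        then have "(M, ys ! (2 * k)) \<in> u" using pat[of "2 * k"] i by simp
        moreover have "ys ! (2 * k) \<in> A" using ys(1,2) k i nth_mem[of "2 * k" ys] by auto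
        ultimately have "ys ! (2 * k) = M" using maxima_up[OF A(1) M] by blast
        then show ?thesis using k i by (intro image_eqI[of _ _ k]) auto
      qed
    qed
    then have "card (maxima A u) \<le> card ((\<lambda>k. ys ! (2 * k)) ` {..j div 2})" by (rule card_mono[rotated]) simp
    also have "\<dots> \<le> Suc (j div 2)" using card_image_le[of "{..j div 2}" "\<lambda>k. ys ! (2 * k)"] by simp
    finally show False using mu by linarith
  qed
  have "P \<noteq> {}" "Q \<noteq> {}" "Suc (j div 2) < card (maxima Q s)" using x q j card_maxima by auto
  then show ?thesis
    unfolding same_count_def using gen[OF P _ j] gen[OF Q] by (intro config_count_eq[OF P Q hyp] disjI2) blast
qed

abbreviation walks_agree :: "nat \<Rightarrow> bool" where
  "walks_agree j \<equiv> same_count t a (Suc j) (walk_pat j) (impure_start a)"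

text \<open>An impure point in the component of \<open>x\<close> or \<open>q\<close> would start a
  walk that reaches \<open>x\<close> or \<open>q\<close>, respectively.\<close>

lemma pure_components:
  assumes H: "\<And>j. walks_agree j"
  shows "T \<subseteq> P \<Longrightarrow> card T = t \<Longrightarrow> x \<in> below a P r T \<Longrightarrow> y \<in> component (below a P r T) r x \<Longrightarrow> card (lowdn a P r y) = a - 1"
    and "T' \<subseteq> Q \<Longrightarrow> card T' = t \<Longrightarrow> q \<in> below a Q s T' \<Longrightarrow> y' \<in> component (below a Q s T') s q \<Longrightarrow> card (lowdn a Q s y') = a - 1"
proof -
  have ge: "card (lowdn a A u y) = a - 1" if "fpo A u" "y \<in> A" "a \<le> card (dn u A y)" "\<not> a \<le> card (lowdn a A u y)"
    for A :: "'z set" and u y using card_lowdn_ge[OF that(1-3)] that(4) by linarith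
  show "card (lowdn a P r y) = a - 1" if T: "T \<subseteq> P" "card T = t" and xZ: "x \<in> below a P r T"
    and y: "y \<in> component (below a P r T) r x"
  proof -
    have yZ: "y \<in> below a P r T" using component_subset[OF xZ] y by blast
    have "\<not> a \<le> card (lowdn a P r y)"
    proof
      assume "a \<le> card (lowdn a P r y)"
      then have "\<exists>k. walk_reach t a r P T (2 * k) x"
        by (intro walk_reach_component[OF P T _ yZ _ component_sym[OF y]]) (auto simp: below_def)
      then show False using no_reach(1)[OF H] by blast
    qed
    then show ?thesis using yZ by (intro ge[OF P]) (auto simp: below_def)
  qed
  show "card (lowdn a Q s y') = a - 1" if T: "T' \<subseteq> Q" "card T' = t" and qZ: "q \<in> below a Q s T'"
    and y: "y' \<in> component (below a Q s T') s q"
  proof -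
    have yZ: "y' \<in> below a Q s T'" using component_subset[OF qZ] y by blast
    have "\<not> a \<le> card (lowdn a Q s y')"
    proof
      assume "a \<le> card (lowdn a Q s y')"
      then have "\<exists>k. walk_reach t a s Q T' (2 * k) q"
        by (intro walk_reach_component[OF Q T _ yZ _ component_sym[OF y]]) (auto simp: below_def)
      then show False using no_reach(2)[OF H] by blast
    qed
    then show ?thesis using yZ by (intro ge[OF Q]) (auto simp: below_def)
  qed
qed

text \<open>When \<open>q\<close> is maximal, only walks with few peaks are controlled. A walk that is as short as
  possible visits distinct maxima, and since two maxima lie above \<open>x\<close> it may omit one of them.\<close>
lemma pure_component_x_max:
  assumes b1: "b = 1" and two: two_up and y: "y \<in> component (below a P r {}) r x"
  shows "card (lowdn a P r y) = a - 1"
proof -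
  let ?Z = "below a P r {}"
  let ?B = "component ?Z r y \<inter> maxima P r"
  let ?X = "{v \<in> P. (x, v) \<in> r \<and> card (up r P v) = b}"
  have xZ: "x \<in> ?Z" using x by (simp add: below_def)
  have yZ: "y \<in> ?Z" using component_subset[OF xZ] y by blast
  have upZ: "w \<in> ?Z" if "v \<in> ?Z" "w \<in> P" "(v, w) \<in> r" for v w
    using that card_mono[OF finite_dn[OF P] dn_mono[OF P _ that(2,3)]] by (fastforce simp: below_def)
  have "\<not> a \<le> card (lowdn a P r y)"
  proof
    assume imp: "a \<le> card (lowdn a P r y)"
    have X: "?X \<subseteq> ?B"
    proof
      fix v assume v: "v \<in> ?X"
      then have "v \<in> component ?Z r x" using component_step[OF component_self xZ upZ[OF xZ]] by blast
      then have "v \<in> component ?Z r y" using component_eq[OF y] by simp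
      then show "v \<in> ?B" using v b1 by (simp add: maxima_def)
    qed
    have X0: "?X \<noteq> {}"
    proof
      assume e: "?X = {}"
      show False using two unfolding two_up_def e by simp
    qed
    have Zs: "?Z \<subseteq> P" and Za: "\<And>v. v \<in> ?Z \<Longrightarrow> a \<le> card (dn r P v)" by (auto simp: below_def)
    have "\<exists>k. \<exists>w\<in>?X. k \<le> card (?B - ?X) \<and> walk_reach 0 a r P {} (2 * k) w"
      by (rule short_walk[OF P Zs Za upZ yZ imp refl X X0])
    then obtain k w where k: "w \<in> ?X" "k \<le> card (?B - ?X)" "walk_reach 0 a r P {} (2 * k) w" by blast
    have finB: "finite ?B" using finite_maxima[OF P] by simp
    have "card (?B - ?X) = card ?B - card ?X" by (rule card_Diff_subset[OF finite_subset[OF X finB] X])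
    moreover have "card ?B \<le> card (maxima P r)" using finite_maxima[OF P] by (intro card_mono) auto
    moreover have "card ?X \<le> card ?B" using X finB by (rule card_mono[rotated])
    ultimately have k2: "Suc k < card (maxima P r)" using k(2) two unfolding two_up_def by linarith
    \<comment> \<open>The last step leads down from a maximal element above \<open>x\<close>. It
      makes the length odd but adds no peak.\<close>
    have "walk_reach 0 a r P {} (Suc (2 * k)) x"
      by (rule walk_reach_Suc[OF k(3) x]) (use k(1) in auto)
    then have "walk_reach t a r P {} (Suc (2 * k)) x" using b1 by simp
    moreover have "walks_agree i" if "i \<le> Suc (2 * k)" for i
      by (rule same_count_few_peaks) (use b1 that k2 in auto)
    ultimately show False using no_reach(1) by blast
  qed
  then show ?thesis using card_lowdn_ge[OF P, of y a] yZ by (auto simp: below_def)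
qed

text \<open>Here the walk ends at the maximal element \<open>q\<close> itself, so all maximal
  elements of the component may be peaks. A maximal element outside the component is needed to stay
  below the permitted number.\<close>

lemma pure_component_q_max:
  assumes b1: "b = 1" and Z: "Z \<subseteq> below a Q s {}" "\<And>v w. v \<in> Z \<Longrightarrow> w \<in> Q \<Longrightarrow> (v, w) \<in> s \<Longrightarrow> w \<in> Z" "q \<in> Z"
    and few: "card (component Z s q \<inter> maxima Q s) < card (maxima Q s)"
    and y: "y \<in> component Z s q"
  shows "card (lowdn a Q s y) = a - 1"
proof -
  let ?B = "component Z s y \<inter> maxima Q s"
  have yZ: "y \<in> Z" using component_subset[OF Z(3)] y by blast
  have ZQ: "Z \<subseteq> Q" using Z(1) by (auto simp: below_def)
  have "\<not> a \<le> card (lowdn a Q s y)"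
  proof
    assume imp: "a \<le> card (lowdn a Q s y)"
    have qB: "q \<in> ?B" using component_sym[OF y] q b1 by (simp add: maxima_def)
    have "\<exists>k. \<exists>w\<in>{q}. k \<le> card (?B - {q}) \<and> walk_reach 0 a s Q {} (2 * k) w"
      by (rule short_walk[OF Q ZQ _ Z(2) yZ imp refl]) (use Z(1) qB in \<open>auto simp: below_def\<close>)
    then obtain k where k: "k \<le> card (?B - {q})" "walk_reach 0 a s Q {} (2 * k) q" by blast
    have "card (?B - {q}) = card ?B - 1" using qB finite_maxima[OF Q] by simp
    moreover have "0 < card ?B" using qB finite_maxima[OF Q] by (auto simp: card_gt_0_iff)
    moreover have "card ?B < card (maxima P r)" using few component_eq[OF y] card_maxima by simp
    ultimately have k2: "Suc k < card (maxima P r)" using k(1) by linarith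
    have "walk_reach t a s Q {} (2 * k) q" using b1 k(2) by simp
    moreover have "walks_agree i" if "i \<le> 2 * k" for i
      by (rule same_count_few_peaks) (use b1 that k2 in auto)
    ultimately show False using no_reach(2) by blast
  qed
  then show ?thesis using card_lowdn_ge[OF Q, of y a] yZ Z(1) by (auto simp: below_def)
qed

end

section \<open>Embeddings of connected patterns\<close>

definition embeddings :: "nat \<Rightarrow> (nat \<Rightarrow> nat \<Rightarrow> bool) \<Rightarrow> 'a rel \<Rightarrow> 'a set \<Rightarrow> 'a list set" where
  "embeddings m R r V = {ys. length ys = m \<and> set ys \<subseteq> V \<and> (\<forall>i<m. \<forall>j<m. (ys ! i, ys ! j) \<in> r \<longleftrightarrow> R i j)}"

definition connected_pattern :: "nat \<Rightarrow> (nat \<Rightarrow> nat \<Rightarrow> bool) \<Rightarrow> bool" where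
  "connected_pattern m R \<longleftrightarrow> 0 < m \<and> (\<forall>i<m. \<forall>j<m. (i, j) \<in> {(i, j). i < m \<and> j < m \<and> (R i j \<or> R j i)}\<^sup>*)"

definition strict_bounds :: "'a rel \<Rightarrow> 'a set \<Rightarrow> 'a list \<Rightarrow> 'a set" where
  "strict_bounds r V ys = {w \<in> V. \<forall>y\<in>set ys. (y, w) \<in> r \<and> y \<noteq> w}"

text \<open>If \<open>t\<close> further points lie above all of \<open>V\<close>, the binomial
  coefficient counts the upper sets available to an embedding (\<open>weight_card\<close>). The
  weight is thus the number of pattern configurations around \<open>V\<close>, written so that it
  depends only on the isomorphism type of \<open>V\<close>.\<close>

definition weight :: "nat \<Rightarrow> nat \<Rightarrow> (nat \<Rightarrow> nat \<Rightarrow> bool) \<Rightarrow> 'a rel \<Rightarrow> 'a set \<Rightarrow> nat" where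
  "weight t m R r V = (\<Sum>ys\<in>embeddings m R r V. (t + card (strict_bounds r V ys)) choose t)"

lemma finite_embeddings: "finite V \<Longrightarrow> finite (embeddings m R r V)"
  by (rule finite_subset[OF _ finite_lists_length_eq[of V m]]) (auto simp: embeddings_def)

lemma embeddings_map:
  assumes f: "bij_betw f V V'" "\<forall>x\<in>V. \<forall>y\<in>V. (x, y) \<in> r \<longleftrightarrow> (f x, f y) \<in> s" and ys: "ys \<in> embeddings m R r V"
  shows "map f ys \<in> embeddings m R s V'"
proof -
  have y: "length ys = m" "set ys \<subseteq> V" "\<forall>i<m. \<forall>j<m. (ys ! i, ys ! j) \<in> r \<longleftrightarrow> R i j"
    using ys by (auto simp: embeddings_def)
  have nth: "ys ! i \<in> V" if "i < m" for i using y(1,2) that nth_mem by blast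
  have "(map f ys ! i, map f ys ! j) \<in> s \<longleftrightarrow> R i j" if "i < m" "j < m" for i j
    using y(1,3) f(2) nth that by simp
  then show ?thesis using y bij_betwE[OF f(1)] by (auto simp: embeddings_def)
qed

lemma strict_bounds_map:
  assumes f: "bij_betw f V V'" "\<forall>x\<in>V. \<forall>y\<in>V. (x, y) \<in> r \<longleftrightarrow> (f x, f y) \<in> s" and ys: "set ys \<subseteq> V"
  shows "card (strict_bounds s V' (map f ys)) = card (strict_bounds r V ys)"
proof -
  have inj: "inj_on f V" and V': "V' = f ` V" using f(1) by (auto simp: bij_betw_def)
  have "(f y, f w) \<in> s \<and> f y \<noteq> f w \<longleftrightarrow> (y, w) \<in> r \<and> y \<noteq> w" if "y \<in> set ys" "w \<in> V" for y w
    using f(2) that ys inj by (auto dest: inj_onD)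
  then have "strict_bounds s V' (map f ys) = f ` strict_bounds r V ys"
    unfolding strict_bounds_def V' by auto
  moreover have "inj_on f (strict_bounds r V ys)"
    by (rule inj_on_subset[OF inj]) (auto simp: strict_bounds_def)
  ultimately show ?thesis by (simp add: card_image)
qed

lemma weight_iso:
  assumes "order_isomorphic V r V' s"
  shows "weight t m R r V = weight t m R s V'"
proof -
  obtain f where f: "bij_betw f V V'" "\<forall>x\<in>V. \<forall>y\<in>V. (x, y) \<in> r \<longleftrightarrow> (f x, f y) \<in> s"
    using assms unfolding order_isomorphic_def by blast
  define g where "g = inv_into V f"
  have g: "bij_betw g V' V" unfolding g_def by (rule bij_betw_inv_into[OF f(1)])
  have fg: "f (g y) = y" if "y \<in> V'" for y unfolding g_def using bij_betw_inv_into_right[OF f(1) that] .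
  have gf: "g (f y) = y" if "y \<in> V" for y unfolding g_def using bij_betw_inv_into_left[OF f(1) that] .
  have g2: "\<forall>x\<in>V'. \<forall>y\<in>V'. (x, y) \<in> s \<longleftrightarrow> (g x, g y) \<in> r"
    using f(2) fg bij_betwE[OF g] by simp
  show ?thesis
    unfolding weight_def
  proof (rule sum.reindex_bij_witness[where i = "map g" and j = "map f"])
    show "map g (map f ys) = ys" if "ys \<in> embeddings m R r V" for ys
      using that gf by (auto simp: embeddings_def intro!: map_idI)
    show "map f (map g ys) = ys" if "ys \<in> embeddings m R s V'" for ys
      using that fg by (auto simp: embeddings_def intro!: map_idI)
    show "map f ys \<in> embeddings m R s V'" if "ys \<in> embeddings m R r V" for ys
      using embeddings_map[OF f that] .
    show "map g ys \<in> embeddings m R r V" if "ys \<in> embeddings m R s V'" for ys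
      using embeddings_map[OF g g2 that] .
    show "t + card (strict_bounds s V' (map f ys)) choose t = t + card (strict_bounds r V ys) choose t"
      if "ys \<in> embeddings m R r V" for ys
      using strict_bounds_map[OF f] that by (simp add: embeddings_def)
  qed
qed

lemma weight_card:
  assumes "finite T" "finite V" "T \<inter> V = {}" "card T = t"
  shows "weight t m R r V
    = card {(T0, ys). ys \<in> embeddings m R r V \<and> T0 \<subseteq> T \<union> strict_bounds r V ys \<and> card T0 = t}"
proof -
  let ?A = "SIGMA ys:embeddings m R r V. {T0. T0 \<subseteq> T \<union> strict_bounds r V ys \<and> card T0 = t}"
  have fin: "finite (strict_bounds r V ys)" for ys using assms(2) by (simp add: strict_bounds_def)
  have c: "card {T0. T0 \<subseteq> T \<union> strict_bounds r V ys \<and> card T0 = t} = (t + card (strict_bounds r V ys)) choose t" for ys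
  proof -
    have "card (T \<union> strict_bounds r V ys) = t + card (strict_bounds r V ys)"
      using assms fin[of ys] by (subst card_Un_disjoint) (auto simp: strict_bounds_def)
    then show ?thesis using n_subsets[of "T \<union> strict_bounds r V ys" t] assms(1) fin by simp
  qed
  have "{(T0, ys). ys \<in> embeddings m R r V \<and> T0 \<subseteq> T \<union> strict_bounds r V ys \<and> card T0 = t} = prod.swap ` ?A"
    by force
  then have "card {(T0, ys). ys \<in> embeddings m R r V \<and> T0 \<subseteq> T \<union> strict_bounds r V ys \<and> card T0 = t} = card ?A"
    by (simp add: card_image)
  also have "\<dots> = weight t m R r V"
    unfolding weight_def c[symmetric] using finite_embeddings[OF assms(2)] assms(1) fin
    by (intro card_SigmaI) auto
  finally show ?thesis by simp
qed

lemma embeddings_connected: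
  assumes R: "connected_pattern m R" and ys: "ys \<in> embeddings m R r V" and y: "y \<in> set ys" and Z: "set ys \<subseteq> Z"
  shows "set ys \<subseteq> component Z r y"
proof
  have len: "length ys = m" and rel: "\<forall>i<m. \<forall>j<m. (ys ! i, ys ! j) \<in> r \<longleftrightarrow> R i j" using ys by (auto simp: embeddings_def)
  fix w assume "w \<in> set ys"
  then obtain j where j: "j < m" "ys ! j = w" using len by (auto simp: in_set_conv_nth)
  obtain i where i: "i < m" "ys ! i = y" using y len by (auto simp: in_set_conv_nth)
  have "(i, j) \<in> {(i, j). i < m \<and> j < m \<and> (R i j \<or> R j i)}\<^sup>*" using R i j by (simp add: connected_pattern_def)
  then have "ys ! j \<in> component Z r y"
  proof (induction rule: rtrancl_induct)
    case base show ?case using i(2) component_self[of y Z r] by simp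
  next
    case (step k l)
    then have kl: "k < m" "l < m" "R k l \<or> R l k" by auto
    then have "(ys ! k, ys ! l) \<in> r \<or> (ys ! l, ys ! k) \<in> r" using rel by blast
    moreover have "ys ! k \<in> Z" "ys ! l \<in> Z" using kl len Z nth_mem by blast+
    ultimately show ?case using component_step[OF step(3)] by blast
  qed
  then show "w \<in> component Z r y" using j by simp
qed

section \<open>Reconstruction of an order from the weights of connected patterns\<close>

definition separated :: "'a rel \<Rightarrow> 'a set \<Rightarrow> 'a set \<Rightarrow> bool" where
  "separated r D E \<longleftrightarrow> D \<inter> E = {} \<and> (\<forall>u\<in>D. \<forall>v\<in>E. (u, v) \<notin> r \<and> (v, u) \<notin> r)"

lemma separated_sym: "separated r D E \<Longrightarrow> separated r E D"
  by (auto simp: separated_def)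

lemma separated_component: "separated r (component X r d) (X - component X r d)" if "d \<in> X"
proof -
  have "v \<in> component X r d" if "u \<in> component X r d" "v \<in> X" "(u, v) \<in> r \<or> (v, u) \<in> r" for u v
    using component_step[OF that(1) _ that(2,3)] component_subset[OF \<open>d \<in> X\<close>] that(1) by blast
  then show ?thesis unfolding separated_def by blast
qed

lemma component_separated:
  assumes "separated r D E" "y \<in> D" shows "component (D \<union> E) r y \<subseteq> D"
proof
  fix w assume "w \<in> component (D \<union> E) r y"
  then show "w \<in> D"
    by (induction rule: component_induct) (use assms in \<open>auto simp: separated_def\<close>)
qed

text \<open>A connected pattern lands in one of the two parts, and the strict upper bounds of a
  nonempty list lie in the part that contains the list.\<close>

lemma weight_split:
  assumes R: "connected_pattern m R" and sep: "separated r D E" and fin: "finite D" "finite E"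
  shows "weight t m R r (D \<union> E) = weight t m R r D + weight t m R r E"
proof -
  have m: "0 < m" using R by (simp add: connected_pattern_def)
  have in_part: "set ys \<subseteq> A" if "separated r A B" "ys \<in> embeddings m R r (A \<union> B)" "ys ! 0 \<in> A" for A B :: "'a set" and ys
  proof -
    have "ys ! 0 \<in> set ys" using that(2) m by (auto simp: embeddings_def)
    then show ?thesis
      using embeddings_connected[OF R that(2), of "ys ! 0" "A \<union> B"] component_separated[OF that(1,3)] that(2)
      by (auto simp: embeddings_def)
  qed
  have un: "embeddings m R r (D \<union> E) = embeddings m R r D \<union> embeddings m R r E"
  proof (intro subset_antisym subsetI)
    fix ys assume ys: "ys \<in> embeddings m R r (D \<union> E)"
    then have "ys ! 0 \<in> set ys" "set ys \<subseteq> D \<union> E" using m by (auto simp: embeddings_def)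
    then have "ys ! 0 \<in> D \<union> E" by blast
    then have "set ys \<subseteq> D \<or> set ys \<subseteq> E"
      using in_part[OF sep ys] in_part[OF separated_sym[OF sep]] ys by (auto simp: Un_commute)
    then show "ys \<in> embeddings m R r D \<union> embeddings m R r E" using ys by (auto simp: embeddings_def)
  qed (auto simp: embeddings_def)
  have dis: "embeddings m R r D \<inter> embeddings m R r E = {}"
  proof -
    have False if "ys \<in> embeddings m R r D" "ys \<in> embeddings m R r E" for ys
    proof -
      have "ys ! 0 \<in> set ys" "set ys \<subseteq> D" "set ys \<subseteq> E" using that m by (auto simp: embeddings_def)
      then show False using sep by (auto simp: separated_def)
    qed
    then show ?thesis by blast
  qed
  have sb: "strict_bounds r (A \<union> B) ys = strict_bounds r A ys"
    if "separated r A B" "ys \<in> embeddings m R r A" for A B :: "'a set" and ys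
  proof -
    have y0: "ys ! 0 \<in> set ys" "ys ! 0 \<in> A" using that m nth_mem[of 0 ys] by (auto simp: embeddings_def)
    have "w \<notin> B" if "w \<in> strict_bounds r (A \<union> B) ys" for w
      using that y0 \<open>separated r A B\<close> by (auto simp: strict_bounds_def separated_def)
    then show ?thesis by (auto simp: strict_bounds_def)
  qed
  have "weight t m R r (D \<union> E)
      = (\<Sum>ys\<in>embeddings m R r D. (t + card (strict_bounds r (D \<union> E) ys)) choose t)
      + (\<Sum>ys\<in>embeddings m R r E. (t + card (strict_bounds r (D \<union> E) ys)) choose t)"
    unfolding weight_def un using finite_embeddings fin dis by (intro sum.union_disjoint) auto
  also have "(\<Sum>ys\<in>embeddings m R r D. (t + card (strict_bounds r (D \<union> E) ys)) choose t) = weight t m R r D"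
    unfolding weight_def by (rule sum.cong[OF refl]) (simp only: sb[OF sep])
  also have "(\<Sum>ys\<in>embeddings m R r E. (t + card (strict_bounds r (D \<union> E) ys)) choose t) = weight t m R r E"
    unfolding weight_def by (rule sum.cong[OF refl]) (simp only: sb[OF separated_sym[OF sep]] Un_commute[of D E])
  finally show ?thesis .
qed

lemma order_isomorphic_union:
  assumes "order_isomorphic D r D' s" "order_isomorphic E r E' s" "separated r D E" "separated s D' E'"
  shows "order_isomorphic (D \<union> E) r (D' \<union> E') s"
proof -
  obtain f where f: "bij_betw f D D'" "\<forall>x\<in>D. \<forall>y\<in>D. (x, y) \<in> r \<longleftrightarrow> (f x, f y) \<in> s"
    using assms(1) unfolding order_isomorphic_def by blast
  obtain g where g: "bij_betw g E E'" "\<forall>x\<in>E. \<forall>y\<in>E. (x, y) \<in> r \<longleftrightarrow> (g x, g y) \<in> s"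
    using assms(2) unfolding order_isomorphic_def by blast
  define h where "h v = (if v \<in> D then f v else g v)" for v
  have hE: "h v = g v" if "v \<in> E" for v using that assms(3) by (auto simp: h_def separated_def)
  have "bij_betw h D D'" using f(1) by (subst bij_betw_cong[of D h f]) (auto simp: h_def)
  moreover have "bij_betw h E E'" using g(1) by (subst bij_betw_cong[of E h g]) (auto simp: hE)
  ultimately have b: "bij_betw h (D \<union> E) (D' \<union> E')"
    using assms(4) by (intro bij_betw_combine) (auto simp: separated_def)
  have "(v, w) \<in> r \<longleftrightarrow> (h v, h w) \<in> s" if "v \<in> D \<union> E" "w \<in> D \<union> E" for v w
  proof -
    have fD: "h u \<in> D'" if "u \<in> D" for u using that bij_betwE[OF f(1)] by (simp add: h_def)
    have gE: "h u \<in> E'" if "u \<in> E" for u using that bij_betwE[OF g(1)] hE by simp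
    from that consider "v \<in> D" "w \<in> D" | "v \<in> E" "w \<in> E" | "v \<in> D" "w \<in> E" | "v \<in> E" "w \<in> D" by blast
    then show ?thesis
    proof cases
      case 1 then show ?thesis using f(2) by (simp add: h_def)
    next
      case 2 then show ?thesis using g(2) hE by simp
    next
      case 3 then show ?thesis using assms(3,4) fD gE by (auto simp: separated_def)
    next
      case 4 then show ?thesis using assms(3,4) fD gE by (auto simp: separated_def)
    qed
  qed
  then show ?thesis using b unfolding order_isomorphic_def by blast
qed

lemma embedding_iso:
  assumes K: "fpo (set ks) r" "distinct ks" and V: "fpo V s"
    and ys: "ys \<in> embeddings (length ks) (\<lambda>i j. (ks ! i, ks ! j) \<in> r) s V"
  shows "order_isomorphic (set ks) r (set ys) s" "card (set ys) = card (set ks)"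
proof -
  let ?m = "length ks"
  let ?R = "{(i, j). (ks ! i, ks ! j) \<in> r}"
  have y: "length ys = ?m" "set ys \<subseteq> V" and rel: "\<forall>i<?m. \<forall>j<?m. (ys ! i, ys ! j) \<in> s \<longleftrightarrow> (ks ! i, ks ! j) \<in> r"
    using ys by (auto simp: embeddings_def)
  have "distinct ys"
    unfolding distinct_conv_nth
  proof (intro allI impI notI)
    fix i j assume ij: "i < length ys" "j < length ys" "i \<noteq> j" "ys ! i = ys ! j"
    then have "ys ! i \<in> V" using y(2) nth_mem by blast
    then have "(ys ! i, ys ! j) \<in> s" "(ys ! j, ys ! i) \<in> s" using fpo_refl[OF V] ij(4) by auto
    then have "(ks ! i, ks ! j) \<in> r" "(ks ! j, ks ! i) \<in> r" using rel ij(1,2) unfolding y(1) by blast+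
    then have "ks ! i = ks ! j" using fpo_antisym[OF K(1)] ij y(1) by auto
    then show False using K(2) ij y(1) by (simp add: nth_eq_iff_index_eq)
  qed
  then have b: "bij_betw (nth ys) {..<?m} (set ys)" using y(1) by (intro bij_betw_nth) auto
  have bk: "bij_betw (nth ks) {..<?m} (set ks)" using K(2) by (intro bij_betw_nth) auto
  have "order_isomorphic {..<?m} ?R (set ks) r"
    unfolding order_isomorphic_def by (rule exI[of _ "nth ks"]) (use bk in auto)
  moreover have "order_isomorphic {..<?m} ?R (set ys) s"
    unfolding order_isomorphic_def by (rule exI[of _ "nth ys"]) (use b rel in auto)
  ultimately show "order_isomorphic (set ks) r (set ys) s"
    using order_isomorphic_trans[OF order_isomorphic_sym] by blast
  show "card (set ys) = card (set ks)" using bij_betw_same_card[OF b] bij_betw_same_card[OF bk] by simp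
qed

lemma connected_pattern_component:
  assumes d: "d \<in> X" and ks: "set ks = component X r d" "distinct ks"
  shows "connected_pattern (length ks) (\<lambda>i j. (ks ! i, ks ! j) \<in> r)"
  unfolding connected_pattern_def
proof (intro conjI allI impI)
  have "ks \<noteq> []" using ks component_self[of d X r] by auto
  then show "0 < length ks" by simp
next
  let ?m = "length ks"
  let ?E = "{(i, j). i < ?m \<and> j < ?m \<and> ((ks ! i, ks ! j) \<in> r \<or> (ks ! j, ks ! i) \<in> r)}"
  fix i j assume i: "i < ?m" and j: "j < ?m"
  have iD: "ks ! i \<in> component X r d" "ks ! j \<in> component X r d" using ks(1) nth_mem i j by blast+
  have e: "component X r (ks ! i) = component X r d" using component_eq[OF iD(1)] .
  have "ks ! j \<in> component X r (ks ! i)" using iD(2) e by simp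
  then have "\<exists>l<?m. ks ! l = ks ! j \<and> (i, l) \<in> ?E\<^sup>*"
  proof (induction rule: component_induct)
    case base
    show ?case using i by blast
  next
    case (step u w)
    have "w \<in> set ks" using component_step[OF step(1-4)] unfolding ks(1) e .
    then obtain l where l: "l < ?m" "ks ! l = w" by (auto simp: in_set_conv_nth)
    obtain k where k: "k < ?m" "ks ! k = u" "(i, k) \<in> ?E\<^sup>*" using step(5) by blast
    have "(k, l) \<in> ?E" using k l step(4) by simp
    with k(3) have "(i, l) \<in> ?E\<^sup>*" by (rule rtrancl_into_rtrancl)
    then show ?case using l by blast
  qed
  then obtain l where l: "l < ?m" "ks ! l = ks ! j" "(i, l) \<in> ?E\<^sup>*" by blast
  have "l = j" using l(1,2) j ks(2) by (simp add: nth_eq_iff_index_eq)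
  then show "(i, j) \<in> ?E\<^sup>*" using l(3) by simp
qed

lemma weight_pos:
  assumes "finite V" "ys \<in> embeddings m R r V" shows "0 < weight t m R r V"
proof -
  have "0 < (t + card (strict_bounds r V ys)) choose t" by simp
  also have "\<dots> \<le> weight t m R r V"
    unfolding weight_def using finite_embeddings[OF assms(1)] assms(2) by (intro member_le_sum) auto
  finally show ?thesis .
qed

lemma weight_pos_D: assumes "0 < weight t m R r V" shows "\<exists>ys. ys \<in> embeddings m R r V"
proof (rule ccontr)
  assume "\<not> ?thesis"
  then have "embeddings m R r V = {}" by blast
  then show False using assms by (simp add: weight_def)
qed

text \<open>The order pattern of the component has positive weight in \<open>X\<close>, hence in
  \<open>X'\<close>, so it embeds there. As no component of \<open>X'\<close> is larger, the image
  is a whole component.\<close>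

lemma common_component:
  assumes X: "fpo X r" and X': "fpo X' s" and d: "d \<in> X"
    and w: "\<And>m R. connected_pattern m R \<Longrightarrow> weight t m R r X = weight t m R s X'"
    and le: "\<And>d'. d' \<in> X' \<Longrightarrow> card (component X' s d') \<le> card (component X r d)"
  shows "\<exists>d'\<in>X'. order_isomorphic (component X r d) r (component X' s d') s"
proof -
  let ?D = "component X r d"
  have DX: "?D \<subseteq> X" by (rule component_subset[OF d])
  then have finD: "finite ?D" using fpo_finite[OF X] by (rule finite_subset)
  then obtain ks where ks: "set ks = ?D" "distinct ks" using finite_distinct_list by blast
  let ?m = "length ks" and ?R = "\<lambda>i j. (ks ! i, ks ! j) \<in> r"
  have R: "connected_pattern ?m ?R" using connected_pattern_component[OF d ks] .
  have "ks \<in> embeddings ?m ?R r X" using ks DX by (simp add: embeddings_def)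
  then have "0 < weight t ?m ?R s X'" using weight_pos[OF fpo_finite[OF X]] w[OF R] by metis
  then obtain ys where ys: "ys \<in> embeddings ?m ?R s X'" using weight_pos_D by blast
  have isoks: "order_isomorphic ?D r (set ys) s" "card (set ys) = card ?D"
    using embedding_iso[OF _ ks(2) X' ys] fpo_subset[OF X DX] ks(1) by simp_all
  have ysX: "set ys \<subseteq> X'" "0 < length ys" using ys R by (auto simp: embeddings_def connected_pattern_def)
  then have y0: "ys ! 0 \<in> set ys" "ys ! 0 \<in> X'" using nth_mem by blast+
  have "set ys \<subseteq> component X' s (ys ! 0)" using embeddings_connected[OF R ys y0(1) ysX(1)] .
  moreover have "card (component X' s (ys ! 0)) \<le> card (set ys)" using le[OF y0(2)] isoks(2) by simp
  moreover have "finite (component X' s (ys ! 0))"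
    using component_subset[OF y0(2)] fpo_finite[OF X'] by (rule finite_subset)
  ultimately have "set ys = component X' s (ys ! 0)" by (intro card_seteq)
  then show ?thesis using isoks(1) y0(2) by auto
qed

lemma weight_remove_component:
  assumes X: "fpo X r" and X': "fpo X' s" and d: "d \<in> X" and d': "d' \<in> X'"
    and w: "\<And>m R. connected_pattern m R \<Longrightarrow> weight t m R r X = weight t m R s X'"
    and iso: "order_isomorphic (component X r d) r (component X' s d') s" and R: "connected_pattern m R"
  shows "weight t m R r (X - component X r d) = weight t m R s (X' - component X' s d')"
proof -
  have split: "weight t m R u A = weight t m R u (component A u v) + weight t m R u (A - component A u v)"
    if "fpo A u" "v \<in> A" for A :: "'c set" and u v
  proof -
    have sub: "component A u v \<subseteq> A" by (rule component_subset[OF that(2)])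
    have fin: "finite (component A u v)" "finite (A - component A u v)"
      using finite_subset[OF sub fpo_finite[OF that(1)]] fpo_finite[OF that(1)] by auto
    have un: "component A u v \<union> (A - component A u v) = A" using sub by blast
    show ?thesis using weight_split[OF R separated_component[OF that(2)] fin] unfolding un .
  qed
  show ?thesis using w[OF R] split[OF X d] split[OF X' d'] weight_iso[OF iso, of t m R] by linarith
qed

text \<open>A component of maximal size in one of the two orders must occur in the other, because its
  order pattern does; removing it from both leaves the hypothesis intact.\<close>
lemma weights_determine_order:
  assumes "fpo X r" "fpo X' s"
    and "\<And>m R. connected_pattern m R \<Longrightarrow> weight t m R r X = weight t m R s X'"
  shows "order_isomorphic X r X' s"
  using assms
proof (induction "card X" arbitrary: X X' rule: less_induct)
  case less
  note X = less.prems(1) and X' = less.prems(2) and w = less.prems(3)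
  have fin: "finite X" "finite X'" using fpo_finite X X' by blast+
  show ?case
  proof (cases "X = {} \<and> X' = {}")
    case True then show ?thesis by (auto simp: order_isomorphic_def bij_betw_def)
  next
    case False
    have "\<exists>d\<in>X. \<exists>d'\<in>X'. order_isomorphic (component X r d) r (component X' s d') s"
    proof (cases "\<exists>d\<in>X. \<forall>d'\<in>X'. card (component X' s d') \<le> card (component X r d)")
      case True
      then obtain d where d: "d \<in> X" "\<And>d'. d' \<in> X' \<Longrightarrow> card (component X' s d') \<le> card (component X r d)" by blast
      then show ?thesis using common_component[OF X X' d(1) w d(2)] by blast
    next
      case no: False
      have ne: "X' \<noteq> {}" using no False by blast
      define M where "M = Max ((\<lambda>d'. card (component X' s d')) ` X')"
      have fi: "finite ((\<lambda>d'. card (component X' s d')) ` X')" using fin by simp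
      have M: "card (component X' s d') \<le> M" if "d' \<in> X'" for d'
        unfolding M_def using Max_ge[OF fi imageI[OF that]] .
      have "M \<in> (\<lambda>d'. card (component X' s d')) ` X'" unfolding M_def using fi ne by (intro Max_in) auto
      then obtain d' where d': "d' \<in> X'" "card (component X' s d') = M" by auto
      have "card (component X r d) \<le> card (component X' s d')" if d: "d \<in> X" for d
      proof -
        obtain e where e: "e \<in> X'" "\<not> card (component X' s e) \<le> card (component X r d)" using no d by blast
        then show ?thesis using M[OF e(1)] d'(2) by linarith
      qed
      then obtain d where "d \<in> X" "order_isomorphic (component X' s d') s (component X r d) r"
        using common_component[OF X' X d'(1) w[symmetric]] by blast
      then show ?thesis using d'(1) order_isomorphic_sym by blast
    qed
    then obtain d d' where d: "d \<in> X" "d' \<in> X'" and iso: "order_isomorphic (component X r d) r (component X' s d') s" by blast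
    let ?D = "component X r d" and ?D' = "component X' s d'"
    have sub: "?D \<subseteq> X" "?D' \<subseteq> X'" using component_subset[OF d(1)] component_subset[OF d(2)] by auto
    have "X - ?D \<subset> X" using d(1) component_self[of d X r] by blast
    then have "card (X - ?D) < card X" by (rule psubset_card_mono[OF fin(1)])
    then have "order_isomorphic (X - ?D) r (X' - ?D') s"
      by (rule less.hyps) (use fpo_subset[OF X] fpo_subset[OF X'] weight_remove_component[OF X X' d w iso] in auto)
    then have "order_isomorphic (?D \<union> (X - ?D)) r (?D' \<union> (X' - ?D')) s"
      by (rule order_isomorphic_union[OF iso _ separated_component[OF d(1)] separated_component[OF d(2)]])
    moreover have "?D \<union> (X - ?D) = X" "?D' \<union> (X' - ?D') = X'" using sub by auto
    ultimately show ?thesis by simp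
  qed
qed

section \<open>Pattern configurations through the deleted points\<close>

definition pattern :: "nat \<Rightarrow> (nat \<Rightarrow> nat \<Rightarrow> bool) \<Rightarrow> (nat \<Rightarrow> nat \<Rightarrow> bool) \<Rightarrow> bool" where
  "pattern m R R' \<longleftrightarrow> (\<forall>i<m. \<forall>j<m. R' i j \<longleftrightarrow> R i j)"

abbreviation pattern_config where
  "pattern_config t a m R r P c \<equiv> config t a m (pattern m R) (\<lambda>_. True) r P c"

lemma pattern_config_iff:
  "pattern_config t a m R r P (T, ys) \<longleftrightarrow> T \<subseteq> P \<and> card T = t \<and> ys \<in> embeddings m R r P
    \<and> (\<forall>y\<in>set ys. \<forall>w\<in>T. (y, w) \<in> r \<and> y \<noteq> w) \<and> (\<forall>y\<in>set ys. a \<le> card (dn r P y))"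
  by (auto simp: config_def pattern_def embeddings_def)

text \<open>Configurations inside \<open>T \<union> V\<close> are counted by the weight of
  \<open>V\<close>, those among them that miss \<open>p\<close> by the weight of
  \<open>V - {p}\<close>. The assumption \<open>local\<close> says that nothing through
  \<open>p\<close> leaves this region.\<close>

lemma through_weight:
  assumes A: "fpo A u" and T: "T \<subseteq> A" "card T = t" and V: "V \<subseteq> below a A u T" and p: "p \<in> V"
    and local: "\<And>T0 ys. pattern_config t a m R u A (T0, ys) \<Longrightarrow> p \<in> T0 \<or> p \<in> set ys \<Longrightarrow> set ys \<subseteq> V \<and> T0 \<subseteq> T \<union> V"
  shows "card {c \<in> config_space m A. pattern_config t a m R u A c \<and> (p \<in> fst c \<or> p \<in> set (snd c))}
     + weight t m R u (V - {p}) = weight t m R u V"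
proof -
  let ?C = "{c \<in> config_space m A. pattern_config t a m R u A c \<and> (p \<in> fst c \<or> p \<in> set (snd c))}"
  define F where "F X = {(T0, ys). ys \<in> embeddings m R u X \<and> T0 \<subseteq> T \<union> strict_bounds u X ys \<and> card T0 = t}" for X
  have VA: "V \<subseteq> A" and Vb: "\<And>v w. v \<in> V \<Longrightarrow> w \<in> T \<Longrightarrow> (v, w) \<in> u \<and> v \<noteq> w" "\<And>v. v \<in> V \<Longrightarrow> a \<le> card (dn u A v)"
    using V by (auto simp: below_def)
  have fin: "finite V" "finite T" "finite A" using VA T(1) fpo_finite[OF A] finite_subset by blast+
  have TV: "T \<inter> V = {}" using Vb(1) by blast
  have sb: "strict_bounds u (V - {p}) ys = strict_bounds u V ys - {p}" for ys by (auto simp: strict_bounds_def)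
  have "F V = F (V - {p}) \<union> ?C"
  proof (intro subset_antisym subsetI)
    fix c assume c: "c \<in> F V"
    obtain T0 ys where Ty: "c = (T0, ys)" by (cases c)
    have h: "ys \<in> embeddings m R u V" "T0 \<subseteq> T \<union> strict_bounds u V ys" "card T0 = t" using c by (auto simp: F_def Ty)
    have ysV: "set ys \<subseteq> V" using h(1) by (auto simp: embeddings_def)
    have TA: "T0 \<subseteq> A" using h(2) T(1) VA by (auto simp: strict_bounds_def)
    have ab: "(y, w) \<in> u \<and> y \<noteq> w" if "y \<in> set ys" "w \<in> T0" for y w
      using h(2) that Vb(1)[of y w] ysV by (auto simp: strict_bounds_def)
    have cfg: "pattern_config t a m R u A (T0, ys)"
      unfolding pattern_config_iff using TA h ab Vb(2) ysV VA by (auto simp: embeddings_def)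
    show "c \<in> F (V - {p}) \<union> ?C"
    proof (cases "p \<in> T0 \<or> p \<in> set ys")
      case True
      then have "c \<in> ?C" using cfg config_in_space[OF cfg order_refl] by (simp add: Ty)
      then show ?thesis by blast
    next
      case False
      then have "c \<in> F (V - {p})" using h by (auto simp: F_def Ty sb embeddings_def)
      then show ?thesis by blast
    qed
  next
    fix c assume c: "c \<in> F (V - {p}) \<union> ?C"
    obtain T0 ys where Ty: "c = (T0, ys)" by (cases c)
    show "c \<in> F V"
    proof (cases "c \<in> ?C")
      case True
      then have cfg: "pattern_config t a m R u A (T0, ys)" and "p \<in> T0 \<or> p \<in> set ys" by (auto simp: Ty)
      then have loc: "set ys \<subseteq> V" "T0 \<subseteq> T \<union> V" using local by auto
      then show ?thesis using cfg unfolding pattern_config_iff by (auto simp: F_def Ty embeddings_def strict_bounds_def)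
    next
      case False
      then have "c \<in> F (V - {p})" using c by blast
      then show ?thesis by (auto simp: F_def Ty sb embeddings_def)
    qed
  qed
  moreover have "F (V - {p}) \<inter> ?C = {}"
  proof -
    have False if cF: "c \<in> F (V - {p})" and cC: "c \<in> ?C" for c
    proof -
      obtain T0 ys where Ty: "c = (T0, ys)" by (cases c)
      have "set ys \<subseteq> V - {p}" "T0 \<subseteq> T \<union> (strict_bounds u V ys - {p})" using cF by (auto simp: F_def Ty sb embeddings_def)
      then have "p \<notin> T0" "p \<notin> set ys" using p TV by auto
      then show False using cC by (simp add: Ty)
    qed
    then show ?thesis by blast
  qed
  moreover have "finite ?C" using finite_config_space[OF fin(3)] by simp
  moreover have "finite (F (V - {p}))"
  proof -
    have "F (V - {p}) \<subseteq> Pow (T \<union> V) \<times> embeddings m R u V"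
      by (auto simp: F_def strict_bounds_def embeddings_def)
    then show ?thesis using fin finite_embeddings[OF fin(1)] by (auto intro: finite_subset)
  qed
  ultimately have "card (F V) = card (F (V - {p})) + card ?C" by (simp add: card_Un_disjoint)
  moreover have "weight t m R u V = card (F V)"
    unfolding F_def by (rule weight_card[OF fin(2,1) TV T(2)])
  moreover have "weight t m R u (V - {p}) = card (F (V - {p}))"
    unfolding F_def by (rule weight_card[OF fin(2) _ _ T(2)]) (use fin TV in auto)
  ultimately show ?thesis by simp
qed

context removal_pair
begin

abbreviation Tx where "Tx \<equiv> {v \<in> P. (x, v) \<in> r \<and> card (up r P v) < b}"
abbreviation Tq where "Tq \<equiv> up s Q q - {q}"
abbreviation Vx where "Vx \<equiv> component (below a P r Tx) r x"
abbreviation Vq where "Vq \<equiv> component (below a Q s Tq) s q"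

lemma card_Tq: "card Tq = t"
  using up_self[OF Q q] finite_up[OF Q] by simp

lemma x_below: "x \<in> below a P r Tx"
proof -
  have "x \<noteq> w" if "card (up r P w) < b" for w using that up_less by auto
  then show ?thesis using x by (auto simp: below_def)
qed

lemma q_below: "q \<in> below a Q s Tq"
  using q less by (auto simp: below_def up_def)

text \<open>By the dual of \<open>card_lowdn_ge\<close>, at least \<open>t\<close> points above
  \<open>w\<close> have filters smaller than \<open>b\<close>. They all belong to \<open>Tx\<close>,
  which has only \<open>t\<close> elements.\<close>

lemma Tx_above:
  assumes w: "w \<in> P" "(x, w) \<in> r" "b \<le> card (up r P w)"
  shows "w \<in> below a P r Tx"
proof -
  let ?W = "{v \<in> P. (w, v) \<in> r \<and> card (up r P v) < b}"
  have e: "?W = lowdn b P (r\<inverse>) w" by (auto simp: lowdn_def up_def)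
  have "t \<le> card ?W" using card_lowdn_ge[of P "r\<inverse>" w b] w P unfolding e by simp
  moreover have sub: "?W \<subseteq> Tx" using fpo_trans[OF P x w(1)] w(2) by auto
  moreover have "finite Tx" using finP by simp
  ultimately have "?W = Tx" using card_high by (intro card_seteq) auto
  then have "\<And>v. v \<in> Tx \<Longrightarrow> (w, v) \<in> r \<and> w \<noteq> v" using w(3) by fastforce
  moreover have "a \<le> card (dn r P w)" by (rule card_mono[OF finite_dn[OF P] dn_mono[OF P x w(1,2)]])
  ultimately show ?thesis using w(1) by (simp add: below_def)
qed

text \<open>The point \<open>x\<close> cannot be in \<open>T0\<close>, as points below it have small
  ideals. So all of \<open>T0\<close> lies above \<open>x\<close>, and by \<open>Tx_above\<close> a
  member outside \<open>Tx\<close> is below all of \<open>Tx\<close> and passes this on to the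
  listed points. If there is no such member, \<open>T0 = Tx\<close> by size.\<close>

lemma Vx_local:
  assumes R: "connected_pattern m R" and c: "pattern_config t a m R r P (T0, ys)" and th: "x \<in> T0 \<or> x \<in> set ys"
  shows "x \<in> set ys" "set ys \<subseteq> Vx \<and> T0 \<subseteq> Tx \<union> Vx"
proof -
  have ys: "ys \<in> embeddings m R r P" "T0 \<subseteq> P" "set ys \<subseteq> P" "\<And>y w. y \<in> set ys \<Longrightarrow> w \<in> T0 \<Longrightarrow> (y, w) \<in> r \<and> y \<noteq> w"
    "\<And>y. y \<in> set ys \<Longrightarrow> a \<le> card (dn r P y)"
    using c unfolding pattern_config_iff by (auto simp: embeddings_def)
  have ne: "ys \<noteq> []" using ys(1) R by (auto simp: embeddings_def connected_pattern_def)
  have "x \<notin> T0"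
  proof
    assume xT: "x \<in> T0"
    obtain y where y: "y \<in> set ys" by (rule that[OF hd_in_set[OF ne]])
    then have "card (dn r P y) < a" using card_dn_less[OF P _ x] ys(3) ys(4)[OF y xT] by blast
    then show False using ys(5)[OF y] by linarith
  qed
  then show xy: "x \<in> set ys" using th by blast
  have T0: "w \<in> Tx \<or> w \<in> below a P r Tx" if "w \<in> T0" for w
    using Tx_above[of w] ys(2) ys(4)[OF xy that] that by (cases "card (up r P w) < b") auto
  have cT0: "card T0 = t" "card Tx = t" using c card_high by (auto simp: pattern_config_iff)
  have ysb: "y \<in> below a P r Tx" if y: "y \<in> set ys" for y
  proof -
    have "(y, w) \<in> r \<and> y \<noteq> w" if w: "w \<in> Tx" for w
    proof (cases "w \<in> T0")
      case True then show ?thesis using ys(4)[OF y] by blast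
    next
      case False
      have "\<not> T0 \<subseteq> Tx"
      proof
        assume "T0 \<subseteq> Tx"
        then have "T0 = Tx" using cT0 finP by (intro card_seteq) auto
        then show False using False w by blast
      qed
      then obtain v where v: "v \<in> T0" "v \<in> below a P r Tx" using T0 by blast
      then have vw: "(v, w) \<in> r" "v \<in> P" "v \<noteq> w" using w by (auto simp: below_def)
      have yv: "(y, v) \<in> r" "y \<noteq> v" "y \<in> P" "w \<in> P" using ys(3,4) y v(1) w by auto
      have "(y, w) \<in> r" using fpo_trans[OF P yv(3) vw(2) yv(4) yv(1) vw(1)] .
      moreover have "y \<noteq> w" using fpo_antisym[OF P vw(2) yv(4) vw(1)] yv(1) vw(3) by blast
      ultimately show ?thesis by blast
    qed
    then show ?thesis using ys(3,5) y by (auto simp: below_def)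
  qed
  have 1: "set ys \<subseteq> Vx" using embeddings_connected[OF R ys(1) xy] ysb by blast
  have "w \<in> Tx \<union> Vx" if w: "w \<in> T0" for w
    using T0[OF w] component_step[OF component_self x_below] ys(4)[OF xy w] by blast
  then show "set ys \<subseteq> Vx \<and> T0 \<subseteq> Tx \<union> Vx" using 1 by blast
qed

text \<open>If \<open>q\<close> is listed, then \<open>T0\<close> consists of strict upper bounds of
  \<open>q\<close> and is \<open>Tq\<close> by size. If \<open>q\<close> is in \<open>T0\<close>,
  the listed points lie below \<open>q\<close>, but the rest of \<open>T0\<close> is confined only
  by \<open>closed\<close>.\<close>

lemma Vq_local:
  assumes R: "connected_pattern m R" and c: "pattern_config t a m R s Q (T0, ys)" and th: "q \<in> T0 \<or> q \<in> set ys"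
    and closed: "\<And>v w. v \<in> Vq \<Longrightarrow> w \<in> Q \<Longrightarrow> (v, w) \<in> s \<Longrightarrow> w \<in> Tq \<union> Vq"
  shows "set ys \<subseteq> Vq \<and> T0 \<subseteq> Tq \<union> Vq"
proof -
  have ys: "ys \<in> embeddings m R s Q" "T0 \<subseteq> Q" "set ys \<subseteq> Q" "\<And>y w. y \<in> set ys \<Longrightarrow> w \<in> T0 \<Longrightarrow> (y, w) \<in> s \<and> y \<noteq> w"
    "\<And>y. y \<in> set ys \<Longrightarrow> a \<le> card (dn s Q y)" "card T0 = t"
    using c unfolding pattern_config_iff by (auto simp: embeddings_def)
  have ne: "ys \<noteq> []" using ys(1) R by (auto simp: embeddings_def connected_pattern_def)
  show ?thesis
  proof (cases "q \<in> set ys")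
    case True
    have "T0 \<subseteq> Tq" using ys(2) ys(4)[OF True] by (auto simp: up_def)
    moreover have "finite Tq" using finite_up[OF Q] by simp
    ultimately have T: "T0 = Tq" using ys(6) card_Tq by (intro card_seteq) auto
    have "set ys \<subseteq> below a Q s Tq" using ys T by (auto simp: below_def)
    then show ?thesis using embeddings_connected[OF R ys(1) True] T by blast
  next
    case False
    then have qT: "q \<in> T0" using th by blast
    have ysb: "y \<in> below a Q s Tq" if y: "y \<in> set ys" for y
    proof -
      have yq: "(y, q) \<in> s" "y \<noteq> q" "y \<in> Q" using ys(3,4) y qT by auto
      have "(y, w) \<in> s \<and> y \<noteq> w" if "w \<in> Tq" for w
      proof -
        have w: "(q, w) \<in> s" "w \<in> Q" "w \<noteq> q" using that by (auto simp: up_def)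
        then show ?thesis using fpo_trans[OF Q yq(3) q w(2) yq(1)] fpo_antisym[OF Q yq(3) q yq(1)] by blast
      qed
      then show ?thesis using ys(5) y yq(3) by (auto simp: below_def)
    qed
    have 1: "set ys \<subseteq> Vq"
    proof
      fix y assume y: "y \<in> set ys"
      show "y \<in> Vq"
        by (rule component_step[OF component_self q_below ysb[OF y]]) (use ys(4)[OF y qT] in auto)
    qed
    obtain y where y: "y \<in> set ys" by (rule that[OF hd_in_set[OF ne]])
    have "w \<in> Tq \<union> Vq" if w: "w \<in> T0" for w
      by (rule closed[of y]) (use 1 y w ys(2) ys(4)[OF y w] in auto)
    then show ?thesis using 1 by blast
  qed
qed

text \<open>The pattern of \<open>Vx\<close> occurs through \<open>x\<close>, hence some
  configuration with it runs through \<open>q\<close> and \<open>Vx\<close> embeds into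
  \<open>Vq\<close>; the same holds conversely, so finiteness gives the isomorphism. The two weights
  now agree, and subtracting the equal numbers through the deleted points shows that the weights
  after deletion agree too.\<close>

lemma critical_components:
  assumes two: two_up and t: "1 \<le> t"
    and closed: "\<And>v w. v \<in> Vq \<Longrightarrow> w \<in> Q \<Longrightarrow> (v, w) \<in> s \<Longrightarrow> w \<in> Tq \<union> Vq"
  shows "order_isomorphic Vx r Vq s" "order_isomorphic (Vx - {x}) r (Vq - {q}) s"
proof -
  let ?CP = "\<lambda>m R. {c \<in> config_space m P. pattern_config t a m R r P c \<and> (x \<in> fst c \<or> x \<in> set (snd c))}"
  let ?CQ = "\<lambda>m R. {c \<in> config_space m Q. pattern_config t a m R s Q c \<and> (q \<in> fst c \<or> q \<in> set (snd c))}"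
  have VxP: "Vx \<subseteq> below a P r Tx" and VqQ: "Vq \<subseteq> below a Q s Tq"
    using component_subset[OF x_below] component_subset[OF q_below] by blast+
  have sub: "Vx \<subseteq> P" "Vq \<subseteq> Q" using VxP VqQ by (auto simp: below_def)
  have fx: "fpo Vx r" and fq: "fpo Vq s" using fpo_subset[OF P sub(1)] fpo_subset[OF Q sub(2)] .
  have fin: "finite Vx" "finite Vq" using fpo_finite fx fq by blast+
  have TQ: "Tq \<subseteq> Q" by (auto simp: up_def)
  have TP: "Tx \<subseteq> P" by auto
  have same: "card (?CP m R) = card (?CQ m R)" if "connected_pattern m R" for m R
    by (rule through_count[OF same_count_top[OF two t]]) (use that in \<open>simp add: connected_pattern_def\<close>)
  have wP: "card (?CP m R) + weight t m R r (Vx - {x}) = weight t m R r Vx" if R: "connected_pattern m R" for m R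
    by (rule through_weight[OF P TP card_high VxP component_self Vx_local(2)[OF R]])
  have wQ: "card (?CQ m R) + weight t m R s (Vq - {q}) = weight t m R s Vq" if R: "connected_pattern m R" for m R
    by (rule through_weight[OF Q TQ card_Tq VqQ component_self Vq_local[OF R _ _ closed]])
  obtain kx where kx: "set kx = Vx" "distinct kx" using finite_distinct_list[OF fin(1)] by blast
  obtain kq where kq: "set kq = Vq" "distinct kq" using finite_distinct_list[OF fin(2)] by blast
  let ?Rx = "\<lambda>i j. (kx ! i, kx ! j) \<in> r" and ?Rq = "\<lambda>i j. (kq ! i, kq ! j) \<in> s"
  have Rx: "connected_pattern (length kx) ?Rx" by (rule connected_pattern_component[OF x_below kx])
  have Rq: "connected_pattern (length kq) ?Rq" by (rule connected_pattern_component[OF q_below kq])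
  have exq: "\<exists>ys. ys \<in> embeddings (length kx) ?Rx s Vq"
  proof -
    have kk: "kx \<in> embeddings (length kx) ?Rx r Vx" by (simp add: embeddings_def kx)
    have "kx \<notin> embeddings (length kx) ?Rx r (Vx - {x})"
      using component_self[of x "below a P r Tx" r] by (auto simp: embeddings_def kx)
    have cfg: "pattern_config t a (length kx) ?Rx r P (Tx, kx)"
      unfolding pattern_config_iff using kk card_high VxP kx sub by (auto simp: embeddings_def below_def)
    have "(Tx, kx) \<in> ?CP (length kx) ?Rx"
      using cfg config_in_space[OF cfg order_refl] component_self[of x "below a P r Tx" r] kx by simp
    moreover have "finite (?CP (length kx) ?Rx)" using finite_config_space[OF finP] by simp
    ultimately have "0 < card (?CP (length kx) ?Rx)" by (auto simp only: card_gt_0_iff)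
    then have "0 < weight t (length kx) ?Rx s Vq" using same[OF Rx] wQ[OF Rx] by linarith
    then show ?thesis by (rule weight_pos_D)
  qed
  have exx: "\<exists>ys. ys \<in> embeddings (length kq) ?Rq r Vx"
  proof -
    have kk: "kq \<in> embeddings (length kq) ?Rq s Vq" by (simp add: embeddings_def kq)
    have cfg: "pattern_config t a (length kq) ?Rq s Q (Tq, kq)"
      unfolding pattern_config_iff using kk card_Tq VqQ kq sub TQ by (auto simp: embeddings_def below_def)
    have "(Tq, kq) \<in> ?CQ (length kq) ?Rq"
      using cfg config_in_space[OF cfg order_refl] component_self[of q "below a Q s Tq" s] kq by simp
    moreover have "finite (?CQ (length kq) ?Rq)" using finite_config_space[OF finQ] by simp
    ultimately have "0 < card (?CQ (length kq) ?Rq)" by (auto simp only: card_gt_0_iff)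
    then have "0 < weight t (length kq) ?Rq r Vx" using same[OF Rq] wP[OF Rq] by linarith
    then show ?thesis by (rule weight_pos_D)
  qed
  obtain ys where ys: "ys \<in> embeddings (length kx) ?Rx s Vq" using exq by blast
  obtain zs where zs: "zs \<in> embeddings (length kq) ?Rq r Vx" using exx by blast
  have i1: "order_isomorphic (set kx) r (set ys) s" "card (set ys) = card (set kx)"
    by (rule embedding_iso[OF fx[folded kx(1)] kx(2) fq ys])+
  have i2: "card (set zs) = card (set kq)"
    by (rule embedding_iso(2)[OF fq[folded kq(1)] kq(2) fx zs])
  have sets: "set ys \<subseteq> Vq" "set zs \<subseteq> Vx" using ys zs by (auto simp: embeddings_def)
  have "card Vq \<le> card (set ys)"
    using i1(2) i2 card_mono[OF fin(1) sets(2)] unfolding kx(1) kq(1) by linarith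
  then have "set ys = Vq" using card_seteq[OF fin(2) sets(1)] by blast
  then show iso: "order_isomorphic Vx r Vq s" using i1(1) unfolding kx(1) by (simp only:)
  have "fpo (Vx - {x}) r" "fpo (Vq - {q}) s" using fpo_subset[OF fx] fpo_subset[OF fq] by blast+
  then show "order_isomorphic (Vx - {x}) r (Vq - {q}) s"
  proof (rule weights_determine_order)
    show "weight t m R r (Vx - {x}) = weight t m R s (Vq - {q})" if R: "connected_pattern m R" for m R
      using wP[OF R] wQ[OF R] same[OF R] weight_iso[OF iso, of t m R] by linarith
  qed
qed

end

section \<open>The autonomous component\<close>

definition middle :: "nat \<Rightarrow> nat \<Rightarrow> 'a set \<Rightarrow> 'a rel \<Rightarrow> 'a set" where
  "middle a b P r = {v \<in> P. a \<le> card (dn r P v) \<and> b \<le> card (up r P v)}"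

lemma lowdn_component_const:
  assumes A: "fpo A u" and S: "S \<subseteq> A" "p \<in> S"
    and pure: "\<And>v. v \<in> component S u p \<Longrightarrow> c \<le> card (dn u A v) \<and> card (lowdn c A u v) = c - 1"
    and v: "v \<in> component S u p"
  shows "lowdn c A u v = lowdn c A u p"
  using v
proof (induction rule: component_induct)
  case base show ?case ..
next
  case (step v w)
  have w: "w \<in> component S u p" by (rule component_step[OF step(1-4)])
  have vw: "v \<in> A" "w \<in> A" using step(2,3) S(1) by auto
  show ?case
  proof (cases "(v, w) \<in> u")
    case True
    then show ?thesis using lowdn_eq[OF A vw True, of c] pure[OF step(1)] pure[OF w] step(5) by simp
  next
    case False
    then have "(w, v) \<in> u" using step(4) by blast
    then show ?thesis using lowdn_eq[OF A vw(2,1), of c] pure[OF step(1)] pure[OF w] step(5) by simp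
  qed
qed

text \<open>All points of the component have the same low part \<open>L\<close> of their ideals and
  the same low part \<open>T\<close> of their filters. Everything comparable to the component is
  then squeezed into \<open>L\<close>, \<open>T\<close> or the component itself, which gives
  autonomy.\<close>

locale pure_component =
  fixes A :: "'a set" and u :: "'a rel" and p :: 'a and L T :: "'a set" and a b :: nat
  assumes A: "fpo A u" and cardL: "card L = a - 1" and a_pos: "0 < a"
    and p: "p \<in> below b A (u\<inverse>) L"
    and lower: "\<And>v. v \<in> component (below b A (u\<inverse>) L) u p \<Longrightarrow> lowdn a A u v = L"
    and upper: "\<And>v. v \<in> component (below b A (u\<inverse>) L) u p \<Longrightarrow> lowdn b A (u\<inverse>) v = T"
begin

abbreviation S where "S \<equiv> below b A (u\<inverse>) L"
abbreviation V where "V \<equiv> component S u p"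

lemma V_S: "V \<subseteq> S" by (rule component_subset[OF p])

lemma S_A: "v \<in> S \<Longrightarrow> v \<in> A" and S_up: "v \<in> S \<Longrightarrow> b \<le> card (up u A v)"
  and S_L: "v \<in> S \<Longrightarrow> w \<in> L \<Longrightarrow> (w, v) \<in> u \<and> v \<noteq> w"
  by (auto simp: below_def)

lemma V_A: "v \<in> V \<Longrightarrow> v \<in> A" using V_S S_A by blast

lemma L_eq: "w \<in> L \<longleftrightarrow> w \<in> A \<and> (w, v) \<in> u \<and> card (dn u A w) < a" if "v \<in> V"
  using lower[OF that] by (auto simp: lowdn_def dn_def)

lemma T_eq: "w \<in> T \<longleftrightarrow> w \<in> A \<and> (v, w) \<in> u \<and> card (up u A w) < b" if "v \<in> V"
  using upper[OF that] by (auto simp: lowdn_def up_def)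

lemma dn_ge: assumes v: "v \<in> V" shows "a \<le> card (dn u A v)"
proof (rule ccontr)
  assume "\<not> ?thesis"
  then have "v \<in> L" using L_eq[OF v] V_A[OF v] fpo_refl[OF A] by auto
  then show False using S_L V_S v by blast
qed

text \<open>If \<open>w\<close> has a large ideal, its low part lies in \<open>L\<close> and has at
  least \<open>a - 1\<close> elements, so it is \<open>L\<close>. Hence \<open>w\<close> lies above
  \<open>L\<close> and belongs to the component.\<close>

lemma below_V:
  assumes v: "v \<in> V" and w: "w \<in> A" "(w, v) \<in> u" shows "w \<in> L \<union> V"
proof (cases "card (dn u A w) < a")
  case True then show ?thesis using L_eq[OF v] w by blast
next
  case False
  have "lowdn a A u w = L"
    using lowdn_eq[OF A w(1) V_A[OF v] w(2), of a] False lower[OF v] cardL by simp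
  then have "(l, w) \<in> u \<and> w \<noteq> l" if "l \<in> L" for l using that False by (auto simp: lowdn_def dn_def)
  moreover have "b \<le> card (up u A w)"
    using S_up[of v] V_S v card_mono[OF finite_up[OF A] up_mono[OF A w(1) V_A[OF v] w(2)]] by fastforce
  ultimately have "w \<in> S" using w(1) by (auto simp: below_def)
  then show ?thesis using component_step[OF v _ _] V_S v w(2) by blast
qed

lemma above_V:
  assumes v: "v \<in> V" and w: "w \<in> A" "(v, w) \<in> u" shows "w \<in> T \<union> V"
proof (cases "card (up u A w) < b")
  case True then show ?thesis using T_eq[OF v] w by blast
next
  case False
  have "(l, w) \<in> u \<and> w \<noteq> l" if "l \<in> L" for l
  proof -
    have l: "(l, v) \<in> u" "v \<noteq> l" "l \<in> A" using that L_eq[OF v] S_L V_S v by auto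
    then show ?thesis using fpo_trans[OF A l(3) V_A[OF v] w(1)] fpo_antisym[OF A V_A[OF v] l(3)] w(2) by blast
  qed
  then have "w \<in> S" using w(1) False by (auto simp: below_def)
  then show ?thesis using component_step[OF v _ _] V_S v w(2) by blast
qed

lemma L_V: assumes "w \<in> L" "v \<in> V" shows "w \<in> A" "(w, v) \<in> u" "w \<notin> V"
  using assms L_eq[OF assms(2)] dn_ge[of w] by auto

lemma T_V: assumes "w \<in> T" "v \<in> V" shows "w \<in> A" "(v, w) \<in> u" "w \<notin> V"
  using assms T_eq[OF assms(2)] V_S S_up[of w] by auto

lemma module_V: "order_module A u V"
  unfolding order_module_def
proof (intro conjI ballI)
  show "V \<subseteq> A" using V_A by blast
  fix v k k' assume v: "v \<in> A - V" and k: "k \<in> V" "k' \<in> V"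
  have "(v, l') \<in> u" if "(v, l) \<in> u" "l \<in> V" "l' \<in> V" for l l'
    using below_V[OF that(2) _ that(1)] v L_V(2)[OF _ that(3)] by blast
  then show "(v, k) \<in> u \<longleftrightarrow> (v, k') \<in> u" using k by blast
  have "(l', v) \<in> u" if "(l, v) \<in> u" "l \<in> V" "l' \<in> V" for l l'
    using above_V[OF that(2) _ that(1)] v T_V(2)[OF _ that(3)] by blast
  then show "(k, v) \<in> u \<longleftrightarrow> (k', v) \<in> u" using k by blast
qed

lemma card_dn_V: assumes k: "k \<in> V" shows "card (dn u A k) = a - 1 + card (dn u V k)"
proof -
  have "dn u A k = L \<union> dn u V k"
    using below_V[OF k] L_V(1,2)[OF _ k] V_A by (auto simp: dn_def)
  moreover have "L \<inter> dn u V k = {}" using L_V(3)[OF _ k] by (auto simp: dn_def)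
  moreover have "finite (dn u A k)" using finite_dn[OF A] .
  ultimately show ?thesis using cardL by (simp add: card_Un_disjoint)
qed

text \<open>A description free of \<open>L\<close> and \<open>T\<close>. It makes components of
  different points comparable, since \<open>a\<close> and \<open>b\<close> are the same for all
  points with the sizes in question.\<close>

lemma V_middle: "V = component (middle a b A u) u p"
proof
  show "V \<subseteq> component (middle a b A u) u p"
    by (rule component_mono_step) (use V_A dn_ge S_up V_S in \<open>auto simp: middle_def\<close>)
  show "component (middle a b A u) u p \<subseteq> V"
  proof
    fix w assume "w \<in> component (middle a b A u) u p"
    then show "w \<in> V"
    proof (induction rule: component_induct)
      case base show ?case by (rule component_self)
    next
      case (step v w)
      have wA: "w \<in> A" "a \<le> card (dn u A w)" "b \<le> card (up u A w)" using step(3) by (auto simp: middle_def)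
      have "w \<notin> L" "w \<notin> T" using L_eq[OF step(5)] T_eq[OF step(5)] wA by auto
      then show ?case using below_V[OF step(5) wA(1)] above_V[OF step(5) wA(1)] step(4) by blast
    qed
  qed
qed

end

lemma below_empty: "v \<in> below a P r {} \<longleftrightarrow> v \<in> P \<and> a \<le> card (dn r P v)"
  by (simp add: below_def)

lemma maxima_part:
  assumes "\<And>k. k \<in> W \<Longrightarrow> k \<in> P" "\<And>k. k \<in> W \<Longrightarrow> up r P k = up r W k"
  shows "W \<inter> maxima P r = {k \<in> W. card (up r W k) = 1}"
  using assms by (auto simp: maxima_def)

section \<open>Purity from both sides and isomorphic components\<close>

context removal_pair
begin

abbreviation Lx where "Lx \<equiv> dn r P x - {x}"
abbreviation Mq where "Mq \<equiv> {v \<in> Q. (v, q) \<in> s \<and> card (dn s Q v) < a}"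
abbreviation Wx where "Wx \<equiv> component (below b P (r\<inverse>) Lx) r x"
abbreviation Wq where "Wq \<equiv> component (below b Q (s\<inverse>) Mq) s q"

definition two_down :: bool where
  "two_down \<longleftrightarrow> 2 \<le> card {v \<in> Q. (v, q) \<in> s \<and> card (dn s Q v) = a}"

lemma two_down_dual: "two_down \<longleftrightarrow> removal_pair.two_up Q (s\<inverse>) q P (r\<inverse>) x"
  using removal_pair.two_up_def[OF dual] by (simp add: two_down_def)

lemma lowdn_q_up: "lowdn b Q (s\<inverse>) q = Tq"
  using card_up_less[OF Q q] by (auto simp: lowdn_def up_def)

lemma lowdn_x_up: "lowdn b P (r\<inverse>) x = Tx"
  by (auto simp: lowdn_def up_def)

lemma lowdn_x_eq: "lowdn a P r x = Lx"
  using card_dn_less[OF P _ x] by (auto simp: lowdn_def dn_def)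

lemma lowdn_q_eq: "lowdn a Q s q = Mq"
  by (auto simp: lowdn_def dn_def)

lemma card_Lx: "card Lx = a - 1"
  using dn_self[OF P x] finite_dn[OF P] by simp

lemma x_above: "x \<in> below b P (r\<inverse>) Lx"
  using removal_pair.q_below[OF dual] by simp

lemma q_above: "q \<in> below b Q (s\<inverse>) Mq"
  using removal_pair.x_below[OF dual] by simp

lemma dual_walks_agree:
  assumes "two_down" "2 \<le> a"
  shows "removal_pair.same_count Q (s\<inverse>) P (r\<inverse>) (a - 1) b (Suc j) (walk_pat j) (impure_start b)"
  using removal_pair.same_count_top[OF dual, of "Suc j" b "walk_pat j" "impure_start b"] assms two_down_dual by simp

text \<open>The walk argument in the reversed orders, where upper sets become sets of
  \<open>a - 1\<close> lower bounds. By \<open>2 \<le> a\<close> they are nonempty, so all walks are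
  controlled, whatever the size \<open>b\<close>.\<close>

lemma upper_pure:
  assumes two: "two_down" "2 \<le> a"
  shows "v \<in> Wx \<Longrightarrow> lowdn b P (r\<inverse>) v = Tx" and "v' \<in> Wq \<Longrightarrow> lowdn b Q (s\<inverse>) v' = Tq"
proof -
  have H: "\<And>j. removal_pair.same_count Q (s\<inverse>) P (r\<inverse>) (card (up (r\<inverse>) P x) - 1) (card (dn (s\<inverse>) Q q)) (Suc j) (walk_pat j) (impure_start (card (dn (s\<inverse>) Q q)))"
    using dual_walks_agree[OF two] by simp
  have L: "Lx \<subseteq> P" "card Lx = card (up (r\<inverse>) P x) - 1" using card_Lx by (auto simp: dn_def)
  have M: "Mq \<subseteq> Q" "card Mq = card (up (r\<inverse>) P x) - 1" using card_low by auto
  have pW: "b \<le> card (dn (r\<inverse>) P w) \<and> card (lowdn b P (r\<inverse>) w) = b - 1" if w: "w \<in> Wx" for w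
  proof -
    have "w \<in> below b P (r\<inverse>) Lx" using component_subset[OF x_above] w by blast
    moreover have "card (lowdn b P (r\<inverse>) w) = b - 1"
      using removal_pair.pure_components(2)[OF dual H L, of w] x_above w by simp
    ultimately show ?thesis by (simp add: below_def)
  qed
  have pW': "b \<le> card (dn (s\<inverse>) Q w) \<and> card (lowdn b Q (s\<inverse>) w) = b - 1" if w: "w \<in> Wq" for w
  proof -
    have "w \<in> below b Q (s\<inverse>) Mq" using component_subset[OF q_above] w by blast
    moreover have "card (lowdn b Q (s\<inverse>) w) = b - 1"
      using removal_pair.pure_components(1)[OF dual H M, of w] q_above w by simp
    ultimately show ?thesis by (simp add: below_def)
  qed
  have S: "below b P (r\<inverse>) Lx \<subseteq> P" "below b Q (s\<inverse>) Mq \<subseteq> Q" by (auto simp: below_def)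
  show "lowdn b P (r\<inverse>) v = Tx" if "v \<in> Wx"
    using lowdn_component_const[of P "r\<inverse>" "below b P (r\<inverse>) Lx" x b v] P S(1) x_above pW that lowdn_x_up by simp
  show "lowdn b Q (s\<inverse>) v' = Tq" if "v' \<in> Wq"
    using lowdn_component_const[of Q "s\<inverse>" "below b Q (s\<inverse>) Mq" q b v'] Q S(2) q_above pW' that lowdn_q_up by simp
qed

lemma Wx_below: "v \<in> Wx \<Longrightarrow> v \<in> P \<and> a \<le> card (dn r P v) \<and> b \<le> card (up r P v)"
  and Wq_below: "v' \<in> Wq \<Longrightarrow> v' \<in> Q \<and> a \<le> card (dn s Q v') \<and> b \<le> card (up s Q v')"
proof -
  have gen: "a \<le> card (dn u A v)" if "fpo A u" "card N = a - 1" "v \<in> A" "\<And>w. w \<in> N \<Longrightarrow> w \<in> A \<and> (w, v) \<in> u \<and> v \<noteq> w" "finite N"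
    for A :: "'z set" and u N v
  proof -
    have "insert v N \<subseteq> dn u A v" using that(3,4) fpo_refl[OF that(1)] by (auto simp: dn_def)
    moreover have "card (insert v N) = a" using that(2,4,5) a_pos by (subst card_insert_disjoint) auto
    ultimately show ?thesis using card_mono[OF finite_dn[OF that(1)]] by metis
  qed
  show "v \<in> P \<and> a \<le> card (dn r P v) \<and> b \<le> card (up r P v)" if "v \<in> Wx"
  proof -
    have v: "v \<in> below b P (r\<inverse>) Lx" using component_subset[OF x_above] that by blast
    then have "a \<le> card (dn r P v)"
      using finite_dn[OF P] by (intro gen[OF P card_Lx]) (auto simp: below_def dn_def)
    then show ?thesis using v by (simp add: below_def)
  qed
  show "v' \<in> Q \<and> a \<le> card (dn s Q v') \<and> b \<le> card (up s Q v')" if "v' \<in> Wq"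
  proof -
    have v: "v' \<in> below b Q (s\<inverse>) Mq" using component_subset[OF q_above] that by blast
    then have "a \<le> card (dn s Q v')"
      using finQ by (intro gen[OF Q card_low]) (auto simp: below_def)
    then show ?thesis using v by (simp add: below_def)
  qed
qed

text \<open>Constancy of the low part of filters places the component below \<open>Tx\<close>. This
  brings it into the region where the walks in the original order decide about ideals.\<close>

lemma Wx_sub:
  assumes two: "two_down" "2 \<le> a" shows "Wx \<subseteq> Vx"
proof (rule component_mono_step)
  fix v assume v: "v \<in> Wx"
  have b: "v \<in> P" "a \<le> card (dn r P v)" "b \<le> card (up r P v)" using Wx_below[OF v] by auto
  have "(v, w) \<in> r \<and> v \<noteq> w" if "w \<in> Tx" for w
  proof -
    have "w \<in> lowdn b P (r\<inverse>) v" using upper_pure(1)[OF two v] that by simp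
    then show ?thesis using b(3) by (auto simp: lowdn_def up_def)
  qed
  then show "v \<in> below a P r Tx" using b by (auto simp: below_def)
qed

lemma Wq_sub:
  assumes two: "two_down" "2 \<le> a" shows "Wq \<subseteq> Vq"
proof (rule component_mono_step)
  fix v assume v: "v \<in> Wq"
  have b: "v \<in> Q" "a \<le> card (dn s Q v)" "b \<le> card (up s Q v)" using Wq_below[OF v] by auto
  have "(v, w) \<in> s \<and> v \<noteq> w" if "w \<in> Tq" for w
  proof -
    have "w \<in> lowdn b Q (s\<inverse>) v" using upper_pure(2)[OF two v] that by simp
    then show ?thesis using b(3) by (auto simp: lowdn_def up_def)
  qed
  then show "v \<in> below a Q s Tq" using b by (auto simp: below_def)
qed

text \<open>For \<open>b = 1\<close> the set \<open>Tx\<close> is empty and the short walks of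
  \<open>pure_component_x_max\<close> are used; otherwise \<open>t\<close> is positive and all walks
  are available.\<close>

lemma lower_pure_x:
  assumes two: "two_up" "two_down" "2 \<le> a" and v: "v \<in> Wx"
  shows "lowdn a P r v = Lx"
proof -
  have vV: "w \<in> Vx" if "w \<in> Wx" for w using Wx_sub[OF two(2,3)] that by blast
  have Tx: "Tx \<subseteq> P" by auto
  have pure: "card (lowdn a P r w) = a - 1" if w: "w \<in> Wx" for w
  proof (cases "b = 1")
    case True
    then have "Tx = {}" using card_up_less[OF P] finite_up[OF P] up_self[OF P] by fastforce
    then have "Vx = component (below a P r {}) r x" by (simp only:)
    then have "w \<in> component (below a P r {}) r x" using vV[OF w] by (simp only:)
    then show ?thesis by (rule pure_component_x_max[OF True two(1)])
  next
    case False
    then have "1 \<le> t" using b_pos by linarith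
    then have H: "\<And>j. walks_agree j" using same_count_top[OF two(1)] by simp
    show ?thesis by (rule pure_components(1)[OF H Tx card_high x_below vV[OF w]])
  qed
  have xS: "below b P (r\<inverse>) Lx \<subseteq> P" by (auto simp: below_def)
  have pp: "a \<le> card (dn r P w) \<and> card (lowdn a P r w) = a - 1" if w: "w \<in> Wx" for w
    using pure[OF w] Wx_below[OF w] by (intro conjI) (simp_all only:)
  have "lowdn a P r v = lowdn a P r x"
    by (rule lowdn_component_const[OF P xS x_above pp v])
  then show ?thesis by (simp only: lowdn_x_eq)
qed

lemma pure_component_x:
  assumes two: "two_up" "two_down" "2 \<le> a"
  shows "pure_component P r x Lx Tx a b"
  by unfold_locales (use P card_Lx a_pos x_above lower_pure_x[OF two] upper_pure(1)[OF two(2,3)] in auto)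

text \<open>In the reversed orders \<open>x\<close> takes the role of \<open>q\<close>, and
  \<open>Wx\<close> that of \<open>Vq\<close>. The closedness demanded there is
  \<open>below_V\<close>, available because purity at \<open>x\<close> is already known. Purity at
  \<open>q\<close> comes later and relies on this isomorphism.\<close>

lemma Wx_iso:
  assumes two: "two_up" "two_down" "2 \<le> a"
  shows "order_isomorphic Wx r Wq s" "order_isomorphic (Wx - {x}) r (Wq - {q}) s"
proof -
  interpret X: pure_component P r x Lx Tx a b by (rule pure_component_x[OF two])
  have t': "1 \<le> card (up (r\<inverse>) P x) - 1" using two(3) by simp
  have D: "removal_pair.two_up Q (s\<inverse>) q P (r\<inverse>) x" using two(2) two_down_dual by simp
  have closed: "w \<in> (up (r\<inverse>) P x - {x}) \<union> component (below (card (dn (s\<inverse>) Q q)) P (r\<inverse>) (up (r\<inverse>) P x - {x})) (r\<inverse>) x"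
    if "v \<in> component (below (card (dn (s\<inverse>) Q q)) P (r\<inverse>) (up (r\<inverse>) P x - {x})) (r\<inverse>) x" "w \<in> P" "(v, w) \<in> r\<inverse>" for v w
    using X.below_V[of v w] that by simp
  have "order_isomorphic Wq (s\<inverse>) Wx (r\<inverse>)" "order_isomorphic (Wq - {q}) (s\<inverse>) (Wx - {x}) (r\<inverse>)"
    using removal_pair.critical_components[OF dual D t' closed] by simp_all
  then show "order_isomorphic Wx r Wq s" "order_isomorphic (Wx - {x}) r (Wq - {q}) s"
    by (simp_all add: order_isomorphic_sym)
qed

text \<open>In the case \<open>b = 1\<close> a maximal element outside \<open>Wq\<close> is wanted.
  Both components are closed upwards and isomorphic, so they contain equally many maximal elements,
  and it suffices that \<open>Wx\<close> omits one. Otherwise every point lies below some point of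
  \<open>Wx\<close> and hence in \<open>Lx \<union> Wx\<close>; then \<open>Lx\<close> is the lower
  summand of an ordinal sum and the orders are isomorphic, a case in which all walks agree
  anyway.\<close>

lemma lower_pure_q:
  assumes two: "two_up" "two_down" "2 \<le> a" and v: "v \<in> Wq"
  shows "lowdn a Q s v = Mq"
proof -
  have qS: "below b Q (s\<inverse>) Mq \<subseteq> Q" by (auto simp: below_def)
  have pure: "card (lowdn a Q s w) = a - 1" if w: "w \<in> Wq" for w
  proof (cases "b = 1")
    case False
    then have "1 \<le> t" using b_pos by linarith
    then have H: "\<And>j. walks_agree j" using same_count_top[OF two(1)] by simp
    have wV: "w \<in> Vq" using Wq_sub[OF two(2,3)] w by blast
    have Tq: "Tq \<subseteq> Q" by (auto simp: up_def)
    show ?thesis by (rule pure_components(2)[OF H Tq card_Tq q_below wV])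
  next
    case b1: True
    show ?thesis
    proof (cases "order_isomorphic P r Q s")
      case True
      then have H: "\<And>j. walks_agree j" by (rule iso_same_count)
      have q0: "q \<in> below a Q s {}" using q less by (simp add: below_def)
      have "Wq \<subseteq> component (below a Q s {}) s q"
      proof (rule component_mono_step)
        show "k \<in> below a Q s {}" if "k \<in> Wq" for k using Wq_below[OF that] by (simp only: below_empty simp_thms)
      qed
      then have w0: "w \<in> component (below a Q s {}) s q" using w by blast
      show ?thesis by (rule pure_components(2)[OF H _ _ q0 w0]) (use b1 in auto)
    next
      case no: False
      interpret X: pure_component P r x Lx Tx a b by (rule pure_component_x[OF two])
      have Tx0: "Tx = {}" using b1 card_up_less[OF P] finite_up[OF P] up_self[OF P] by fastforce
      have upP: "up r P k = up r Wx k" if k: "k \<in> Wx" for k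
      proof (rule set_eqI)
        fix v
        show "v \<in> up r P k \<longleftrightarrow> v \<in> up r Wx k"
          using X.above_V[OF k, of v] X.V_A[of v] Tx0 by (auto simp: up_def)
      qed
      have upSq: "v \<in> below b Q (s\<inverse>) Mq" if k: "k \<in> below b Q (s\<inverse>) Mq" and v: "v \<in> Q" "(k, v) \<in> s" for k v
      proof -
        have kQ: "k \<in> Q" using k qS by blast
        have "(m, v) \<in> s \<and> v \<noteq> m" if m: "m \<in> Mq" for m
        proof -
          have mk: "(m, k) \<in> s" "k \<noteq> m" "m \<in> Q" using k m by (auto simp: below_def)
          then show ?thesis using fpo_trans[OF Q mk(3) kQ v(1) mk(1) v(2)] fpo_antisym[OF Q kQ mk(3)] v(2) by blast
        qed
        moreover have "b \<le> card (up s Q v)"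
          using b1 up_self[OF Q v(1)] finite_up[OF Q] by (simp add: Suc_le_eq card_gt_0_iff) blast
        ultimately show ?thesis using v(1) by (simp add: below_def)
      qed
      have upQ: "up s Q k = up s Wq k" if k: "k \<in> Wq" for k
      proof (rule set_eqI)
        fix v
        have kS: "k \<in> below b Q (s\<inverse>) Mq" using component_subset[OF q_above] k by blast
        have "v \<in> Wq" if "v \<in> Q" "(k, v) \<in> s"
          using component_step[OF k kS upSq[OF kS that]] that(2) by blast
        then show "v \<in> up s Q k \<longleftrightarrow> v \<in> up s Wq k"
          using Wq_below[of v] by (auto simp: up_def)
      qed
      have mx: "Wx \<inter> maxima P r = {k \<in> Wx. card (up r Wx k) = 1}"
        by (rule maxima_part[OF _ upP]) (rule X.V_A)
      have mq: "Wq \<inter> maxima Q s = {k \<in> Wq. card (up s Wq k) = 1}"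
        by (rule maxima_part[OF _ upQ]) (rule conjunct1[OF Wq_below])
      have eq: "card (Wx \<inter> maxima P r) = card (Wq \<inter> maxima Q s)"
        using dn_count_iso[of Wx "r\<inverse>" Wq "s\<inverse>" 1] Wx_iso(1)[OF two]
        unfolding mx mq by (simp add: dn_count_def)
      have "\<not> maxima P r \<subseteq> Wx"
      proof
        assume all: "maxima P r \<subseteq> Wx"
        have cover: "p \<in> Lx \<union> Wx" if pP: "p \<in> P" for p
        proof -
          obtain M where M: "M \<in> maxima P r" "(p, M) \<in> r" using ex_maxima[OF P pP] by blast
          then have "M \<in> Wx" using all by blast
          then show ?thesis by (rule X.below_V[OF _ pP M(2)])
        qed
        have "top_part P (r\<inverse>) Lx"
          unfolding top_part_def
        proof (intro conjI ballI)
          show "Lx \<subseteq> P" by (auto simp: dn_def)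
          fix v w assume v: "v \<in> P - Lx" and w: "w \<in> Lx"
          have "v \<in> Wx" using cover v by blast
          then show "(v, w) \<in> r\<inverse>" using X.L_V(2)[OF w] by simp
        qed
        then have "order_isomorphic Q (s\<inverse>) P (r\<inverse>)"
          using removal_pair.top_part_iso[OF dual, of "{}" Lx] two(2,3) card_Lx
          by (simp add: two_down_def)
        then show False using no order_isomorphic_sym[of Q s P r] by simp
      qed
      then have "Wx \<inter> maxima P r \<subset> maxima P r" by blast
      then have "card (Wx \<inter> maxima P r) < card (maxima P r)" by (rule psubset_card_mono[OF finite_maxima[OF P]])
      then have few: "card (Wq \<inter> maxima Q s) < card (maxima Q s)" using eq card_maxima by simp
      have sub: "below b Q (s\<inverse>) Mq \<subseteq> below a Q s {}"
      proof
        fix k assume k: "k \<in> below b Q (s\<inverse>) Mq"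
        then have "card Mq + 1 \<le> card (dn s Q k)"
        proof -
          have kQ: "k \<in> Q" using k qS by blast
          have "insert k Mq \<subseteq> dn s Q k" using k fpo_refl[OF Q kQ] kQ by (auto simp: below_def dn_def)
          moreover have "k \<notin> Mq" using k by (auto simp: below_def)
          moreover have "finite Mq" using finQ by simp
          ultimately show ?thesis using card_mono[OF finite_dn[OF Q], of "insert k Mq" k] by simp
        qed
        then show "k \<in> below a Q s {}" using k card_low a_pos by (auto simp: below_def)
      qed
      show ?thesis by (rule pure_component_q_max[OF b1 sub upSq q_above few w])
    qed
  qed
  have pp: "a \<le> card (dn s Q w) \<and> card (lowdn a Q s w) = a - 1" if w: "w \<in> Wq" for w
    using pure[OF w] Wq_below[OF w] by (intro conjI) (simp_all only:)
  have "lowdn a Q s v = lowdn a Q s q"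
    by (rule lowdn_component_const[OF Q qS q_above pp v])
  then show ?thesis by (simp only: lowdn_q_eq)
qed

lemma pure_component_q:
  assumes two: "two_up" "two_down" "2 \<le> a"
  shows "pure_component Q s q Mq Tq a b"
  by unfold_locales (use Q card_low a_pos q_above lower_pure_q[OF two] upper_pure(2)[OF two(2,3)] in auto)

lemma middle_components:
  assumes two: "two_up" "two_down" "2 \<le> a"
  defines "V \<equiv> component (middle a b P r) r x" and "W \<equiv> component (middle a b Q s) s q"
  shows "order_module P r V" "order_module Q s W" "order_isomorphic V r W s"
    "order_isomorphic (V - {x}) r (W - {q}) s"
    "\<And>k. k \<in> V \<Longrightarrow> card (dn r P k) = a - 1 + card (dn r V k)"
    "\<And>k. k \<in> W \<Longrightarrow> card (dn s Q k) = a - 1 + card (dn s W k)"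
proof -
  interpret X: pure_component P r x Lx Tx a b by (rule pure_component_x[OF two])
  interpret Y: pure_component Q s q Mq Tq a b by (rule pure_component_q[OF two])
  have V: "V = Wx" unfolding V_def by (rule X.V_middle[symmetric])
  have W: "W = Wq" unfolding W_def by (rule Y.V_middle[symmetric])
  show "order_module P r V" "order_module Q s W" "order_isomorphic V r W s"
    "order_isomorphic (V - {x}) r (W - {q}) s"
    "\<And>k. k \<in> V \<Longrightarrow> card (dn r P k) = a - 1 + card (dn r V k)"
    "\<And>k. k \<in> W \<Longrightarrow> card (dn s Q k) = a - 1 + card (dn s W k)"
    unfolding V W by (fact X.module_V Y.module_V Wx_iso[OF two] X.card_dn_V Y.card_dn_V)+
qed

end

section \<open>Points with isomorphic cards\<close>

text \<open>The points with the fixed card \<open>C\<close>, sorted by the sizes of ideal and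
  filter. The card is a separate order, possibly over another type, so that the same
  \<open>C\<close> serves both orders.\<close>

definition classmates :: "'a set \<Rightarrow> 'a rel \<Rightarrow> 'b set \<Rightarrow> 'b rel \<Rightarrow> nat \<Rightarrow> nat \<Rightarrow> 'a set" where
  "classmates P r C c k l = {v \<in> P. order_isomorphic (P - {v}) r C c \<and> card (dn r P v) = k \<and> card (up r P v) = l}"

lemma classmates_converse [simp]: "classmates P (r\<inverse>) C (c\<inverse>) l k = classmates P r C c k l"
  by (auto simp: classmates_def)

lemma finite_classmates: "fpo P r \<Longrightarrow> finite (classmates P r C c k l)"
  using fpo_finite[of P r] by (simp add: classmates_def)

lemma classmates_iso:
  assumes "x \<in> classmates P r C c k l" "y \<in> classmates Q s C c k' l'"
  shows "order_isomorphic (P - {x}) r (Q - {y}) s"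
  using assms order_isomorphic_trans[OF _ order_isomorphic_sym, of "P - {x}" r C c "Q - {y}" s] by (simp add: classmates_def)

lemma classmates_sum:
  assumes "fpo P r" "fpo Q s" "hypomorphic P r Q s" "4 \<le> card P"
    and "x \<in> classmates P r C c k l" "y \<in> classmates Q s C c k' l'"
  shows "k + l = k' + l'"
  using deletion_degree_sum[OF assms(1-4) _ _ classmates_iso[OF assms(5,6)]] assms(5,6) by (simp add: classmates_def)

lemma classmates_pair:
  assumes "fpo P r" "fpo Q s" "hypomorphic P r Q s" "4 \<le> card P"
    and "x \<in> classmates P r C c k l" "y \<in> classmates Q s C c k' l'" "k < k'"
  shows "removal_pair P r x Q s y"
  by unfold_locales (use assms classmates_iso[OF assms(5,6)] in \<open>auto simp: classmates_def\<close>)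

text \<open>The alternatives \<open>two_down\<close> and \<open>two_up\<close> depend on the two sizes and the card only.\<close>
context removal_pair
begin

lemma change_x:
  assumes A: "fpo A u" "hypomorphic A u Q s" "x' \<in> A" "order_isomorphic (A - {x'}) u (Q - {q}) s"
    and eq: "card (dn u A x') = a"
  shows "removal_pair A u x' Q s q"
    and "removal_pair.two_down A u x' Q s q \<longleftrightarrow> two_down"
    and "removal_pair.two_up A u x' Q s q \<longleftrightarrow> two_up"
proof -
  show rp: "removal_pair A u x' Q s q"
    by unfold_locales (use A Q q less eq n4 card_eq hypomorphic_card[OF A(2)] in auto)
  show "removal_pair.two_down A u x' Q s q \<longleftrightarrow> two_down"
    unfolding removal_pair.two_down_def[OF rp] two_down_def eq ..
  \<comment> \<open>The mirror image of \<open>card_level\<close> expresses the number of points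
    above \<open>x\<close> with filters of size \<open>b\<close> through \<open>q\<close> alone, so
    it is the same for \<open>x'\<close>.\<close>
  have "card {v \<in> P. (x, v) \<in> r \<and> card (up r P v) = b} + card (dn s Q (removal_pair.z Q (s\<inverse>) q)) = card (dn s Q q)"
    using removal_pair.card_level[OF dual] by simp
  moreover have "card {v \<in> A. (x', v) \<in> u \<and> card (up u A v) = b} + card (dn s Q (removal_pair.z Q (s\<inverse>) q)) = card (dn s Q q)"
    using removal_pair.card_level[OF removal_pair.dual[OF rp]] by simp
  ultimately have e: "card {v \<in> A. (x', v) \<in> u \<and> card (up u A v) = b} = card {v \<in> P. (x, v) \<in> r \<and> card (up r P v) = b}"
    by linarith
  show "removal_pair.two_up A u x' Q s q \<longleftrightarrow> two_up"
    unfolding removal_pair.two_up_def[OF rp] two_up_def e ..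
qed

lemma change_q:
  assumes A: "fpo A u" "hypomorphic P r A u" "q' \<in> A" "order_isomorphic (P - {x}) r (A - {q'}) u"
    and eq: "card (up u A q') = b"
  shows "removal_pair P r x A u q'"
    and "removal_pair.two_down P r x A u q' \<longleftrightarrow> two_down"
    and "removal_pair.two_up P r x A u q' \<longleftrightarrow> two_up"
proof -
  have A': "fpo A (u\<inverse>)" "hypomorphic A (u\<inverse>) P (r\<inverse>)" "order_isomorphic (A - {q'}) (u\<inverse>) (P - {x}) (r\<inverse>)"
    "card (dn (u\<inverse>) A q') = card (dn (s\<inverse>) Q q)"
    using A hypomorphic_sym order_isomorphic_sym eq by auto
  have D: "removal_pair A (u\<inverse>) q' P (r\<inverse>) x"
    by (rule removal_pair.change_x(1)[OF dual A'(1,2) A(3) A'(3,4)])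
  show rp: "removal_pair P r x A u q'" using removal_pair.dual[OF D] by simp
  have e: "removal_pair.two_down A (u\<inverse>) q' P (r\<inverse>) x \<longleftrightarrow> removal_pair.two_down Q (s\<inverse>) q P (r\<inverse>) x"
    "removal_pair.two_up A (u\<inverse>) q' P (r\<inverse>) x \<longleftrightarrow> removal_pair.two_up Q (s\<inverse>) q P (r\<inverse>) x"
    by (rule removal_pair.change_x(2,3)[OF dual A'(1,2) A(3) A'(3,4)])+
  show "removal_pair.two_down P r x A u q' \<longleftrightarrow> two_down"
    using e(2) removal_pair.two_down_dual[OF rp] two_down_dual by simp
  have "removal_pair.two_up P r x A u q' \<longleftrightarrow> removal_pair.two_down A (u\<inverse>) q' P (r\<inverse>) x"
    using removal_pair.two_down_dual[OF D] by simp
  also have "\<dots> \<longleftrightarrow> two_up" using e(1) removal_pair.two_down_dual[OF dual] by simp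
  finally show "removal_pair.two_up P r x A u q' \<longleftrightarrow> two_up" .
qed

end

lemma card_iso_part:
  assumes iso: "order_isomorphic V r W s" and xq: "order_isomorphic (V - {x}) r (W - {q}) s"
  shows "card {k \<in> V. order_isomorphic (V - {k}) r (V - {x}) r \<and> card (dn r V k) = m}
    = card {k \<in> W. order_isomorphic (W - {k}) s (W - {q}) s \<and> card (dn s W k) = m}"
proof -
  obtain f where f: "bij_betw f V W" "\<forall>v\<in>V. \<forall>w\<in>V. (v, w) \<in> r \<longleftrightarrow> (f v, f w) \<in> s"
    using iso unfolding order_isomorphic_def by blast
  have fk: "order_isomorphic (V - {k}) r (W - {f k}) s" if k: "k \<in> V" for k
  proof -
    have "inj_on f (V - {k})" using f(1) by (auto simp: bij_betw_def intro: inj_on_subset)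
    moreover have "f ` (V - {k}) = W - {f k}"
      using f(1) k inj_on_image_set_diff[of f V V "{k}"] by (simp add: bij_betw_def)
    ultimately have "bij_betw f (V - {k}) (W - {f k})" by (simp add: bij_betw_def)
    then show ?thesis unfolding order_isomorphic_def using f(2) by blast
  qed
  have good: "order_isomorphic (V - {k}) r (V - {x}) r \<longleftrightarrow> order_isomorphic (W - {f k}) s (W - {q}) s" if k: "k \<in> V" for k
  proof
    assume h: "order_isomorphic (V - {k}) r (V - {x}) r"
    show "order_isomorphic (W - {f k}) s (W - {q}) s"
      by (rule order_isomorphic_trans[OF order_isomorphic_sym[OF fk[OF k]] order_isomorphic_trans[OF h xq]])
  next
    assume h: "order_isomorphic (W - {f k}) s (W - {q}) s"
    show "order_isomorphic (V - {k}) r (V - {x}) r"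
      by (rule order_isomorphic_trans[OF order_isomorphic_trans[OF fk[OF k] h] order_isomorphic_sym[OF xq]])
  qed
  have "bij_betw f {k \<in> V. order_isomorphic (V - {k}) r (V - {x}) r \<and> card (dn r V k) = m}
     {k \<in> W. order_isomorphic (W - {k}) s (W - {q}) s \<and> card (dn s W k) = m}"
    unfolding bij_betw_def
  proof
    show "inj_on f {k \<in> V. order_isomorphic (V - {k}) r (V - {x}) r \<and> card (dn r V k) = m}"
      using f(1) by (auto simp: bij_betw_def intro: inj_on_subset)
    have W: "W = f ` V" using f(1) by (auto simp: bij_betw_def)
    show "f ` {k \<in> V. order_isomorphic (V - {k}) r (V - {x}) r \<and> card (dn r V k) = m}
       = {k \<in> W. order_isomorphic (W - {k}) s (W - {q}) s \<and> card (dn s W k) = m}"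
      using good iso_dn(2)[OF f] unfolding W by auto
  qed
  then show ?thesis by (rule bij_betw_same_card)
qed

text \<open>Points of an autonomous set have isomorphic cards as soon as their removals from the set
  are isomorphic. Ideal sizes inside and outside differ by the constant \<open>a - 1\<close>, and
  the filter size then follows from the degree sum. The converse implication on removals is not
  automatic and enters as \<open>all\<close>.\<close>

lemma classmates_module:
  assumes A: "fpo A u" "4 \<le> card A" and mod: "order_module A u V"
    and dn: "\<And>k. k \<in> V \<Longrightarrow> card (dn u A k) = a - 1 + card (dn u V k)"
    and y: "y \<in> V" "y \<in> classmates A u C c k0 l0" and kl: "k + l = k0 + l0" "a - 1 \<le> k"
    and all: "\<And>v. v \<in> classmates A u C c k l \<Longrightarrow> v \<in> V \<Longrightarrow> order_isomorphic (V - {v}) u (V - {y}) u"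
  shows "classmates A u C c k l \<inter> V = {v \<in> V. order_isomorphic (V - {v}) u (V - {y}) u \<and> card (dn u V v) = k - (a - 1)}"
proof (intro subset_antisym subsetI)
  fix v assume "v \<in> classmates A u C c k l \<inter> V"
  then show "v \<in> {v \<in> V. order_isomorphic (V - {v}) u (V - {y}) u \<and> card (dn u V v) = k - (a - 1)}"
    using all dn[of v] by (auto simp: classmates_def)
next
  fix v assume v: "v \<in> {v \<in> V. order_isomorphic (V - {v}) u (V - {y}) u \<and> card (dn u V v) = k - (a - 1)}"
  have VA: "V \<subseteq> A" using mod by (simp add: order_module_def)
  then have vA: "v \<in> A" using v by blast
  have vy: "order_isomorphic (A - {v}) u (A - {y}) u" using module_replace[OF mod, of v y] v y by blast
  then have "order_isomorphic (A - {v}) u C c"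
    using y(2) order_isomorphic_trans[of "A - {v}" u "A - {y}" u C c] by (simp add: classmates_def)
  moreover have "card (dn u A v) + card (up u A v) = k0 + l0"
    using deletion_degree_sum[OF A(1,1) hypomorphic_refl A(2) vA _ vy] y(2) by (simp add: classmates_def)
  moreover have "card (dn u A v) = k" using dn[of v] v kl(2) by auto
  ultimately show "v \<in> classmates A u C c k l \<inter> V" using v vA kl(1) by (auto simp: classmates_def)
qed

text \<open>The components partition \<open>A\<close>, and each of those considered contains
  \<alpha> of its points. The set \<open>B\<close> enlarges the family of components so that two
  classes can be counted over the same family.\<close>

lemma card_by_components:
  assumes fin: "finite A" "finite B" and A: "\<And>y. y \<in> A \<union> B \<Longrightarrow> card (A \<inter> component M u y) = \<alpha>"
  shows "card A = \<alpha> * card (component M u ` (A \<union> B))"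
proof -
  let ?F = "component M u ` (A \<union> B)"
  have "A = (\<Union>V\<in>?F. A \<inter> V)" using component_self[of _ M u] by auto
  then have "card A = card (\<Union>V\<in>?F. A \<inter> V)" by (rule arg_cong)
  also have "\<dots> = (\<Sum>V\<in>?F. card (A \<inter> V))"
  proof (rule card_UN_disjoint)
    show "finite ?F" "\<forall>V\<in>?F. finite (A \<inter> V)" using fin by auto
    show "\<forall>V\<in>?F. \<forall>W\<in>?F. V \<noteq> W \<longrightarrow> A \<inter> V \<inter> (A \<inter> W) = {}"
    proof (intro ballI impI)
      fix V W assume "V \<in> ?F" "W \<in> ?F" and ne: "V \<noteq> W"
      then obtain y z where yz: "V = component M u y" "W = component M u z" by auto
      have False if "w \<in> V" "w \<in> W" for w
        using component_eq[of w M u y] component_eq[of w M u z] that ne yz by simp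
      then show "A \<inter> V \<inter> (A \<inter> W) = {}" by blast
    qed
  qed
  also have "\<dots> = (\<Sum>V\<in>?F. \<alpha>)" by (rule sum.cong[OF refl]) (use A in auto)
  finally show ?thesis by simp
qed

section \<open>Proportional classes from autonomous components\<close>

context removal_pair
begin

lemma change_x_components:
  assumes two: "two_up" "two_down" "2 \<le> a"
    and A: "fpo A u" "hypomorphic A u Q s" "x' \<in> A" "order_isomorphic (A - {x'}) u (Q - {q}) s" "card (dn u A x') = a"
  shows "order_isomorphic (component (middle a b A u) u x' - {x'}) u (component (middle a b Q s) s q - {q}) s"
  using removal_pair.middle_components(4)[OF change_x(1)[OF A]] change_x(2,3)[OF A] two A(5) by simp

lemma change_q_components:
  assumes two: "two_up" "two_down" "2 \<le> a"
    and A: "fpo A u" "hypomorphic P r A u" "q' \<in> A" "order_isomorphic (P - {x}) r (A - {q'}) u" "card (up u A q') = b"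
  shows "order_isomorphic (component (middle a b P r) r x - {x}) r (component (middle a b A u) u q' - {q'}) u"
  using removal_pair.middle_components(4)[OF change_q(1)[OF A]] change_q(2,3)[OF A] two A(5) by simp

text \<open>By \<open>change_x_components\<close> and \<open>change_q_components\<close>, removing
  any of the classmates from its component leaves the same order. Inside the component the class is
  thus described by the component alone, and the components at \<open>x\<close> and \<open>q\<close>
  are isomorphic.\<close>

lemma classmates_in_components:
  assumes two: "two_up" "two_down" "2 \<le> a" and C: "order_isomorphic (P - {x}) r C c"
    and kl: "(k = a \<and> l = card (up r P x)) \<or> (k = card (dn s Q q) \<and> l = b)"
  shows "card (classmates P r C c k l \<inter> component (middle a b P r) r x)
    = card (classmates Q s C c k l \<inter> component (middle a b Q s) s q)"
proof -
  let ?V = "component (middle a b P r) r x" and ?W = "component (middle a b Q s) s q"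
  have xK: "x \<in> classmates P r C c a (card (up r P x))" using x C by (simp add: classmates_def)
  have Cq: "order_isomorphic (Q - {q}) s C c" by (rule order_isomorphic_trans[OF order_isomorphic_sym[OF iso] C])
  have qK: "q \<in> classmates Q s C c (card (dn s Q q)) b" using q Cq by (simp add: classmates_def)
  note VW = middle_components[OF two]
  have n4Q: "4 \<le> card Q" using n4 card_eq by simp
  have sum: "k + l = a + card (up r P x)" "k + l = card (dn s Q q) + b" "a - 1 \<le> k"
    using kl degree_sum less by auto
  have allV: "order_isomorphic (?V - {v}) r (?V - {x}) r" if v: "v \<in> classmates P r C c k l" "v \<in> ?V" for v
  proof -
    have vP: "v \<in> P" "card (dn r P v) = k" "card (up r P v) = l" using v by (auto simp: classmates_def)
    have e: "component (middle a b P r) r v = ?V" by (rule component_eq[OF v(2)])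
    from kl show ?thesis
    proof
      assume "k = a \<and> l = card (up r P x)"
      then have "order_isomorphic (component (middle a b P r) r v - {v}) r (?W - {q}) s"
        by (intro change_x_components[OF two P hyp vP(1) classmates_iso[OF v(1) qK]]) (simp add: vP)
      then show ?thesis unfolding e using order_isomorphic_trans[OF _ order_isomorphic_sym[OF VW(4)]] by blast
    next
      assume "k = card (dn s Q q) \<and> l = b"
      then have "order_isomorphic (?V - {x}) r (component (middle a b P r) r v - {v}) r"
        by (intro change_q_components[OF two P hypomorphic_refl vP(1) classmates_iso[OF xK v(1)]]) (simp add: vP)
      then show ?thesis unfolding e by (rule order_isomorphic_sym)
    qed
  qed
  have allW: "order_isomorphic (?W - {v}) s (?W - {q}) s" if v: "v \<in> classmates Q s C c k l" "v \<in> ?W" for v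
  proof -
    have vQ: "v \<in> Q" "card (dn s Q v) = k" "card (up s Q v) = l" using v by (auto simp: classmates_def)
    have e: "component (middle a b Q s) s v = ?W" by (rule component_eq[OF v(2)])
    from kl show ?thesis
    proof
      assume "k = a \<and> l = card (up r P x)"
      then have "order_isomorphic (component (middle a b Q s) s v - {v}) s (?W - {q}) s"
        by (intro change_x_components[OF two Q hypomorphic_refl vQ(1) classmates_iso[OF v(1) qK]]) (simp add: vQ)
      then show ?thesis unfolding e .
    next
      assume "k = card (dn s Q q) \<and> l = b"
      then have "order_isomorphic (?V - {x}) r (component (middle a b Q s) s v - {v}) s"
        by (intro change_q_components[OF two Q hyp vQ(1) classmates_iso[OF xK v(1)]]) (simp add: vQ)
      then have h: "order_isomorphic (?V - {x}) r (?W - {v}) s" unfolding e .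
      show ?thesis by (rule order_isomorphic_trans[OF order_isomorphic_sym[OF h] VW(4)])
    qed
  qed
  have "classmates P r C c k l \<inter> ?V = {v \<in> ?V. order_isomorphic (?V - {v}) r (?V - {x}) r \<and> card (dn r ?V v) = k - (a - 1)}"
    by (rule classmates_module[OF P n4 VW(1) VW(5) component_self xK sum(1,3) allV])
  moreover have "classmates Q s C c k l \<inter> ?W = {v \<in> ?W. order_isomorphic (?W - {v}) s (?W - {q}) s \<and> card (dn s ?W v) = k - (a - 1)}"
    by (rule classmates_module[OF Q n4Q VW(2) VW(6) component_self qK sum(2,3) allW])
  ultimately show ?thesis using card_iso_part[OF VW(3,4)] by simp
qed

text \<open>Every component that meets one of the two classes contains the same numbers of points of
  both, in either order. Class sizes are these numbers times the number \<open>NP\<close> or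
  \<open>NQ\<close> of such components, so their ratio does not depend on the order.\<close>

lemma classmates_proportional_module:
  assumes two: "two_up" "two_down" "2 \<le> a" and C: "order_isomorphic (P - {x}) r C c"
  shows "\<exists>\<alpha> \<beta>. 0 < \<alpha> \<and> 0 < \<beta>
    \<and> \<alpha> * card (classmates P r C c a (card (up r P x))) = \<beta> * card (classmates P r C c (card (dn s Q q)) b)
    \<and> \<alpha> * card (classmates Q s C c a (card (up r P x))) = \<beta> * card (classmates Q s C c (card (dn s Q q)) b)"
proof -
  let ?a' = "card (up r P x)" and ?b' = "card (dn s Q q)"
  let ?X = "classmates P r C c a ?a'" and ?Y = "classmates P r C c ?b' b"
  let ?X' = "classmates Q s C c a ?a'" and ?Y' = "classmates Q s C c ?b' b"
  let ?V = "component (middle a b P r) r" and ?W = "component (middle a b Q s) s"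
  let ?n = "\<lambda>k l. card (classmates P r C c k l \<inter> ?V x)"
  have xK: "x \<in> ?X" using x C by (simp add: classmates_def)
  have Cq: "order_isomorphic (Q - {q}) s C c" by (rule order_isomorphic_trans[OF order_isomorphic_sym[OF iso] C])
  have qK: "q \<in> ?Y'" using q Cq by (simp add: classmates_def)
  have agree: "?n k l = card (classmates Q s C c k l \<inter> ?W q)"
    if "(k = a \<and> l = ?a') \<or> (k = ?b' \<and> l = b)" for k l
    by (rule classmates_in_components[OF two C that])
  have xside: "card (classmates A u C c k l \<inter> component (middle a b A u) u y) = ?n k l"
    if kl: "(k = a \<and> l = ?a') \<or> (k = ?b' \<and> l = b)" and y: "y \<in> classmates A u C c a ?a'"
      and A: "fpo A u" "hypomorphic A u Q s" for A :: "'z set" and u k l y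
  proof -
    have yA: "y \<in> A" "order_isomorphic (A - {y}) u C c" "card (dn u A y) = a" "card (up u A y) = ?a'"
      using y by (auto simp: classmates_def)
    note h = A yA(1) classmates_iso[OF y qK] yA(3)
    have "card (classmates A u C c k l \<inter> component (middle a b A u) u y) = card (classmates Q s C c k l \<inter> ?W q)"
      using removal_pair.classmates_in_components[OF change_x(1)[OF h] _ _ _ yA(2), of k l] change_x(2,3)[OF h] two kl yA(3,4)
      by simp
    then show ?thesis using agree[OF kl] by simp
  qed
  have qside: "card (classmates A u C c k l \<inter> component (middle a b A u) u y) = ?n k l"
    if kl: "(k = a \<and> l = ?a') \<or> (k = ?b' \<and> l = b)" and y: "y \<in> classmates A u C c ?b' b"
      and A: "fpo A u" "hypomorphic P r A u" for A :: "'z set" and u k l y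
  proof -
    have yA: "y \<in> A" "order_isomorphic (A - {y}) u C c" "card (dn u A y) = ?b'" "card (up u A y) = b"
      using y by (auto simp: classmates_def)
    note h = A yA(1) classmates_iso[OF xK y] yA(4)
    show ?thesis
      using removal_pair.classmates_in_components[OF change_q(1)[OF h] _ _ _ C, of k l] change_q(2,3)[OF h] two kl yA(3,4)
      by simp
  qed
  define NP where "NP = card (?V ` (?X \<union> ?Y))"
  define NQ where "NQ = card (?W ` (?X' \<union> ?Y'))"
  have fin: "finite ?X" "finite ?Y" "finite ?X'" "finite ?Y'"
    using finite_classmates[OF P] finite_classmates[OF Q] by auto
  have cP: "card (classmates P r C c k l \<inter> ?V y) = ?n k l"
    if kl: "(k = a \<and> l = ?a') \<or> (k = ?b' \<and> l = b)" and y: "y \<in> ?X \<union> ?Y" for k l y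
    using xside[OF kl _ P hyp, of y] qside[OF kl _ P hypomorphic_refl, of y] y by blast
  have cQ: "card (classmates Q s C c k l \<inter> ?W y) = ?n k l"
    if kl: "(k = a \<and> l = ?a') \<or> (k = ?b' \<and> l = b)" and y: "y \<in> ?X' \<union> ?Y'" for k l y
    using xside[OF kl _ Q hypomorphic_refl, of y] qside[OF kl _ Q hyp, of y] y by blast
  have X: "card ?X = ?n a ?a' * NP" unfolding NP_def by (rule card_by_components[OF fin(1,2) cP]) auto
  have Y: "card ?Y = ?n ?b' b * NP" unfolding NP_def Un_commute[of ?X] by (rule card_by_components[OF fin(2,1) cP]) auto
  have X': "card ?X' = ?n a ?a' * NQ" unfolding NQ_def by (rule card_by_components[OF fin(3,4) cQ]) auto
  have Y': "card ?Y' = ?n ?b' b * NQ" unfolding NQ_def Un_commute[of ?X'] by (rule card_by_components[OF fin(4,3) cQ]) auto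
  have "0 < ?n a ?a'" using fin(1) xK component_self[of x "middle a b P r" r] by (auto simp: card_gt_0_iff)
  moreover have "0 < ?n ?b' b"
    using fin(4) qK component_self[of q "middle a b Q s" s] agree[of ?b' b] by (auto simp: card_gt_0_iff)
  ultimately show ?thesis
    by (intro exI[of _ "?n ?b' b"] exI[of _ "?n a ?a'"]) (simp add: X Y X' Y')
qed

end

section \<open>Twins and the shift of a class by one size\<close>

context removal_pair
begin

text \<open>Exactly one point below \<open>q\<close> is at the level of \<open>x\<close>, so
  \<open>card_level\<close> makes the filter of \<open>x\<close> larger than that of
  \<open>z\<close> by one. With \<open>dn_z\<close> this turns \<open>x\<close> and \<open>z\<close>
  into twins.\<close>

lemma up_z:
  assumes "\<not> two_down" shows "up r P x = insert x (up r P z)" "card (up r P x) = Suc (card (up r P z))"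
proof -
  have "card {u \<in> Q. (u, q) \<in> s \<and> card (dn s Q u) = a} = 1"
    using assms card_level card_up_z_less unfolding two_down_def by linarith
  then show c: "card (up r P x) = Suc (card (up r P z))" using card_level by simp
  have sub: "insert x (up r P z) \<subseteq> up r P x"
    using up_mono[OF P x z(1,2)] up_self[OF P x] by blast
  have "x \<notin> up r P z" using fpo_antisym[OF P z(1) x] z(2,4) by (auto simp: up_def)
  then have "card (insert x (up r P z)) = card (up r P x)" using finite_up[OF P] c by simp
  then show "up r P x = insert x (up r P z)" using card_subset_eq[OF finite_up[OF P] sub] by simp
qed

lemma z_classmate:
  assumes "\<not> two_down" and xK: "x \<in> classmates P r C c k l"
  shows "z \<in> classmates P r C c (Suc k) (l - 1)"
proof -
  have "order_isomorphic (P - {x}) r (P - {z}) r"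
    by (rule twin_swap[OF P x z(1) z(4)[symmetric] dn_z up_z(1)[OF assms(1)]])
  then have "order_isomorphic (P - {z}) r C c"
    using xK order_isomorphic_trans[OF order_isomorphic_sym, of "P - {x}" r "P - {z}" r C c] by (simp add: classmates_def)
  then show ?thesis using xK z(1,3) up_z(2)[OF assms(1)] by (auto simp: classmates_def)
qed

lemma dn_x_z: "dn r P x = dn r P z - {z}"
proof -
  have "z \<notin> dn r P x" using fpo_antisym[OF P z(1) x] z(2,4) by (auto simp: dn_def)
  then show ?thesis using dn_z by auto
qed

end

text \<open>The map from \<open>x\<close> to its twin is injective, since the twin determines the
  ideal of \<open>x\<close> and the ideal determines \<open>x\<close>. The condition
  \<open>no\<close> mentions only \<open>q\<close> and the size \<open>a\<close>, so it serves every
  \<open>x\<close> of the class.\<close>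

lemma classmates_le_Suc:
  assumes A: "fpo A u" "4 \<le> card A" and B: "fpo B w" "hypomorphic A u B w" and q: "q \<in> classmates B w C c b b'"
    and ab: "a < b" and no: "\<not> 2 \<le> card {y \<in> B. (y, q) \<in> w \<and> card (dn w B y) = a}"
  shows "card (classmates A u C c a a') \<le> card (classmates A u C c (Suc a) (a' - 1))"
proof (rule card_inj_on_le)
  have rp: "removal_pair A u x B w q" if x: "x \<in> classmates A u C c a a'" for x
    by (rule classmates_pair[OF A(1) B A(2) x q ab])
  have nt: "\<not> removal_pair.two_down A u x B w q" if x: "x \<in> classmates A u C c a a'" for x
    using no x unfolding removal_pair.two_down_def[OF rp[OF x]] by (simp add: classmates_def)
  show "removal_pair.z A u ` classmates A u C c a a' \<subseteq> classmates A u C c (Suc a) (a' - 1)"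
    using removal_pair.z_classmate[OF rp nt] by blast
  show "finite (classmates A u C c (Suc a) (a' - 1))" using finite_classmates[OF A(1)] .
  show "inj_on (removal_pair.z A u) (classmates A u C c a a')"
  proof (rule inj_onI)
    fix x y assume xy: "x \<in> classmates A u C c a a'" "y \<in> classmates A u C c a a'"
      and e: "removal_pair.z A u x = removal_pair.z A u y"
    have "dn u A x = dn u A y" using removal_pair.dn_x_z[OF rp[OF xy(1)]] removal_pair.dn_x_z[OF rp[OF xy(2)]] e by simp
    moreover have xA: "x \<in> A" "y \<in> A" using xy by (auto simp: classmates_def)
    ultimately have "(x, y) \<in> u" "(y, x) \<in> u" using dn_self[OF A(1)] by (auto simp: dn_def)
    then show "x = y" using fpo_antisym[OF A(1) xA] by blast
  qed
qed

context removal_pair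
begin

text \<open>One inequality is the twin map. For the other the order is reversed and \<open>x\<close>
  takes the place of \<open>q\<close>: only \<open>z\<close> lies above \<open>x\<close> with a
  filter smaller by one, so the shift also works backwards. Both inequalities hold for any order
  hypomorphic to the given ones, hence in \<open>P\<close> and in \<open>Q\<close>.\<close>

lemma string_classes:
  assumes no: "\<not> two_down" and xK: "x \<in> classmates P r C c k k'" and qK: "q \<in> classmates Q s C c l l'"
  shows "card (classmates P r C c k k') = card (classmates P r C c (Suc k) (k' - 1))"
    and "card (classmates Q s C c k k') = card (classmates Q s C c (Suc k) (k' - 1))"
proof -
  have n4Q: "4 \<le> card Q" using n4 card_eq by simp
  have k: "k = a" "k' = card (up r P x)" "l = card (dn s Q q)" using xK qK by (auto simp: classmates_def)
  have kl: "k < l" using less k by simp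
  have no': "\<not> 2 \<le> card {y \<in> Q. (y, q) \<in> s \<and> card (dn s Q y) = k}" using no k(1) by (simp add: two_down_def)
  have "{y \<in> P. (y, x) \<in> r\<inverse> \<and> card (dn (r\<inverse>) P y) = k' - 1} \<subseteq> {z}"
  proof
    fix y assume "y \<in> {y \<in> P. (y, x) \<in> r\<inverse> \<and> card (dn (r\<inverse>) P y) = k' - 1}"
    then have y: "y \<in> P" "y \<in> up r P x" "card (up r P y) = k' - 1" by (auto simp: up_def)
    have c: "k' = Suc (card (up r P z))" using up_z(2)[OF no] k(2) by simp
    then have "y \<noteq> x" using y(3) k(2) by auto
    then have "(z, y) \<in> r" using y(2) up_z(1)[OF no] by (auto simp: up_def)
    then show "y \<in> {z}" using card_up_less[OF P z(1) y(1)] y(3) c by fastforce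
  qed
  then have "card {y \<in> P. (y, x) \<in> r\<inverse> \<and> card (dn (r\<inverse>) P y) = k' - 1} \<le> card {z}" by (rule card_mono[rotated]) simp
  then have no2: "\<not> 2 \<le> card {y \<in> P. (y, x) \<in> r\<inverse> \<and> card (dn (r\<inverse>) P y) = k' - 1}" by simp
  have xd: "x \<in> classmates P (r\<inverse>) C (c\<inverse>) k' k" using xK by simp
  have k'pos: "k' - 1 < k'" "Suc (k' - 1) = k'" using up_z(2)[OF no] k(2) by auto
  have dP: "fpo P (r\<inverse>)" "hypomorphic P (r\<inverse>) P (r\<inverse>)" and dQ: "fpo Q (s\<inverse>)" "hypomorphic Q (s\<inverse>) P (r\<inverse>)"
    using P Q hypomorphic_refl hypomorphic_sym[OF hyp] by auto
  show "card (classmates P r C c k k') = card (classmates P r C c (Suc k) (k' - 1))"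
    using classmates_le_Suc[OF P n4 Q hyp qK kl no', of k'] classmates_le_Suc[OF dP(1) n4 dP xd k'pos(1) no2, of "Suc k"] k'pos(2)
    by simp
  show "card (classmates Q s C c k k') = card (classmates Q s C c (Suc k) (k' - 1))"
    using classmates_le_Suc[OF Q n4Q Q hypomorphic_refl qK kl no', of k'] classmates_le_Suc[OF dQ(1) n4Q dP(1) dQ(2) xd k'pos(1) no2, of "Suc k"] k'pos(2)
    by simp
qed

end

text \<open>Induction on the gap \<open>l - k\<close>. If \<open>two_down\<close> fails, the lower
  class is shifted up; if \<open>two_up\<close> fails, the upper class is shifted down. If both
  hold, the components are used, directly for \<open>2 \<le> k\<close> and in the reversed orders
  for \<open>2 \<le> l'\<close>. A shift creates one of these two conditions, as sizes are
  positive.\<close>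

lemma classmates_proportional:
  assumes P: "fpo P r" and Q: "fpo Q s" and hyp: "hypomorphic P r Q s" and n4: "4 \<le> card P"
    and "x \<in> classmates P r C c k k'" "q \<in> classmates Q s C c l l'" "k < l" "2 \<le> k \<or> 2 \<le> l'"
  shows "\<exists>\<alpha> \<beta>. 0 < \<alpha> \<and> 0 < \<beta>
    \<and> \<alpha> * card (classmates P r C c k k') = \<beta> * card (classmates P r C c l l')
    \<and> \<alpha> * card (classmates Q s C c k k') = \<beta> * card (classmates Q s C c l l')"
  using assms(5-)
proof (induction "l - k" arbitrary: k k' l l' x q rule: less_induct)
  case less
  note xK = less.prems(1) and qK = less.prems(2) and kl = less.prems(3) and int = less.prems(4)
  interpret removal_pair P r x Q s q by (rule classmates_pair[OF P Q hyp n4 xK qK kl])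
  have e: "k = card (dn r P x)" "k' = card (up r P x)" "l = card (dn s Q q)" "l' = card (up s Q q)"
    and Cx: "order_isomorphic (P - {x}) r C c" and Cq: "order_isomorphic (Q - {q}) s C c"
    using xK qK by (auto simp: classmates_def)
  have sum: "k + k' = l + l'" using classmates_sum[OF P Q hyp n4 xK qK] .
  show ?case
  proof (cases "two_down")
    case False
    note str = string_classes[OF False xK qK]
    show ?thesis
    proof (cases "Suc k = l")
      case True
      then have "k' - 1 = l'" using sum by simp
      then show ?thesis using str True by (intro exI[of _ 1]) simp
    next
      case ne: False
      then have "l - Suc k < l - k" "Suc k < l" using kl by auto
      then show ?thesis unfolding str
        by (rule less.hyps[OF _ z_classmate[OF False xK] qK]) (use kl e(1) a_pos in auto)
    qed
  next
    case down: True
    show ?thesis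
    proof (cases "two_up")
      case False
      then have no: "\<not> removal_pair.two_down Q (s\<inverse>) q P (r\<inverse>) x"
        using removal_pair.two_down_dual[OF dual] by simp
      have xd: "x \<in> classmates P (r\<inverse>) C (c\<inverse>) k' k" and qd: "q \<in> classmates Q (s\<inverse>) C (c\<inverse>) l' l"
        using xK qK by auto
      have str: "card (classmates P r C c l l') = card (classmates P r C c (l - 1) (Suc l'))"
        "card (classmates Q s C c l l') = card (classmates Q s C c (l - 1) (Suc l'))"
        using removal_pair.string_classes[OF dual no qd xd] by simp_all
      have zK: "removal_pair.z Q (s\<inverse>) q \<in> classmates Q s C c (l - 1) (Suc l')"
        using removal_pair.z_classmate[OF dual no qd] by simp
      show ?thesis
      proof (cases "k = l - 1")
        case True
        then have "k' = Suc l'" using sum kl by simp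
        then show ?thesis using str True by (intro exI[of _ 1]) simp
      next
        case ne: False
        then have "l - 1 - k < l - k" "k < l - 1" using kl by auto
        then show ?thesis unfolding str
          by (rule less.hyps[OF _ xK zK]) (use e(4) b_pos in auto)
      qed
    next
      case up: True
      show ?thesis
      proof (cases "2 \<le> k")
        case True
        then show ?thesis using classmates_proportional_module[OF up down _ Cx] e by simp
      next
        case False
        have Cqd: "order_isomorphic (Q - {q}) (s\<inverse>) C (c\<inverse>)" using Cq by simp
        have l2: "2 \<le> card (dn (s\<inverse>) Q q)" using False int e by simp
        have "removal_pair.two_up Q (s\<inverse>) q P (r\<inverse>) x" "removal_pair.two_down Q (s\<inverse>) q P (r\<inverse>) x"
          using up down two_down_dual removal_pair.two_down_dual[OF dual] by simp_all
        then obtain \<alpha> \<beta> where "0 < \<alpha>" "0 < \<beta>"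
          "\<alpha> * card (classmates Q s C c l l') = \<beta> * card (classmates Q s C c k k')"
          "\<alpha> * card (classmates P r C c l l') = \<beta> * card (classmates P r C c k k')"
          using removal_pair.classmates_proportional_module[OF dual _ _ l2 Cqd] e by auto
        then show ?thesis by (intro exI[of _ \<beta>] exI[of _ \<alpha>]) simp
      qed
    qed
  qed
qed

lemma card_classmates_sum:
  assumes P: "fpo P r" and N: "\<And>v. v \<in> P \<Longrightarrow> order_isomorphic (P - {v}) r C c \<Longrightarrow> card (dn r P v) + card (up r P v) = N"
  shows "card {v \<in> P. order_isomorphic (P - {v}) r C c \<and> \<Phi> v} = (\<Sum>k\<le>N. card {v \<in> classmates P r C c k (N - k). \<Phi> v})"
proof -
  let ?F = "\<lambda>k. {v \<in> classmates P r C c k (N - k). \<Phi> v}"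
  have "{v \<in> P. order_isomorphic (P - {v}) r C c \<and> \<Phi> v} = (\<Union>k\<in>{..N}. ?F k)"
  proof (intro subset_antisym subsetI)
    fix v assume v: "v \<in> {v \<in> P. order_isomorphic (P - {v}) r C c \<and> \<Phi> v}"
    then have "card (dn r P v) + card (up r P v) = N" using N by blast
    then have "v \<in> ?F (card (dn r P v))" "card (dn r P v) \<le> N" using v by (auto simp: classmates_def)
    then show "v \<in> (\<Union>k\<in>{..N}. ?F k)" by blast
  qed (auto simp: classmates_def)
  then have "card {v \<in> P. order_isomorphic (P - {v}) r C c \<and> \<Phi> v} = card (\<Union>k\<in>{..N}. ?F k)" by (rule arg_cong)
  also have "\<dots> = (\<Sum>k\<le>N. card (?F k))"
    by (rule card_UN_disjoint) (use fpo_finite[OF P] in \<open>auto simp: classmates_def\<close>)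
  finally show ?thesis .
qed

lemma hypomorphic_card_type:
  assumes "hypomorphic P r Q s"
  shows "card {v \<in> P. order_isomorphic (P - {v}) r C c} = card {v \<in> Q. order_isomorphic (Q - {v}) s C c}"
proof -
  obtain \<pi> where p: "bij_betw \<pi> P Q" "\<forall>v\<in>P. order_isomorphic (P - {v}) r (Q - {\<pi> v}) s"
    using assms unfolding hypomorphic_def by blast
  have e: "order_isomorphic (P - {v}) r C c \<longleftrightarrow> order_isomorphic (Q - {\<pi> v}) s C c" if "v \<in> P" for v
  proof -
    have i: "order_isomorphic (P - {v}) r (Q - {\<pi> v}) s" using p(2) that by blast
    show ?thesis
      using order_isomorphic_trans[OF i, of C c] order_isomorphic_trans[OF order_isomorphic_sym[OF i], of C c] by blast
  qed
  have "bij_betw \<pi> {v \<in> P. order_isomorphic (P - {v}) r C c} {v \<in> Q. order_isomorphic (Q - {v}) s C c}"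
  proof -
    have "inj_on \<pi> P" "Q = \<pi> ` P" using p(1) by (auto simp: bij_betw_def)
    then show ?thesis using e by (auto simp: bij_betw_def intro: inj_on_subset)
  qed
  then show ?thesis by (rule bij_betw_same_card)
qed

text \<open>All nonempty classes are proportional to the interior class, so the difference between the
  two orders has the same sign in every class; as the totals agree it vanishes.\<close>
lemma classmates_card_eq:
  assumes P: "fpo P r" and Q: "fpo Q s" and hyp: "hypomorphic P r Q s" and n4: "4 \<le> card P"
    and e: "e \<in> classmates P r C c m m'" "2 \<le> m" "2 \<le> m'"
  shows "card (classmates P r C c k l) = card (classmates Q s C c k l)"
proof -
  let ?N = "m + m'"
  have n4Q: "4 \<le> card Q" using hypomorphic_card[OF hyp] n4 by simp
  have hyp': "hypomorphic Q s P r" by (rule hypomorphic_sym[OF hyp])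
  have sumP: "k + l = ?N" if "y \<in> classmates P r C c k l" for k l y
    using classmates_sum[OF P P hypomorphic_refl n4 that e(1)] .
  have sumQ: "k + l = ?N" if "y \<in> classmates Q s C c k l" for k l y
    using classmates_sum[OF Q P hyp' n4Q that e(1)] .
  have NP: "card (dn r P v) + card (up r P v) = ?N" if "v \<in> P" "order_isomorphic (P - {v}) r C c" for v
    using sumP[of v] that by (simp add: classmates_def)
  have NQ: "card (dn s Q v) + card (up s Q v) = ?N" if "v \<in> Q" "order_isomorphic (Q - {v}) s C c" for v
    using sumQ[of v] that by (simp add: classmates_def)
  define p where "p k = card (classmates P r C c k (?N - k))" for k
  define d where "d k = card (classmates Q s C c k (?N - k))" for k
  have total: "(\<Sum>k\<le>?N. p k) = (\<Sum>k\<le>?N. d k)"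
    using hypomorphic_card_type[OF hyp, of C c] card_classmates_sum[OF P NP, of C c "\<lambda>_. True"]
      card_classmates_sum[OF Q NQ, of C c "\<lambda>_. True"] unfolding p_def d_def by simp
  have finP: "finite (classmates P r C c k l)" and finQ: "finite (classmates Q s C c k l)" for k l
    using finite_classmates P Q by blast+
  have pos: "\<exists>y. y \<in> A" if "0 < card A" for A :: "'z set" using that by (metis card_gt_0_iff ex_in_conv)
  \<comment> \<open>That one of the sizes is the interior size \<open>m\<close> supplies the side
    condition of proportionality: a lower class at \<open>m\<close> has \<open>2 \<le> m\<close>, an
    upper class at \<open>m\<close> has \<open>2 \<le> m'\<close>.\<close>
  have cross: "\<exists>\<alpha> \<beta>. 0 < \<alpha> \<and> 0 < \<beta> \<and> \<alpha> * p k = \<beta> * p l \<and> \<alpha> * d k = \<beta> * d l"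
    if kl: "0 < p k" "0 < d l" and mm: "k = m \<or> l = m" for k l
  proof -
    obtain x q where x: "x \<in> classmates P r C c k (?N - k)" and q: "q \<in> classmates Q s C c l (?N - l)"
      using kl pos unfolding p_def d_def by metis
    consider "k < l" | "k = l" | "l < k" by linarith
    then show ?thesis
    proof cases
      case 1
      then have "2 \<le> k \<or> 2 \<le> ?N - l" using mm e by auto
      then show ?thesis unfolding p_def d_def by (rule classmates_proportional[OF P Q hyp n4 x q 1])
    next
      case 2 then show ?thesis by (intro exI[of _ 1]) simp
    next
      case 3
      then have "2 \<le> l \<or> 2 \<le> ?N - k" using mm e by auto
      then obtain \<alpha> \<beta> where "0 < \<alpha>" "0 < \<beta>" "\<alpha> * d l = \<beta> * d k" "\<alpha> * p l = \<beta> * p k"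
        using classmates_proportional[OF Q P hyp' n4Q q x 3] unfolding p_def d_def by blast
      then show ?thesis by (intro exI[of _ \<beta>] exI[of _ \<alpha>]) simp
    qed
  qed
  have mP: "0 < p m"
    using e(1) finP[of m m'] by (auto simp: p_def card_gt_0_iff)
  have mN: "m \<le> ?N" by simp
  have mQ: "0 < d m"
  proof (rule ccontr)
    assume "\<not> 0 < d m"
    then have "d m < p m" using mP by simp
    \<comment> \<open>Totals agree, so a deficit of \<open>Q\<close> at \<open>m\<close> is
      compensated at another size, which is then proportional to an empty class.\<close>
    then have "\<exists>k\<le>?N. p k < d k"
      using sum_strict_mono_ex1[of "{..?N}" d p] total mN by (metis atMost_iff finite_atMost less_irrefl not_le)
    then obtain k where k: "p k < d k" by blast
    then obtain \<alpha> \<beta> where "0 < \<alpha>" "\<alpha> * d m = \<beta> * d k" "0 < \<beta>" using cross[OF mP, of k] by auto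
    then show False using \<open>\<not> 0 < d m\<close> k by simp
  qed
  have ratio: "\<exists>\<alpha> \<beta>. 0 < \<alpha> \<and> 0 < \<beta> \<and> \<alpha> * p k = \<beta> * p m \<and> \<alpha> * d k = \<beta> * d m" if "0 < p k \<or> 0 < d k" for k
    using that
  proof
    assume "0 < p k" then show ?thesis using cross[OF _ mQ] by blast
  next
    assume "0 < d k"
    then obtain \<alpha> \<beta> where "0 < \<alpha>" "0 < \<beta>" "\<alpha> * p m = \<beta> * p k" "\<alpha> * d m = \<beta> * d k" using cross[OF mP] by blast
    then show ?thesis by (intro exI[of _ \<beta>] exI[of _ \<alpha>]) simp
  qed
  have le: "p k \<le> d k" if "p m \<le> d m" for k
  proof (cases "0 < p k \<or> 0 < d k")
    case True
    then obtain \<alpha> \<beta> where h: "0 < \<alpha>" "\<alpha> * p k = \<beta> * p m" "\<alpha> * d k = \<beta> * d m" using ratio by blast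
    then have "\<alpha> * p k \<le> \<alpha> * d k" using that by simp
    then show ?thesis using h(1) by simp
  qed simp
  have ge: "d k \<le> p k" if "d m \<le> p m" for k
  proof (cases "0 < p k \<or> 0 < d k")
    case True
    then obtain \<alpha> \<beta> where h: "0 < \<alpha>" "\<alpha> * p k = \<beta> * p m" "\<alpha> * d k = \<beta> * d m" using ratio by blast
    then have "\<alpha> * d k \<le> \<alpha> * p k" using that by simp
    then show ?thesis using h(1) by simp
  qed simp
  have eqm: "p m = d m"
  proof (rule ccontr)
    assume "p m \<noteq> d m"
    then consider "p m < d m" | "d m < p m" by linarith
    then show False
    proof cases
      case 1
      then have "(\<Sum>k\<le>?N. p k) < (\<Sum>k\<le>?N. d k)" using le by (intro sum_strict_mono_ex1) (auto intro!: bexI[of _ m])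
      then show False using total by simp
    next
      case 2
      then have "(\<Sum>k\<le>?N. d k) < (\<Sum>k\<le>?N. p k)" using ge by (intro sum_strict_mono_ex1) (auto intro!: bexI[of _ m])
      then show False using total by simp
    qed
  qed
  have eq: "p k = d k" for k using le[of k] ge[of k] eqm by simp
  show ?thesis
  proof (cases "k + l = ?N")
    case True
    then have l: "?N - k = l" by linarith
    show ?thesis using eq[of k] unfolding p_def d_def l .
  next
    case False
    then have "classmates P r C c k l = {}" "classmates Q s C c k l = {}" using sumP sumQ by blast+
    then show ?thesis by simp
  qed
qed

section \<open>Heights\<close>

definition chains_in :: "'a rel \<Rightarrow> 'a set \<Rightarrow> 'a set set" where
  "chains_in r D = {C. C \<subseteq> D \<and> (\<forall>c\<in>C. \<forall>d\<in>C. (c, d) \<in> r \<or> (d, c) \<in> r)}"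

text \<open>The number of points of a longest chain. For the ideal of a point it exceeds the rank by
  one (\<open>order_rank_height\<close>) and needs no reference to minimal elements.\<close>

definition height :: "'a rel \<Rightarrow> 'a set \<Rightarrow> nat" where
  "height r D = Max (card ` chains_in r D)"

lemma chains_in_finite: "finite D \<Longrightarrow> finite (chains_in r D)"
  by (rule finite_subset[of _ "Pow D"]) (auto simp: chains_in_def)

lemma height_ge: "finite D \<Longrightarrow> C \<in> chains_in r D \<Longrightarrow> card C \<le> height r D"
  unfolding height_def by (rule Max_ge) (auto simp: chains_in_finite)

lemma height_chain:
  assumes "finite D" obtains C where "C \<in> chains_in r D" "card C = height r D"
proof -
  have "{} \<in> chains_in r D" by (simp add: chains_in_def)
  then have "height r D \<in> card ` chains_in r D"
    unfolding height_def using chains_in_finite[OF assms] by (intro Max_in) auto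
  then show ?thesis using that by auto
qed

lemma height_mono: assumes "finite D'" "D \<subseteq> D'" shows "height r D \<le> height r D'"
proof -
  obtain C where "C \<in> chains_in r D" "card C = height r D" using height_chain finite_subset[OF assms(2,1)] by metis
  moreover from this have "C \<in> chains_in r D'" using assms(2) by (auto simp: chains_in_def)
  ultimately show ?thesis using height_ge[OF assms(1)] by metis
qed

lemma height_iso_le:
  assumes f: "bij_betw f D E" "\<forall>x\<in>D. \<forall>y\<in>D. (x, y) \<in> r \<longleftrightarrow> (f x, f y) \<in> s" and D: "finite D"
  shows "height r D \<le> height s E"
proof -
  obtain C where C: "C \<in> chains_in r D" "card C = height r D" using height_chain D by metis
  have CD: "C \<subseteq> D" using C(1) by (simp add: chains_in_def)
  have inj: "inj_on f D" and E: "E = f ` D" using f(1) by (auto simp: bij_betw_def)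
  have "f ` C \<in> chains_in s E" using C(1) CD f(2) unfolding chains_in_def E by blast
  then have "card (f ` C) \<le> height s E" using height_ge D E by blast
  then show ?thesis using C(2) card_image[OF inj_on_subset[OF inj CD]] by simp
qed

lemma height_iso:
  assumes "order_isomorphic D r E s" "finite D" shows "height r D = height s E"
proof -
  obtain f where f: "bij_betw f D E" "\<forall>x\<in>D. \<forall>y\<in>D. (x, y) \<in> r \<longleftrightarrow> (f x, f y) \<in> s"
    using assms(1) unfolding order_isomorphic_def by blast
  obtain g where g: "bij_betw g E D" "\<forall>x\<in>E. \<forall>y\<in>E. (x, y) \<in> s \<longleftrightarrow> (g x, g y) \<in> r"
    using order_isomorphic_sym[OF assms(1)] unfolding order_isomorphic_def by blast
  have "finite E" using f(1) assms(2) by (simp add: bij_betw_finite)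
  then show ?thesis using height_iso_le[OF f assms(2)] height_iso_le[OF g] by simp
qed

lemma height_dn_less:
  assumes P: "fpo P r" and uv: "u \<in> P" "v \<in> P" "(u, v) \<in> r" "u \<noteq> v"
  shows "height r (dn r P u) < height r (dn r P v)"
proof -
  obtain C where C: "C \<in> chains_in r (dn r P u)" "card C = height r (dn r P u)"
    using height_chain finite_dn[OF P] by metis
  have Cu: "C \<subseteq> dn r P u" using C(1) by (simp add: chains_in_def)
  have sub: "dn r P u \<subseteq> dn r P v" by (rule dn_mono[OF P uv(1-3)])
  have below: "(c, v) \<in> r" if "c \<in> C" for c using that Cu sub by (auto simp: dn_def)
  have "v \<notin> dn r P u" using fpo_antisym[OF P uv(1,2,3)] uv(4) by (auto simp: dn_def)
  then have "v \<notin> C" using Cu by blast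
  moreover have "finite C" using Cu finite_dn[OF P] by (rule finite_subset)
  ultimately have "card (insert v C) = Suc (card C)" by simp
  moreover have "insert v C \<in> chains_in r (dn r P v)"
    using C(1) Cu sub below dn_self[OF P uv(2)] fpo_refl[OF P uv(2)] unfolding chains_in_def by blast
  ultimately show ?thesis using height_ge[OF finite_dn[OF P]] C(2) by fastforce
qed

lemma chain_top:
  assumes P: "fpo P r" and C: "C \<in> chains_in r P" "C \<noteq> {}" shows "\<exists>u\<in>C. C \<subseteq> dn r P u"
proof -
  have CP: "C \<subseteq> P" using C(1) by (simp add: chains_in_def)
  have "finite ((\<lambda>u. card (dn r P u)) ` C)" using finite_subset[OF CP fpo_finite[OF P]] by simp
  then have "Max ((\<lambda>u. card (dn r P u)) ` C) \<in> (\<lambda>u. card (dn r P u)) ` C" using C(2) by (intro Max_in) auto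
  then obtain u where u: "u \<in> C" "card (dn r P u) = Max ((\<lambda>u. card (dn r P u)) ` C)" by auto
  have mx: "card (dn r P w) \<le> card (dn r P u)" if "w \<in> C" for w
    unfolding u(2) using \<open>finite ((\<lambda>u. card (dn r P u)) ` C)\<close> that by (intro Max_ge) auto
  have "(w, u) \<in> r" if w: "w \<in> C" for w
  proof (rule ccontr)
    assume "(w, u) \<notin> r"
    then have "(u, w) \<in> r" "u \<noteq> w" using C(1) u(1) w unfolding chains_in_def by blast+
    then show False using card_dn_less[OF P, of u w] u(1) w CP mx[OF w] by auto
  qed
  then show ?thesis using u(1) CP by (auto simp: dn_def)
qed

text \<open>The top of a longest chain without \<open>v\<close> is a point strictly below
  \<open>v\<close> of height at least \<open>h\<close>; the descent is repeated until the height is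
  exactly \<open>h\<close>.\<close>

lemma ex_below_of_height:
  assumes P: "fpo P r" and v: "v \<in> P" "h < height r (dn r P v)" and h: "0 < h"
  shows "\<exists>u\<in>P. (u, v) \<in> r \<and> u \<noteq> v \<and> height r (dn r P u) = h"
  using v
proof (induction "card (dn r P v)" arbitrary: v rule: less_induct)
  case less
  obtain C where C: "C \<in> chains_in r (dn r P v)" "card C = height r (dn r P v)"
    using height_chain finite_dn[OF P] by metis
  have Cv: "C \<subseteq> dn r P v" using C(1) by (simp add: chains_in_def)
  let ?C = "C - {v}"
  have finC: "finite C" using Cv finite_dn[OF P] by (rule finite_subset)
  have cC: "h \<le> card ?C" using less.prems(2) C(2) card_Diff_singleton_if[of C v] finC by (simp split: if_splits)
  have ne: "?C \<noteq> {}"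
  proof
    assume e: "?C = {}"
    show False using cC h unfolding e by simp
  qed
  have CP: "?C \<in> chains_in r P" using C(1) unfolding chains_in_def dn_def by blast
  obtain u where u: "u \<in> ?C" "?C \<subseteq> dn r P u" using chain_top[OF P CP ne] by blast
  have uv: "u \<in> P" "(u, v) \<in> r" "u \<noteq> v" using u(1) Cv by (auto simp: dn_def)
  have "?C \<in> chains_in r (dn r P u)" using u(2) C(1) unfolding chains_in_def by blast
  then have hu: "h \<le> height r (dn r P u)" using height_ge[OF finite_dn[OF P]] cC by (meson order_trans)
  show ?case
  proof (cases "height r (dn r P u) = h")
    case True then show ?thesis using uv by blast
  next
    case False
    then have "h < height r (dn r P u)" using hu by simp
    then obtain w where w: "w \<in> P" "(w, u) \<in> r" "w \<noteq> u" "height r (dn r P w) = h"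
      using less.hyps[OF card_dn_less[OF P uv(1) less.prems(1) uv(2,3)] uv(1)] by blast
    have "(w, v) \<in> r" by (rule fpo_trans[OF P w(1) uv(1) less.prems(1) w(2) uv(2)])
    moreover have "w \<noteq> v" using fpo_antisym[OF P w(1) uv(1) w(2)] uv(2) w(3) by blast
    ultimately show ?thesis using w by blast
  qed
qed

text \<open>A longest chain below \<open>x\<close>, with \<open>v\<close> put on top and
  \<open>x\<close> removed, survives the deletion and is no shorter. A point above \<open>x\<close>
  thus has height greater than \<open>k\<close> both before and after.\<close>

lemma height_minus:
  assumes P: "fpo P r" and x: "x \<in> P" and v: "v \<in> P" "v \<noteq> x" and k: "k < height r (dn r P x)"
  shows "height r (dn r (P - {x}) v) = k \<longleftrightarrow> height r (dn r P v) = k"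
proof (cases "(x, v) \<in> r")
  case False
  then have "dn r (P - {x}) v = dn r P v" by (auto simp: dn_def)
  then show ?thesis by simp
next
  case True
  obtain C where C: "C \<in> chains_in r (dn r P x)" "card C = height r (dn r P x)"
    using height_chain finite_dn[OF P] by metis
  have Cx: "C \<subseteq> dn r P x" using C(1) by (simp add: chains_in_def)
  have finC: "finite C" using Cx finite_dn[OF P] by (rule finite_subset)
  have sub: "dn r P x \<subseteq> dn r P v" by (rule dn_mono[OF P x v(1) True])
  have below: "(c, v) \<in> r" if "c \<in> C" for c using that Cx sub by (auto simp: dn_def)
  have "v \<notin> dn r P x" using fpo_antisym[OF P x v(1) True] v(2) by (auto simp: dn_def)
  then have vC: "v \<notin> C" using Cx by blast
  have "insert v (C - {x}) \<in> chains_in r (dn r (P - {x}) v)"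
  proof -
    have "insert v (C - {x}) \<subseteq> dn r (P - {x}) v"
      using Cx below v fpo_refl[OF P v(1)] by (auto simp: dn_def)
    then show ?thesis using C(1) below fpo_refl[OF P v(1)] unfolding chains_in_def by blast
  qed
  moreover have fin: "finite (dn r (P - {x}) v)" using fpo_finite[OF P] by (simp add: dn_def)
  ultimately have "card (insert v (C - {x})) \<le> height r (dn r (P - {x}) v)" by (rule height_ge[rotated])
  moreover have "card C \<le> card (insert v (C - {x}))"
    using vC finC card_Diff_singleton_if[of C x] by (simp split: if_splits)
  ultimately have "k < height r (dn r (P - {x}) v)" using C(2) k by linarith
  moreover have "k < height r (dn r P v)" using height_mono[OF finite_dn[OF P] sub, of r] k by linarith
  ultimately show ?thesis by simp
qed

section \<open>Comparable pairs by height\<close>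

definition height_pairs :: "'a rel \<Rightarrow> nat \<Rightarrow> 'a set \<Rightarrow> ('a \<times> 'a) set" where
  "height_pairs r k S = {(v, w). v \<in> S \<and> w \<in> S \<and> v \<noteq> w \<and> (v, w) \<in> r \<and> height r (dn r S v) = k}"

lemma finite_height_pairs: "finite S \<Longrightarrow> finite (height_pairs r k S)"
  by (rule finite_subset[of _ "S \<times> S"]) (auto simp: height_pairs_def)

lemma height_pairs_le:
  assumes "order_isomorphic P r Q s" "finite P" "finite Q"
  shows "card (height_pairs r k P) \<le> card (height_pairs s k Q)"
proof -
  obtain f where f: "bij_betw f P Q" "\<forall>x\<in>P. \<forall>y\<in>P. (x, y) \<in> r \<longleftrightarrow> (f x, f y) \<in> s"
    using assms(1) unfolding order_isomorphic_def by blast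
  have inj: "inj_on f P" using f(1) by (simp add: bij_betw_def)
  have h: "height s (dn s Q (f v)) = height r (dn r P v)" if v: "v \<in> P" for v
  proof -
    have "dn r P v \<subseteq> P" by (rule dn_subset)
    then have "bij_betw f (dn r P v) (dn s Q (f v))"
      unfolding bij_betw_def iso_dn(1)[OF f v] using inj inj_on_subset by blast
    moreover have "\<forall>y\<in>dn r P v. \<forall>w\<in>dn r P v. (y, w) \<in> r \<longleftrightarrow> (f y, f w) \<in> s" using f(2) by (simp add: dn_def)
    ultimately have "order_isomorphic (dn r P v) r (dn s Q (f v)) s" unfolding order_isomorphic_def by blast
    then show ?thesis using height_iso assms(2) finite_subset[OF dn_subset] by metis
  qed
  show ?thesis
  proof (rule card_inj_on_le)
    show "inj_on (map_prod f f) (height_pairs r k P)"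
      by (rule inj_on_subset[OF map_prod_inj_on[OF inj inj]]) (auto simp: height_pairs_def)
    show "finite (height_pairs s k Q)" using finite_height_pairs[OF assms(3)] .
    show "map_prod f f ` height_pairs r k P \<subseteq> height_pairs s k Q"
    proof
      fix c assume "c \<in> map_prod f f ` height_pairs r k P"
      then obtain v w where vw: "c = (f v, f w)" "v \<in> P" "w \<in> P" "v \<noteq> w" "(v, w) \<in> r" "height r (dn r P v) = k"
        by (auto simp: height_pairs_def)
      then show "c \<in> height_pairs s k Q"
        using f(2) h bij_betwE[OF f(1)] inj_onD[OF inj, of v w] by (auto simp: height_pairs_def)
    qed
  qed
qed

lemma height_pairs_iso:
  assumes "order_isomorphic P r Q s" "finite P" "finite Q"
  shows "card (height_pairs r k P) = card (height_pairs s k Q)"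
  using height_pairs_le[OF assms] height_pairs_le[OF order_isomorphic_sym[OF assms(1)] assms(3,2)] by (rule antisym)

lemma height_pairs_minus:
  assumes P: "fpo P r" and x: "x \<in> P" and k: "k < height r (dn r P x)"
  shows "card (height_pairs r k (P - {x})) + card {v \<in> P. (v, x) \<in> r \<and> v \<noteq> x \<and> height r (dn r P v) = k}
    = card (height_pairs r k P)"
proof -
  let ?A = "{v \<in> P. (v, x) \<in> r \<and> v \<noteq> x \<and> height r (dn r P v) = k}"
  have "height_pairs r k P = height_pairs r k (P - {x}) \<union> (\<lambda>v. (v, x)) ` ?A"
  proof (rule set_eqI)
    fix c :: "'a \<times> 'a"
    obtain v w where c: "c = (v, w)" by (cases c)
    have "v \<noteq> x" if "height r (dn r P v) = k" using that k by auto
    then show "c \<in> height_pairs r k P \<longleftrightarrow> c \<in> height_pairs r k (P - {x}) \<union> (\<lambda>v. (v, x)) ` ?A"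
      using height_minus[OF P x _ _ k, of v] x unfolding c height_pairs_def by auto
  qed
  moreover have "height_pairs r k (P - {x}) \<inter> (\<lambda>v. (v, x)) ` ?A = {}" by (auto simp: height_pairs_def)
  moreover have "finite (height_pairs r k (P - {x}))" "finite ?A" using fpo_finite[OF P] finite_height_pairs[of "P - {x}" r k] by auto
  ultimately have "card (height_pairs r k P) = card (height_pairs r k (P - {x})) + card ((\<lambda>v. (v, x)) ` ?A)"
    by (simp add: card_Un_disjoint)
  then show ?thesis by (simp add: card_image inj_on_def)
qed

lemma order_isomorphic_add_top:
  assumes iso: "order_isomorphic (P - {w}) r (Q - {y}) s" and P: "fpo P r" "w \<in> P" "dn r P w = P"
    and Q: "fpo Q s" "y \<in> Q" "dn s Q y = Q"
  shows "order_isomorphic P r Q s"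
proof -
  obtain f where f: "bij_betw f (P - {w}) (Q - {y})" "\<forall>u\<in>P - {w}. \<forall>v\<in>P - {w}. (u, v) \<in> r \<longleftrightarrow> (f u, f v) \<in> s"
    using iso unfolding order_isomorphic_def by blast
  define g where "g v = (if v = w then y else f v)" for v
  have fQ: "f v \<in> Q" "f v \<noteq> y" if "v \<in> P" "v \<noteq> w" for v using bij_betwE[OF f(1)] that by auto
  have "bij_betw g (P - {w}) (Q - {y})" using f(1) by (subst bij_betw_cong[of _ g f]) (auto simp: g_def)
  moreover have "bij_betw g {w} {y}" by (simp add: g_def)
  ultimately have "bij_betw g (P - {w} \<union> {w}) (Q - {y} \<union> {y})" by (rule bij_betw_combine) auto
  moreover have "P - {w} \<union> {w} = P" "Q - {y} \<union> {y} = Q" using P(2) Q(2) by auto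
  ultimately have b: "bij_betw g P Q" by simp
  have topP: "(v, w) \<in> r" if "v \<in> P" for v using P(3) that by (auto simp: dn_def)
  have topQ: "(v, y) \<in> s" if "v \<in> Q" for v using Q(3) that by (auto simp: dn_def)
  have wP: "(w, v) \<in> r \<longleftrightarrow> v = w" if "v \<in> P" for v
    using fpo_antisym[OF P(1,2) that] topP[OF that] fpo_refl[OF P(1,2)] by blast
  have yQ: "(y, v) \<in> s \<longleftrightarrow> v = y" if "v \<in> Q" for v
    using fpo_antisym[OF Q(1,2) that] topQ[OF that] fpo_refl[OF Q(1,2)] by blast
  have "(u, v) \<in> r \<longleftrightarrow> (g u, g v) \<in> s" if "u \<in> P" "v \<in> P" for u v
  proof (cases "u = w")
    case True
    then show ?thesis using wP[OF that(2)] yQ[of "g v"] fQ[OF that(2)] Q(2) unfolding g_def by auto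
  next
    case u: False
    show ?thesis
    proof (cases "v = w")
      case True
      then show ?thesis using u topP[OF that(1)] topQ fQ[OF that(1)] by (simp add: g_def)
    next
      case False
      then show ?thesis using u f(2) that by (simp add: g_def)
    qed
  qed
  then show ?thesis using b unfolding order_isomorphic_def by blast
qed

text \<open>Among the points of \<open>Q\<close> with the card of \<open>w\<close>, let
  \<open>y\<close> have the largest ideal. If \<open>y\<close> is not greatest, the degree sum makes
  it comparable to everything, so it is alone at its ideal size in \<open>Q\<close>, and by the
  reconstructed counts at most one point of \<open>P\<close> has that size. Hence
  \<open>two_down\<close> fails, and the twin of \<open>y\<close> has the same card and a larger
  ideal.\<close>

lemma greatest_element_reconstructible:
  assumes P: "fpo P r" and Q: "fpo Q s" and hyp: "hypomorphic P r Q s" and n4: "4 \<le> card P"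
    and w: "w \<in> P" "dn r P w = P"
  shows "order_isomorphic P r Q s"
proof -
  let ?Y = "{y \<in> Q. order_isomorphic (Q - {y}) s (P - {w}) r}"
  have finQ: "finite Q" and n4Q: "4 \<le> card Q" and hyp': "hypomorphic Q s P r"
    using fpo_finite[OF Q] hypomorphic_card[OF hyp] n4 hypomorphic_sym[OF hyp] by auto
  obtain \<pi> where p: "bij_betw \<pi> P Q" "\<forall>v\<in>P. order_isomorphic (P - {v}) r (Q - {\<pi> v}) s"
    using hyp unfolding hypomorphic_def by blast
  have "\<pi> w \<in> ?Y" using p(2) w(1) bij_betwE[OF p(1)] order_isomorphic_sym by blast
  moreover have "finite ((\<lambda>y. card (dn s Q y)) ` ?Y)" using finQ by simp
  ultimately have "Max ((\<lambda>y. card (dn s Q y)) ` ?Y) \<in> (\<lambda>y. card (dn s Q y)) ` ?Y" by (intro Max_in) auto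
  then obtain y where y: "y \<in> ?Y" "card (dn s Q y) = Max ((\<lambda>y. card (dn s Q y)) ` ?Y)" by auto
  have mx: "card (dn s Q v) \<le> card (dn s Q y)" if "v \<in> ?Y" for v
    unfolding y(2) using \<open>finite ((\<lambda>y. card (dn s Q y)) ` ?Y)\<close> that by (intro Max_ge) auto
  have yQ: "y \<in> Q" "order_isomorphic (Q - {y}) s (P - {w}) r" using y(1) by auto
  note P0 = P and Q0 = Q and hyp0 = hyp and n40 = n4 and finQ0 = finQ
  have "dn s Q y = Q"
  proof (rule ccontr)
    assume "dn s Q y \<noteq> Q"
    then have "dn s Q y \<subset> Q" using dn_subset[of s Q y] by blast
    then have lt: "card (dn s Q y) < card (dn r P w)"
      using psubset_card_mono[OF finQ] hypomorphic_card[OF hyp] w(2) by simp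
    interpret removal_pair Q s y P r w
      by unfold_locales (use P Q hyp' n4Q yQ w(1) lt in auto)
    have "up r P w = {w}"
      using fpo_antisym[OF P0 w(1)] w fpo_refl[OF P0 w(1)] by (auto simp: up_def dn_def)
    then have "card (dn s Q y) + card (up s Q y) = Suc (card Q)"
      using degree_sum w(2) hypomorphic_card[OF hyp0] by simp
    moreover have "dn s Q y \<inter> up s Q y = {y}"
      using fpo_antisym[OF Q0 _ yQ(1)] dn_self[OF Q0 yQ(1)] up_self[OF Q0 yQ(1)] by (auto simp: dn_def up_def)
    ultimately have "card (dn s Q y \<union> up s Q y) = card Q"
      using card_Un_Int[OF finite_dn[OF Q0] finite_up[OF Q0], of y y] by simp
    moreover have "dn s Q y \<union> up s Q y \<subseteq> Q" by (auto simp: dn_def up_def)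
    ultimately have all: "dn s Q y \<union> up s Q y = Q" using card_subset_eq[OF finQ0] by blast
    have "v = y" if "v \<in> Q" "card (dn s Q v) = card (dn s Q y)" for v
    proof (rule ccontr)
      assume ne: "v \<noteq> y"
      have "(v, y) \<in> s \<or> (y, v) \<in> s" using all that(1) by (auto simp: dn_def up_def)
      then show False using card_dn_less[OF Q0 that(1) yQ(1)] card_dn_less[OF Q0 yQ(1) that(1)] ne that(2) by auto
    qed
    then have "{v \<in> Q. card (dn s Q v) = card (dn s Q y)} \<subseteq> {y}" by blast
    then have "dn_count s (card (dn s Q y)) Q \<le> card {y}" unfolding dn_count_def by (rule card_mono[rotated]) simp
    then have "dn_count r (card (dn s Q y)) P \<le> 1" using hypomorphic_dn_count[OF P0 Q0 hyp0 n40] by simp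
    moreover have "card {v \<in> P. (v, w) \<in> r \<and> card (dn r P v) = card (dn s Q y)} \<le> dn_count r (card (dn s Q y)) P"
      unfolding dn_count_def using fpo_finite[OF P0] by (intro card_mono) auto
    ultimately have "\<not> two_down" unfolding two_down_def by linarith
    then have "z \<in> classmates Q s (P - {w}) r (Suc (card (dn s Q y))) (card (up s Q y) - 1)"
      by (rule z_classmate) (use yQ in \<open>simp add: classmates_def\<close>)
    then have "z \<in> ?Y" "card (dn s Q z) = Suc (card (dn s Q y))" by (auto simp: classmates_def)
    then show False using mx[of z] by simp
  qed
  then show ?thesis by (intro order_isomorphic_add_top[OF order_isomorphic_sym[OF yQ(2)] P w Q yQ(1)])
qed

text \<open>For a pair \<open>(v, w)\<close> any point other than \<open>w\<close> that is not below
  \<open>v\<close> is irrelevant. If there is none, \<open>w\<close> is a greatest element, and the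
  orders are isomorphic.\<close>

lemma hypomorphic_height_pairs:
  assumes P: "fpo P r" and Q: "fpo Q s" and hyp: "hypomorphic P r Q s" and n4: "4 \<le> card P"
  shows "card (height_pairs r k P) = card (height_pairs s k Q)"
proof (cases "order_isomorphic P r Q s")
  case True
  then show ?thesis by (rule height_pairs_iso) (use P Q in \<open>auto simp: fpo_finite\<close>)
next
  case False
  have n4Q: "4 \<le> card Q" using hypomorphic_card[OF hyp] n4 by simp
  have noP: "dn r P w \<noteq> P" if "w \<in> P" for w
    using greatest_element_reconstructible[OF P Q hyp n4 that] False by blast
  have noQ: "dn s Q w \<noteq> Q" if "w \<in> Q" for w
    using greatest_element_reconstructible[OF Q P hypomorphic_sym[OF hyp] n4Q that] False order_isomorphic_sym[of Q s P r] by blast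
  have irr: "\<exists>t\<in>A. \<forall>S\<subseteq>A - {t}. (c \<in> height_pairs u k (insert t S)) = (c \<in> height_pairs u k S)"
    if A: "fpo A u" "\<And>w. w \<in> A \<Longrightarrow> dn u A w \<noteq> A" and c: "c \<in> A \<times> A" for A :: "'z set" and u c
  proof -
    obtain v w where vw: "c = (v, w)" "v \<in> A" "w \<in> A" using c by blast
    show ?thesis
    proof (cases "(v, w) \<in> u \<and> v \<noteq> w")
      case False
      then have "c \<notin> height_pairs u k S" for S by (auto simp: vw(1) height_pairs_def)
      then show ?thesis using vw(2) by blast
    next
      case True
      have "\<exists>t\<in>A. t \<notin> dn u A v \<and> t \<noteq> w"
      proof (rule ccontr)
        assume h: "\<not> ?thesis"
        have "dn u A v \<subseteq> dn u A w" using dn_mono[OF A(1) vw(2,3)] True by blast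
        then have "A \<subseteq> dn u A w" using h dn_self[OF A(1) vw(3)] by blast
        then show False using A(2)[OF vw(3)] dn_subset[of u A w] by blast
      qed
      then obtain t where t: "t \<in> A" "(t, v) \<notin> u" "t \<noteq> w" by (auto simp: dn_def)
      have tv: "t \<noteq> v" using t(2) fpo_refl[OF A(1) vw(2)] by blast
      have d: "dn u (insert t S) v = dn u S v" for S using t(2) by (auto simp: dn_def)
      have "(c \<in> height_pairs u k (insert t S)) = (c \<in> height_pairs u k S)" for S
        using tv t(3) by (auto simp: height_pairs_def d vw(1))
      then show ?thesis using t(1) by blast
    qed
  qed
  have fin: "finite P" "finite Q" using fpo_finite P Q by blast+
  have sub: "{c \<in> A \<times> A. c \<in> height_pairs u k S} = height_pairs u k S" if "S \<subseteq> A" for A S :: "'z set" and u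
    using that by (auto simp: height_pairs_def)
  have "card {c \<in> P \<times> P. c \<in> height_pairs r k P} = card {c \<in> Q \<times> Q. c \<in> height_pairs s k Q}"
  proof (rule configuration_count_eq[OF hyp])
    show "finite P" "finite Q" "finite (P \<times> P)" "finite (Q \<times> Q)" using fin by auto
    show "card {c \<in> P \<times> P. c \<in> height_pairs r k S} = card {c \<in> Q \<times> Q. c \<in> height_pairs s k S'}"
      if "S \<subseteq> P" "S' \<subseteq> Q" "order_isomorphic S r S' s" for S S'
      unfolding sub[OF that(1)] sub[OF that(2)]
      by (rule height_pairs_iso[OF that(3)]) (use that(1,2) fin finite_subset in auto)
    show "\<exists>t\<in>P. \<forall>S\<subseteq>P - {t}. (c \<in> height_pairs r k (insert t S)) = (c \<in> height_pairs r k S)" if "c \<in> P \<times> P" for c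
      by (rule irr[OF P noP that])
    show "\<exists>t\<in>Q. \<forall>S\<subseteq>Q - {t}. (c \<in> height_pairs s k (insert t S)) = (c \<in> height_pairs s k S)" if "c \<in> Q \<times> Q" for c
      by (rule irr[OF Q noQ that])
  qed
  then show ?thesis unfolding sub[OF order_refl] .
qed

text \<open>At each height smaller than that of \<open>x\<close> equally many points lie below
  \<open>x\<close> and below \<open>q\<close>. This accounts for everything strictly below
  \<open>x\<close>, while \<open>q\<close> has in addition a point of exactly the height of
  \<open>x\<close> below it. Hence equal ideal sizes and equal cards give equal heights.\<close>

lemma height_less_imp_card_less:
  assumes P: "fpo P r" and Q: "fpo Q s" and hyp: "hypomorphic P r Q s" and n4: "4 \<le> card P"
    and x: "x \<in> P" and q: "q \<in> Q" and iso: "order_isomorphic (P - {x}) r (Q - {q}) s"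
    and h: "height r (dn r P x) < height s (dn s Q q)"
  shows "card (dn r P x) < card (dn s Q q)"
proof -
  let ?h = "height r (dn r P x)"
  let ?A = "{v \<in> P. (v, x) \<in> r \<and> v \<noteq> x}" and ?B = "{v \<in> Q. (v, q) \<in> s \<and> v \<noteq> q}"
  have fin: "finite P" "finite Q" using fpo_finite P Q by blast+
  have level: "card {v \<in> ?A. height r (dn r P v) = k} = card {v \<in> ?B. height s (dn s Q v) = k}" if k: "k < ?h" for k
  proof -
    have "card (height_pairs r k (P - {x})) = card (height_pairs s k (Q - {q}))"
      by (rule height_pairs_iso[OF iso]) (use fin in auto)
    then show ?thesis
      using height_pairs_minus[OF P x k] height_pairs_minus[OF Q q, of k] k h hypomorphic_height_pairs[OF P Q hyp n4, of k]
      by (simp add: conj_assoc)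
  qed
  have finAB: "finite ?A" "finite ?B" using fin by auto
  have AB: "card {v \<in> ?A. height r (dn r P v) < ?h} = card {v \<in> ?B. height s (dn s Q v) < ?h}"
    unfolding card_fibers[OF finAB(1)] card_fibers[OF finAB(2)] by (rule sum.cong[OF refl]) (rule level, simp)
  have "{v \<in> ?A. height r (dn r P v) < ?h} = dn r P x - {x}"
    using height_dn_less[OF P _ x] by (auto simp: dn_def)
  then have c1: "card {v \<in> ?A. height r (dn r P v) < ?h} = card (dn r P x) - 1"
    using dn_self[OF P x] finite_dn[OF P] by simp
  have "{x} \<in> chains_in r (dn r P x)" using dn_self[OF P x] fpo_refl[OF P x] by (simp add: chains_in_def)
  then have h0: "0 < ?h" using height_ge[OF finite_dn[OF P]] by fastforce
  obtain u where u: "u \<in> Q" "(u, q) \<in> s" "u \<noteq> q" "height s (dn s Q u) = ?h"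
    using ex_below_of_height[OF Q q h h0] by blast
  have "{v \<in> ?B. height s (dn s Q v) < ?h} \<subseteq> dn s Q q - {q} - {u}" using u(4) by (auto simp: dn_def)
  then have "card {v \<in> ?B. height s (dn s Q v) < ?h} \<le> card (dn s Q q - {q} - {u})"
    using finite_dn[OF Q] by (intro card_mono) auto
  moreover have uq: "u \<in> dn s Q q - {q}" using u by (simp add: dn_def)
  then have "card (dn s Q q - {q} - {u}) = card (dn s Q q - {q}) - 1" "0 < card (dn s Q q - {q})"
    using finite_dn[OF Q] by (auto simp: card_gt_0_iff)
  moreover have "card (dn s Q q - {q}) = card (dn s Q q) - 1" using dn_self[OF Q q] finite_dn[OF Q] by simp
  ultimately show ?thesis using AB c1 card_dn_pos[OF P x] by linarith
qed

lemma classmates_height: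
  assumes P: "fpo P r" and Q: "fpo Q s" and hyp: "hypomorphic P r Q s" and n4: "4 \<le> card P"
    and x: "x \<in> classmates P r C c k l" and q: "q \<in> classmates Q s C c k l"
  shows "height r (dn r P x) = height s (dn s Q q)"
proof -
  have n4Q: "4 \<le> card Q" using hypomorphic_card[OF hyp] n4 by simp
  have xq: "x \<in> P" "q \<in> Q" "card (dn r P x) = card (dn s Q q)" using x q by (auto simp: classmates_def)
  show ?thesis
    using height_less_imp_card_less[OF P Q hyp n4 xq(1,2) classmates_iso[OF x q]]
      height_less_imp_card_less[OF Q P hypomorphic_sym[OF hyp] n4Q xq(2,1) classmates_iso[OF q x]] xq(3)
    by linarith
qed

text \<open>A longest chain in the ideal cannot be extended, so it contains \<open>x\<close> and its
  least element is minimal in \<open>P\<close>.\<close>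

lemma order_rank_height:
  assumes fin: "finite P" and po: "partial_order_on P le" and x: "x \<in> P"
  shows "Suc (order_rank P le x) = height le (dn le P x)"
proof -
  have P: "fpo P le" using fin po by (rule partial_order_fpo)
  let ?R = "{k. \<exists>m\<in>minimal_elements P le. \<exists>C. chain_from_to P le m x C \<and> card C = k + 1}"
  let ?h = "height le (dn le P x)"
  have finD: "finite (dn le P x)" using finite_dn[OF P] .
  obtain C where C: "C \<in> chains_in le (dn le P x)" "card C = ?h" using height_chain[OF finD] by metis
  have Cx: "C \<subseteq> dn le P x" using C(1) by (simp add: chains_in_def)
  have CP: "C \<subseteq> P" "\<And>c. c \<in> C \<Longrightarrow> (c, x) \<in> le" using Cx by (auto simp: dn_def)
  have finC: "finite C" using Cx finD by (rule finite_subset)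
  have maximal: "y \<in> C" if "insert y C \<in> chains_in le (dn le P x)" for y
  proof (rule ccontr)
    assume "y \<notin> C"
    then have "card (insert y C) = Suc ?h" using finC C(2) by simp
    then show False using height_ge[OF finD that] by simp
  qed
  have xC: "x \<in> C"
    by (rule maximal) (use C(1) CP dn_self[OF P x] fpo_refl[OF P x] in \<open>auto simp: chains_in_def\<close>)
  have "C \<in> chains_in (le\<inverse>) P" using C(1) CP by (auto simp: chains_in_def)
  then obtain m where m: "m \<in> C" "C \<subseteq> dn (le\<inverse>) P m" using chain_top[of P "le\<inverse>" C] P xC by auto
  have mC: "(m, c) \<in> le" if "c \<in> C" for c using m(2) that by (auto simp: up_def)
  have mP: "m \<in> P" using m(1) CP by blast
  have "m \<in> minimal_elements P le"
    unfolding minimal_elements_def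
  proof (intro CollectI conjI ballI impI)
    fix y assume y: "y \<in> P" "(y, m) \<in> le"
    have yc: "(y, c) \<in> le" if "c \<in> C" for c
      using fpo_trans[OF P y(1) mP _ y(2) mC[OF that]] that CP by blast
    have "insert y C \<in> chains_in le (dn le P x)"
      using C(1) yc xC y(1) fpo_refl[OF P y(1)] by (auto simp: chains_in_def dn_def)
    then have "y \<in> C" by (rule maximal)
    then show "y = m" using fpo_antisym[OF P y(1) mP y(2)] mC by blast
  qed (rule mP)
  moreover have "chain_from_to P le m x C"
    unfolding chain_from_to_def Chains_def using C(1) CP m(1) xC mC by (auto simp: chains_in_def)
  moreover have "0 < card C" using xC finC by (auto simp: card_gt_0_iff)
  then have pos: "0 < ?h" by (simp only: C(2))
  ultimately have inR: "?h - 1 \<in> ?R" using C(2) by (intro CollectI bexI[of _ m] exI[of _ C]) auto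
  have le: "k \<le> ?h - 1" if kR: "k \<in> ?R" for k
  proof -
    obtain m C where "chain_from_to P le m x C" "card C = k + 1" using kR by blast
    then have "C \<in> chains_in le (dn le P x)" by (auto simp: chain_from_to_def Chains_def chains_in_def dn_def)
    then show ?thesis using height_ge[OF finD] \<open>card C = k + 1\<close> by fastforce
  qed
  have "finite ?R" by (rule finite_subset[of _ "{..?h - 1}"]) (use le in auto)
  then have "order_rank P le x = ?h - 1" unfolding order_rank_def using le inR by (intro Max_eqI)
  then show ?thesis using pos by simp
qed

section \<open>Decks\<close>

lemma unlabelled_card_eq_iff:
  assumes fin: "finite P" and po: "partial_order_on P leP"
  shows "unlabelled_card P leP x = unlabelled_card Q leQ y \<longleftrightarrow> order_isomorphic (P - {x}) leP (Q - {y}) leQ"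
proof -
  have "partial_order_on (P - {x}) (Restr leP (P - {x}))"
    using po unfolding partial_order_on_def preorder_on_def
    by (auto simp: refl_on_def intro: trans_Restr antisym_subset)
  then have "unlabelled_card P leP x = unlabelled_card Q leQ y
      \<longleftrightarrow> order_isomorphic (P - {x}) (Restr leP (P - {x})) (Q - {y}) (Restr leQ (Q - {y}))"
    unfolding unlabelled_card_def by (rule iso_type_eq_iff[rotated]) (use fin in simp)
  also have "\<dots> \<longleftrightarrow> order_isomorphic (P - {x}) leP (Q - {y}) leQ"
  proof -
    have e: "(\<forall>u\<in>P - {x}. \<forall>v\<in>P - {x}. (u, v) \<in> Restr leP (P - {x}) \<longleftrightarrow> (f u, f v) \<in> Restr leQ (Q - {y}))
      \<longleftrightarrow> (\<forall>u\<in>P - {x}. \<forall>v\<in>P - {x}. (u, v) \<in> leP \<longleftrightarrow> (f u, f v) \<in> leQ)"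
      if "bij_betw f (P - {x}) (Q - {y})" for f
      using bij_betwE[OF that] by simp
    show ?thesis unfolding order_isomorphic_def by (intro ex_cong1 conj_cong[OF refl]) (rule e)
  qed
  finally show ?thesis .
qed

lemma count_cards_removing:
  assumes "finite S"
  shows "count (cards_removing P le S) \<tau> = card {x \<in> S. unlabelled_card P le x = \<tau>}"
proof -
  have "count (cards_removing P le S) \<tau> = (\<Sum>x\<in>unlabelled_card P le -` {\<tau>} \<inter> S. 1)"
    unfolding cards_removing_def count_image_mset using assms
    by (intro sum.cong) (auto simp: count_mset_set)
  also have "unlabelled_card P le -` {\<tau>} \<inter> S = {x \<in> S. unlabelled_card P le x = \<tau>}" by auto
  finally show ?thesis by simp
qed

text \<open>Equal multiplicities give a bijection for each isomorphism type of card, and these are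
  glued.\<close>

lemma deck_eq_hypomorphic:
  assumes P: "finite P" "partial_order_on P leP" and Q: "finite Q" "partial_order_on Q leQ"
    and deck: "deck Q leQ = deck P leP"
  shows "hypomorphic P leP Q leQ"
proof -
  let ?f = "unlabelled_card P leP" and ?g = "unlabelled_card Q leQ"
  have c: "card {x \<in> P. ?f x = \<tau>} = card {y \<in> Q. ?g y = \<tau>}" for \<tau>
    using count_cards_removing[OF P(1), of P leP \<tau>] count_cards_removing[OF Q(1), of Q leQ \<tau>] deck
    by (simp add: deck_def)
  have "\<forall>\<tau>. \<exists>h. bij_betw h {x \<in> P. ?f x = \<tau>} {y \<in> Q. ?g y = \<tau>}"
    by (intro allI finite_same_card_bij[OF _ _ c]) (use P Q in auto)
  from choice[OF this] obtain H where "\<forall>\<tau>. bij_betw (H \<tau>) {x \<in> P. ?f x = \<tau>} {y \<in> Q. ?g y = \<tau>}" ..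
  then have H: "bij_betw (H \<tau>) {x \<in> P. ?f x = \<tau>} {y \<in> Q. ?g y = \<tau>}" for \<tau> by (rule spec)
  define \<pi> where "\<pi> x = H (?f x) x" for x
  have \<pi>: "\<pi> x \<in> Q" "?g (\<pi> x) = ?f x" if "x \<in> P" for x
    using bij_betwE[OF H[of "?f x"]] that by (auto simp: \<pi>_def)
  have "bij_betw \<pi> P Q"
    unfolding bij_betw_def
  proof
    show "inj_on \<pi> P"
    proof (rule inj_onI)
      fix x y assume xy: "x \<in> P" "y \<in> P" "\<pi> x = \<pi> y"
      then have e: "?f x = ?f y" using \<pi>(2)[OF xy(1)] \<pi>(2)[OF xy(2)] by simp
      have "inj_on (H (?f x)) {v \<in> P. ?f v = ?f x}" using H by (simp add: bij_betw_def)
      then show "x = y" by (rule inj_onD) (use xy e in \<open>auto simp: \<pi>_def\<close>)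
    qed
    show "\<pi> ` P = Q"
    proof (intro subset_antisym subsetI)
      fix y assume y: "y \<in> Q"
      have "H (?g y) ` {x \<in> P. ?f x = ?g y} = {v \<in> Q. ?g v = ?g y}" using H by (simp add: bij_betw_def)
      then have "y \<in> H (?g y) ` {x \<in> P. ?f x = ?g y}" using y by simp
      then obtain x where "x \<in> P" "?f x = ?g y" "y = H (?g y) x" by blast
      then show "y \<in> \<pi> ` P" by (intro image_eqI[of _ _ x]) (simp_all add: \<pi>_def)
    qed (use \<pi> in auto)
  qed
  moreover have "order_isomorphic (P - {v}) leP (Q - {\<pi> v}) leQ" if "v \<in> P" for v
    using \<pi>(2)[OF that] unlabelled_card_eq_iff[OF P, of v Q leQ "\<pi> v"] by simp
  ultimately show ?thesis unfolding hypomorphic_def by blast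
qed

text \<open>By \<open>classmates_height\<close> and the assumption \<open>same\<close>, the
  conditions \<Phi> and \<Psi> hold for all or for no members of a class, with the same answer in
  both orders. The equality of class sizes therefore carries over; the interior point
  \<open>e\<close> makes it available.\<close>

lemma interior_type_count:
  assumes P: "fpo P r" and Q: "fpo Q s" and hyp: "hypomorphic P r Q s" and n4: "4 \<le> card P"
    and same: "\<And>x y. x \<in> P \<Longrightarrow> y \<in> Q \<Longrightarrow> order_isomorphic (P - {x}) r (Q - {y}) s \<Longrightarrow> card (dn r P x) = card (dn s Q y)
      \<Longrightarrow> card (up r P x) = card (up s Q y) \<Longrightarrow> height r (dn r P x) = height s (dn s Q y) \<Longrightarrow> \<Phi> x = \<Psi> y"
    and e: "e \<in> P" "2 \<le> card (dn r P e)" "2 \<le> card (up r P e)"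
  shows "card {x \<in> P. order_isomorphic (P - {x}) r (P - {e}) r \<and> \<Phi> x}
    = card {y \<in> Q. order_isomorphic (Q - {y}) s (P - {e}) r \<and> \<Psi> y}"
proof -
  let ?C = "P - {e}"
  have eK: "e \<in> classmates P r ?C r (card (dn r P e)) (card (up r P e))"
    using e(1) by (simp add: classmates_def order_isomorphic_refl)
  let ?N = "card (dn r P e) + card (up r P e)"
  have n4Q: "4 \<le> card Q" using hypomorphic_card[OF hyp] n4 by simp
  have N: "card (dn u A v) + card (up u A v) = ?N"
    if "fpo A u" "hypomorphic A u P r" "4 \<le> card A" "v \<in> A" "order_isomorphic (A - {v}) u ?C r" for A :: "'z set" and u v
    by (rule deletion_degree_sum[OF that(1) P that(2-4) e(1) that(5)])
  have sP: "card {x \<in> P. order_isomorphic (P - {x}) r ?C r \<and> \<Phi> x} = (\<Sum>k\<le>?N. card {v \<in> classmates P r ?C r k (?N - k). \<Phi> v})"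
    by (rule card_classmates_sum[OF P N[OF P hypomorphic_refl n4]])
  have sQ: "card {y \<in> Q. order_isomorphic (Q - {y}) s ?C r \<and> \<Psi> y} = (\<Sum>k\<le>?N. card {v \<in> classmates Q s ?C r k (?N - k). \<Psi> v})"
    by (rule card_classmates_sum[OF Q N[OF Q hypomorphic_sym[OF hyp] n4Q]])
  have "card {v \<in> classmates P r ?C r k l. \<Phi> v} = card {v \<in> classmates Q s ?C r k l. \<Psi> v}" for k l
  proof -
    let ?X = "classmates P r ?C r k l" and ?Y = "classmates Q s ?C r k l"
    have c: "card ?X = card ?Y" by (rule classmates_card_eq[OF P Q hyp n4 eK e(2,3)])
    have fin: "finite ?X" "finite ?Y" using finite_classmates P Q by blast+
    have agree: "\<Phi> v = \<Psi> w" if v: "v \<in> ?X" and w: "w \<in> ?Y" for v w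
      by (rule same[OF _ _ classmates_iso[OF v w] _ _ classmates_height[OF P Q hyp n4 v w]])
        (use v w in \<open>auto simp: classmates_def\<close>)
    show ?thesis
    proof (cases "?X = {}")
      case True
      then have "?Y = {}" using c fin by simp
      then show ?thesis using True by simp
    next
      case False
      then have "?Y \<noteq> {}" using c fin by auto
      then obtain v w where v: "v \<in> ?X" and w: "w \<in> ?Y" using False by blast
      show ?thesis
      proof (cases "\<Phi> v")
        case True
        then have "{v \<in> ?X. \<Phi> v} = ?X" "{v \<in> ?Y. \<Psi> v} = ?Y" using agree v w by auto
        then show ?thesis using c by simp
      next
        case False
        then have none: "{v \<in> ?X. \<Phi> v} = {}" "{v \<in> ?Y. \<Psi> v} = {}" using agree v w by auto
        show ?thesis unfolding none by simp
      qed
    qed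
  qed
  then show ?thesis unfolding sP sQ by simp
qed

text \<open>A type that occurs in one of the two decks is the card of an interior point of that
  order, which serves as the reference point; types that occur in neither contribute
  nothing.\<close>

lemma interior_cards_eq:
  assumes P: "finite P" "partial_order_on P leP" "4 \<le> card P" and Q: "finite Q" "partial_order_on Q leQ"
    and hyp: "hypomorphic P leP Q leQ"
    and int: "\<And>x. x \<in> P \<Longrightarrow> \<Phi> x \<Longrightarrow> 2 \<le> card (dn leP P x) \<and> 2 \<le> card (up leP P x)"
    and int': "\<And>y. y \<in> Q \<Longrightarrow> \<Psi> y \<Longrightarrow> 2 \<le> card (dn leQ Q y) \<and> 2 \<le> card (up leQ Q y)"
    and same: "\<And>x y. x \<in> P \<Longrightarrow> y \<in> Q \<Longrightarrow> card (dn leP P x) = card (dn leQ Q y)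
      \<Longrightarrow> card (up leP P x) = card (up leQ Q y) \<Longrightarrow> height leP (dn leP P x) = height leQ (dn leQ Q y) \<Longrightarrow> \<Phi> x = \<Psi> y"
  shows "cards_removing Q leQ {y \<in> Q. \<Psi> y} = cards_removing P leP {x \<in> P. \<Phi> x}"
proof (rule multiset_eqI)
  fix \<tau>
  let ?f = "unlabelled_card P leP" and ?g = "unlabelled_card Q leQ"
  have fP: "fpo P leP" and fQ: "fpo Q leQ" using partial_order_fpo P Q by blast+
  have n4Q: "4 \<le> card Q" using hypomorphic_card[OF hyp] P(3) by simp
  have "card {x \<in> P. \<Phi> x \<and> ?f x = \<tau>} = card {y \<in> Q. \<Psi> y \<and> ?g y = \<tau>}"
  proof (cases "\<exists>e\<in>P. \<Phi> e \<and> ?f e = \<tau>")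
    case True
    then obtain e where e: "e \<in> P" "\<Phi> e" "?f e = \<tau>" by blast
    have "card {x \<in> P. order_isomorphic (P - {x}) leP (P - {e}) leP \<and> \<Phi> x}
        = card {y \<in> Q. order_isomorphic (Q - {y}) leQ (P - {e}) leP \<and> \<Psi> y}"
      by (rule interior_type_count[OF fP fQ hyp P(3) same e(1)]) (use int[OF e(1,2)] in auto)
    then show ?thesis
      unfolding e(3)[symmetric] unlabelled_card_eq_iff[OF P(1,2)] unlabelled_card_eq_iff[OF Q] by (simp add: conj_commute)
  next
    case no: False
    show ?thesis
    proof (cases "\<exists>e\<in>Q. \<Psi> e \<and> ?g e = \<tau>")
      case True
      then obtain e where e: "e \<in> Q" "\<Psi> e" "?g e = \<tau>" by blast
      have "card {y \<in> Q. order_isomorphic (Q - {y}) leQ (Q - {e}) leQ \<and> \<Psi> y}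
          = card {x \<in> P. order_isomorphic (P - {x}) leP (Q - {e}) leQ \<and> \<Phi> x}"
        by (rule interior_type_count[OF fQ fP hypomorphic_sym[OF hyp] n4Q same[symmetric] e(1)])
          (use int'[OF e(1,2)] in auto)
      then show ?thesis
        unfolding e(3)[symmetric] unlabelled_card_eq_iff[OF P(1,2)] unlabelled_card_eq_iff[OF Q] by (simp add: conj_commute)
    next
      case False
      then have none: "{x \<in> P. \<Phi> x \<and> ?f x = \<tau>} = {}" "{y \<in> Q. \<Psi> y \<and> ?g y = \<tau>} = {}" using no by blast+
      show ?thesis unfolding none by simp
    qed
  qed
  then show "count (cards_removing Q leQ {y \<in> Q. \<Psi> y}) \<tau> = count (cards_removing P leP {x \<in> P. \<Phi> x}) \<tau>"
    using P(1) Q(1) by (simp add: count_cards_removing conj_assoc)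
qed

lemma maximal_iff:
  assumes "fpo P le" "x \<in> P" shows "x \<in> maximal_elements P le \<longleftrightarrow> card (up le P x) < 2"
proof -
  have "x \<in> maximal_elements P le \<longleftrightarrow> up le P x = {x}"
    using up_self[OF assms] assms(2) by (auto simp: maximal_elements_def up_def)
  also have "\<dots> \<longleftrightarrow> card (up le P x) \<le> card {x}"
    using card_seteq[OF finite_up[OF assms(1)], of "{x}" x] up_self[OF assms] by auto
  finally show ?thesis by auto
qed

lemma minimal_iff:
  assumes "fpo P le" "x \<in> P" shows "x \<in> minimal_elements P le \<longleftrightarrow> card (dn le P x) < 2"
  using maximal_iff[of P "le\<inverse>" x] assms by (simp add: maximal_elements_def minimal_elements_def)

lemma height_le_card: "finite D \<Longrightarrow> height r D \<le> card D"
  using height_chain[of D r] card_mono[of D] by (metis (no_types, lifting) chains_in_def mem_Collect_eq)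

lemma cards_removing_split:
  assumes "finite P" "S \<subseteq> P"
  shows "deck P le = cards_removing P le S + cards_removing P le (P - S)"
proof -
  have "mset_set (S \<union> (P - S)) = mset_set S + mset_set (P - S)"
    using assms finite_subset by (intro mset_set_Union) auto
  moreover have "S \<union> (P - S) = P" using assms(2) by blast
  ultimately show ?thesis by (simp add: deck_def cards_removing_def)
qed

theorem theorem1p2:
  fixes P :: "'a set" and leP :: "'a rel"
    and Q :: "'b set" and leQ :: "'b rel"
  assumes "finite P" and "partial_order_on P leP"
    and "connected_order P leP" and "card P \<ge> 4"
    and "finite Q" and "partial_order_on Q leQ"
    and "deck Q leQ = deck P leP"
  shows "(\<forall>r>0. nonmaximal_rank_deck Q leQ r = nonmaximal_rank_deck P leP r)
    \<and> extremal_deck P leP = extremal_deck Q leQ"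
proof (intro conjI allI impI)
  note P = assms(1,2) and Q = assms(5,6)
  have fP: "fpo P leP" and fQ: "fpo Q leQ" using partial_order_fpo P Q by blast+
  have hyp: "hypomorphic P leP Q leQ" by (rule deck_eq_hypomorphic[OF P Q assms(7)])
  have inner: "cards_removing Q leQ {y \<in> Q. \<Psi> y} = cards_removing P leP {x \<in> P. \<Phi> x}"
    if "\<And>x. x \<in> P \<Longrightarrow> \<Phi> x \<Longrightarrow> 2 \<le> card (dn leP P x) \<and> 2 \<le> card (up leP P x)"
      "\<And>y. y \<in> Q \<Longrightarrow> \<Psi> y \<Longrightarrow> 2 \<le> card (dn leQ Q y) \<and> 2 \<le> card (up leQ Q y)"
      "\<And>x y. x \<in> P \<Longrightarrow> y \<in> Q \<Longrightarrow> card (dn leP P x) = card (dn leQ Q y)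
      \<Longrightarrow> card (up leP P x) = card (up leQ Q y) \<Longrightarrow> height leP (dn leP P x) = height leQ (dn leQ Q y) \<Longrightarrow> \<Phi> x = \<Psi> y"
    for \<Phi> \<Psi> by (rule interior_cards_eq[OF P assms(4) Q hyp that])
  show "nonmaximal_rank_deck Q leQ k = nonmaximal_rank_deck P leP k" if k: "0 < k" for k
  proof -
    have set: "{v \<in> A - maximal_elements A le. order_rank A le v = k}
        = {v \<in> A. 2 \<le> card (up le A v) \<and> height le (dn le A v) = Suc k}"
      if "finite A" "partial_order_on A le" for A :: "'z set" and le
      using order_rank_height[OF that] maximal_iff[OF partial_order_fpo[OF that]] by fastforce
    \<comment> \<open>Positive rank excludes minimal points: a height of at least 2 requires two
      points in the ideal.\<close>
    have dn2: "2 \<le> card (dn le A v)" if "fpo A le" "height le (dn le A v) = Suc k" for A :: "'z set" and le v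
      using height_le_card[OF finite_dn[OF that(1)], of le v] that(2) k by linarith
    show ?thesis
      unfolding nonmaximal_rank_deck_def set[OF P] set[OF Q]
      by (rule inner) (use dn2[OF fP] dn2[OF fQ] in auto)
  qed
  \<comment> \<open>The extremal deck is what remains of the full deck once the interior cards are
    taken away.\<close>
  have split: "deck A le = cards_removing A le {v \<in> A. 2 \<le> card (dn le A v) \<and> 2 \<le> card (up le A v)} + extremal_deck A le"
    if "fpo A le" for A :: "'z set" and le
  proof -
    have "A - {v \<in> A. 2 \<le> card (dn le A v) \<and> 2 \<le> card (up le A v)} = maximal_elements A le \<union> minimal_elements A le"
    proof (rule set_eqI)
      fix v
      show "v \<in> A - {v \<in> A. 2 \<le> card (dn le A v) \<and> 2 \<le> card (up le A v)}
          \<longleftrightarrow> v \<in> maximal_elements A le \<union> minimal_elements A le"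
      proof (cases "v \<in> A")
        case True
        show ?thesis
          unfolding Un_iff maximal_iff[OF that True] minimal_iff[OF that True] using True by auto
      next
        case False
        then show ?thesis by (simp add: maximal_elements_def minimal_elements_def)
      qed
    qed
    then show ?thesis
      using cards_removing_split[OF fpo_finite[OF that], of "{v \<in> A. 2 \<le> card (dn le A v) \<and> 2 \<le> card (up le A v)}" le]
      by (simp add: extremal_deck_def)
  qed
  have "cards_removing Q leQ {v \<in> Q. 2 \<le> card (dn leQ Q v) \<and> 2 \<le> card (up leQ Q v)}
      = cards_removing P leP {v \<in> P. 2 \<le> card (dn leP P v) \<and> 2 \<le> card (up leP P v)}"
    by (rule inner) auto
  then show "extremal_deck P leP = extremal_deck Q leQ"
    using split[OF fP] split[OF fQ] assms(7) by simp
qed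

end
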